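(* Let $\mathcal{C}$ be an abelian monoidal category, let $\mathcal{M}$ be an abelian left $\mathcal{C}$-module category whose action $\triangleright$ is right exact in both variables, and let $S,T$ be right exact lax $\mathcal{C}$-module monads on $\mathcal{M}$. Endow $\mathbf{EM}(T)$ and $\mathbf{EM}(S)$ with the $\mathcal{C}$-module structures defined by Linton coequalizers. Then the faithful functor $$\mathcal{C}\mathsf{EW}\colon\mathbf{LaxRex}(\mathbf{EM}(T),\mathbf{EM}(S))\to S\text{-}\mathbf{Biact}_{\mathcal{C}}\text{-}T,\qquad \Phi\mapsto R_{\mathbf{EM}(S)}\circ\Phi\circ L_{\mathbf{EM}(T)},$$ from the category of right exact lax $\mathcal{C}$-module functors $\mathbf{EM}(T)\to\mathbf{EM}(S)$ (with $\mathcal{C}$-module transformations) to the category of lax $\mathcal{C}$-module $S$-$T$-biact functors, is an equivalence of categories.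
   Context: All categories and functors are linear over a fixed field. A lax $\mathcal{C}$-module functor $F$ has coherent natural maps $F_{\mathsf a}\colon V\triangleright F(M)\to F(V\triangleright M)$; a lax $\mathcal{C}$-module monad is a monad whose functor is lax $\mathcal{C}$-module and whose unit $\eta$ and multiplication $\mu$ are $\mathcal{C}$-module transformations. $L_{\mathbf{EM}(T)}\colon\mathcal{M}\to\mathbf{EM}(T)$ and $R_{\mathbf{EM}(T)}\colon\mathbf{EM}(T)\to\mathcal{M}$ are the free and forgetful functors, with counit $\varepsilon_{\mathbf{EM}(T)}$; $\nabla_M\colon T(M)\to M$ denotes the action on $M\in\mathbf{EM}(T)$. Module structure on $\mathbf{EM}(T)$: $V\blacktriangleright M$ is the coequalizer in $\mathbf{EM}(T)$ of $T(V\triangleright\nabla_M)$ and $\mu_{V\triangleright M}\circ T((T_{\mathsf a})_{V,M})\colon T(V\triangleright T(M))\rightrightarrows T(V\triangleright M)$. Let $q_{V,M}\colon V\triangleright M\to V\blacktriangleright M$ be $\eta_{V\triangleright M}$ followed by the projection. The associators and unitors of $\blacktriangleright$ are the unique isomorphisms in $\mathbf{EM}(T)$ compatible, via the maps $q$, with those of $\triangleright$. There are canonical isomorphisms $V\blacktriangleright T(M)\cong T(V\triangleright M)$, making $L_{\mathbf{EM}(T)}$ strong, and $R_{\mathbf{EM}(T)}$ is lax $\mathcal{C}$-module with structure maps $q_{V,M}$; the same holds for $S$. A lax $\mathcal{C}$-module $S$-$T$-biact functor is an $S$-$T$-bimodule object in the monoidal category of right exact lax $\mathcal{C}$-module endofunctors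 of $\mathcal{M}$: a right exact lax $\mathcal{C}$-module endofunctor $F$ with $\mathcal{C}$-module transformations $F_{\mathsf{la}}\colon S\circ F\Rightarrow F$ and $F_{\mathsf{ra}}\colon F\circ T\Rightarrow F$, each unital and associative, with $F_{\mathsf{la}}\circ(S F_{\mathsf{ra}})=F_{\mathsf{ra}}\circ(F_{\mathsf{la}}T)$. Morphisms are $\mathcal{C}$-module transformations commuting with both actions. The functor $\mathcal{C}\mathsf{EW}$ sends $\Phi$ to $R_{\mathbf{EM}(S)}\Phi L_{\mathbf{EM}(T)}$ with the composite lax $\mathcal{C}$-module structure, left action $R_{\mathbf{EM}(S)}\,\varepsilon_{\mathbf{EM}(S)}\,\Phi L_{\mathbf{EM}(T)}$ and right action $R_{\mathbf{EM}(S)}\Phi\,\varepsilon_{\mathbf{EM}(T)}\,L_{\mathbf{EM}(T)}$, and sends a transformation $t$ to $R_{\mathbf{EM}(S)}\,t\,L_{\mathbf{EM}(T)}$. *)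

theory Defs
  imports Main "HOL-Library.FuncSet"
begin

section \<open>Linear and abelian categories\<close>

text \<open>
  Every category carries its linear structure over the field \<open>'k\<close>. Arrows know their source and
  target, so hom-sets are pairwise disjoint. All operations are only meaningful on the carriers
  \<open>obs\<close> and \<open>arrs\<close>; \<open>zro X Y\<close> is the zero arrow from \<open>X\<close> to \<open>Y\<close>.
\<close>

record ('o, 'a, 'k) lincat =
  obs :: "'o set"
  arrs :: "'a set"
  src :: "'a \<Rightarrow> 'o"
  trg :: "'a \<Rightarrow> 'o"
  ide :: "'o \<Rightarrow> 'a"
  cmp :: "'a \<Rightarrow> 'a \<Rightarrow> 'a" (infixl "\<cdot>\<index>" 70)
  zro :: "'o \<Rightarrow> 'o \<Rightarrow> 'a"
  plus_arr :: "'a \<Rightarrow> 'a \<Rightarrow> 'a" (infixl "\<oplus>\<index>" 65)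
  scale_arr :: "'k \<Rightarrow> 'a \<Rightarrow> 'a" (infixr "\<star>\<index>" 75)

definition homset :: "('o, 'a, 'k, 'z) lincat_scheme \<Rightarrow> 'o \<Rightarrow> 'o \<Rightarrow> 'a set" where
  "homset A X Y = {f \<in> arrs A. src A f = X \<and> trg A f = Y}"

locale linear_category =
  fixes A :: "('o, 'a, 'k::field, 'z) lincat_scheme" (structure)
  assumes src_obs: "f \<in> arrs A \<Longrightarrow> src A f \<in> obs A"
    and trg_obs: "f \<in> arrs A \<Longrightarrow> trg A f \<in> obs A"
    and ide_hom: "X \<in> obs A \<Longrightarrow> ide A X \<in> homset A X X"
    and cmp_hom: "\<lbrakk>f \<in> homset A X Y; g \<in> homset A Y Z\<rbrakk> \<Longrightarrow> g \<cdot> f \<in> homset A X Z"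
    and ide_left: "f \<in> homset A X Y \<Longrightarrow> ide A Y \<cdot> f = f"
    and ide_right: "f \<in> homset A X Y \<Longrightarrow> f \<cdot> ide A X = f"
    and cmp_assoc: "\<lbrakk>f \<in> homset A W X; g \<in> homset A X Y; h \<in> homset A Y Z\<rbrakk>
                     \<Longrightarrow> h \<cdot> (g \<cdot> f) = (h \<cdot> g) \<cdot> f"
    and zro_hom: "\<lbrakk>X \<in> obs A; Y \<in> obs A\<rbrakk> \<Longrightarrow> zro A X Y \<in> homset A X Y"
    and plus_hom: "\<lbrakk>f \<in> homset A X Y; g \<in> homset A X Y\<rbrakk> \<Longrightarrow> f \<oplus> g \<in> homset A X Y"
    and scale_hom: "f \<in> homset A X Y \<Longrightarrow> c \<star> f \<in> homset A X Y"
    and plus_assoc: "\<lbrakk>f \<in> homset A X Y; g \<in> homset A X Y; h \<in> homset A X Y\<rbrakk>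
                     \<Longrightarrow> (f \<oplus> g) \<oplus> h = f \<oplus> (g \<oplus> h)"
    and plus_commute: "\<lbrakk>f \<in> homset A X Y; g \<in> homset A X Y\<rbrakk> \<Longrightarrow> f \<oplus> g = g \<oplus> f"
    and plus_zro: "f \<in> homset A X Y \<Longrightarrow> f \<oplus> zro A X Y = f"
    and plus_inverse: "f \<in> homset A X Y \<Longrightarrow> \<exists>g \<in> homset A X Y. f \<oplus> g = zro A X Y"
    and scale_plus: "\<lbrakk>f \<in> homset A X Y; g \<in> homset A X Y\<rbrakk> \<Longrightarrow> c \<star> (f \<oplus> g) = (c \<star> f) \<oplus> (c \<star> g)"
    and plus_scale: "f \<in> homset A X Y \<Longrightarrow> (c + d) \<star> f = (c \<star> f) \<oplus> (d \<star> f)"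
    and scale_scale: "f \<in> homset A X Y \<Longrightarrow> c \<star> (d \<star> f) = (c * d) \<star> f"
    and scale_one: "f \<in> homset A X Y \<Longrightarrow> 1 \<star> f = f"
    and cmp_plus_left: "\<lbrakk>f \<in> homset A X Y; g \<in> homset A Y Z; h \<in> homset A Y Z\<rbrakk>
                     \<Longrightarrow> (g \<oplus> h) \<cdot> f = (g \<cdot> f) \<oplus> (h \<cdot> f)"
    and cmp_plus_right: "\<lbrakk>f \<in> homset A X Y; g \<in> homset A X Y; h \<in> homset A Y Z\<rbrakk>
                     \<Longrightarrow> h \<cdot> (f \<oplus> g) = (h \<cdot> f) \<oplus> (h \<cdot> g)"
    and cmp_scale_left: "\<lbrakk>f \<in> homset A X Y; g \<in> homset A Y Z\<rbrakk> \<Longrightarrow> (c \<star> g) \<cdot> f = c \<star> (g \<cdot> f)"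
    and cmp_scale_right: "\<lbrakk>f \<in> homset A X Y; g \<in> homset A Y Z\<rbrakk> \<Longrightarrow> g \<cdot> (c \<star> f) = c \<star> (g \<cdot> f)"

definition is_iso :: "('o, 'a, 'k, 'z) lincat_scheme \<Rightarrow> 'a \<Rightarrow> bool" where
  "is_iso A f \<longleftrightarrow> f \<in> arrs A \<and>
     (\<exists>g \<in> homset A (trg A f) (src A f).
        g \<cdot>\<^bsub>A\<^esub> f = ide A (src A f) \<and> f \<cdot>\<^bsub>A\<^esub> g = ide A (trg A f))"

definition is_mono :: "('o, 'a, 'k, 'z) lincat_scheme \<Rightarrow> 'a \<Rightarrow> bool" where
  "is_mono A f \<longleftrightarrow> f \<in> arrs A \<and>
     (\<forall>Z. \<forall>u \<in> homset A Z (src A f). \<forall>v \<in> homset A Z (src A f).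
        f \<cdot>\<^bsub>A\<^esub> u = f \<cdot>\<^bsub>A\<^esub> v \<longrightarrow> u = v)"

definition is_epi :: "('o, 'a, 'k, 'z) lincat_scheme \<Rightarrow> 'a \<Rightarrow> bool" where
  "is_epi A f \<longleftrightarrow> f \<in> arrs A \<and>
     (\<forall>Z. \<forall>u \<in> homset A (trg A f) Z. \<forall>v \<in> homset A (trg A f) Z.
        u \<cdot>\<^bsub>A\<^esub> f = v \<cdot>\<^bsub>A\<^esub> f \<longrightarrow> u = v)"

definition is_kernel :: "('o, 'a, 'k, 'z) lincat_scheme \<Rightarrow> 'a \<Rightarrow> 'a \<Rightarrow> bool" where
  "is_kernel A f i \<longleftrightarrow> f \<in> arrs A \<and> i \<in> arrs A \<and> trg A i = src A f \<and>
     f \<cdot>\<^bsub>A\<^esub> i = zro A (src A i) (trg A f) \<and>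
     (\<forall>Z. \<forall>h \<in> homset A Z (src A f). f \<cdot>\<^bsub>A\<^esub> h = zro A Z (trg A f) \<longrightarrow>
        (\<exists>!u. u \<in> homset A Z (src A i) \<and> i \<cdot>\<^bsub>A\<^esub> u = h))"

definition is_cokernel :: "('o, 'a, 'k, 'z) lincat_scheme \<Rightarrow> 'a \<Rightarrow> 'a \<Rightarrow> bool" where
  "is_cokernel A f p \<longleftrightarrow> f \<in> arrs A \<and> p \<in> arrs A \<and> src A p = trg A f \<and>
     p \<cdot>\<^bsub>A\<^esub> f = zro A (src A f) (trg A p) \<and>
     (\<forall>Z. \<forall>h \<in> homset A (trg A f) Z. h \<cdot>\<^bsub>A\<^esub> f = zro A (src A f) Z \<longrightarrow>
        (\<exists>!u. u \<in> homset A (trg A p) Z \<and> u \<cdot>\<^bsub>A\<^esub> p = h))"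

definition is_coequalizer :: "('o, 'a, 'k, 'z) lincat_scheme \<Rightarrow> 'a \<Rightarrow> 'a \<Rightarrow> 'a \<Rightarrow> bool" where
  "is_coequalizer A f g p \<longleftrightarrow> f \<in> arrs A \<and> g \<in> homset A (src A f) (trg A f) \<and>
     p \<in> arrs A \<and> src A p = trg A f \<and> p \<cdot>\<^bsub>A\<^esub> f = p \<cdot>\<^bsub>A\<^esub> g \<and>
     (\<forall>Z. \<forall>h \<in> homset A (trg A f) Z. h \<cdot>\<^bsub>A\<^esub> f = h \<cdot>\<^bsub>A\<^esub> g \<longrightarrow>
        (\<exists>!u. u \<in> homset A (trg A p) Z \<and> u \<cdot>\<^bsub>A\<^esub> p = h))"

locale abelian_category = linear_category A
  for A :: "('o, 'a, 'k::field, 'z) lincat_scheme" (structure) +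
  assumes zero_object:
      "\<exists>Z \<in> obs A. \<forall>X \<in> obs A. homset A Z X = {zro A Z X} \<and> homset A X Z = {zro A X Z}"
    and biproducts:
      "\<lbrakk>X \<in> obs A; Y \<in> obs A\<rbrakk> \<Longrightarrow>
        \<exists>P \<in> obs A. \<exists>i \<in> homset A X P. \<exists>j \<in> homset A Y P. \<exists>p \<in> homset A P X. \<exists>q \<in> homset A P Y.
          p \<cdot> i = ide A X \<and> q \<cdot> j = ide A Y \<and> q \<cdot> i = zro A X Y \<and> p \<cdot> j = zro A Y X \<and>
          (i \<cdot> p) \<oplus> (j \<cdot> q) = ide A P"
    and kernels: "f \<in> arrs A \<Longrightarrow> \<exists>i. is_kernel A f i"
    and cokernels: "f \<in> arrs A \<Longrightarrow> \<exists>p. is_cokernel A f p"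
    and mono_normal: "is_mono A i \<Longrightarrow> \<exists>f. is_kernel A f i"
    and epi_normal: "is_epi A p \<Longrightarrow> \<exists>f. is_cokernel A f p"


section \<open>Linear functors, natural transformations, equivalences\<close>

record ('o, 'a, 'p, 'b) func =
  fob :: "'o \<Rightarrow> 'p"
  far :: "'a \<Rightarrow> 'b"

definition linear_functor ::
  "('o, 'a, 'k, 'z) lincat_scheme \<Rightarrow> ('p, 'b, 'k, 'y) lincat_scheme \<Rightarrow>
   ('o, 'a, 'p, 'b, 'x) func_scheme \<Rightarrow> bool" where
  "linear_functor A B F \<longleftrightarrow>
     (\<forall>X \<in> obs A. fob F X \<in> obs B) \<and>
     (\<forall>X Y. \<forall>f \<in> homset A X Y. far F f \<in> homset B (fob F X) (fob F Y)) \<and>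
     (\<forall>X \<in> obs A. far F (ide A X) = ide B (fob F X)) \<and>
     (\<forall>X Y Z. \<forall>f \<in> homset A X Y. \<forall>g \<in> homset A Y Z.
        far F (g \<cdot>\<^bsub>A\<^esub> f) = far F g \<cdot>\<^bsub>B\<^esub> far F f) \<and>
     (\<forall>X Y. \<forall>f \<in> homset A X Y. \<forall>g \<in> homset A X Y.
        far F (f \<oplus>\<^bsub>A\<^esub> g) = far F f \<oplus>\<^bsub>B\<^esub> far F g) \<and>
     (\<forall>X Y c. \<forall>f \<in> homset A X Y. far F (c \<star>\<^bsub>A\<^esub> f) = c \<star>\<^bsub>B\<^esub> far F f)"

text \<open>
  That \<open>p\<close> is a cokernel of \<open>f : X \<rightarrow> Y\<close> says exactly that \<open>X \<rightarrow> Y \<rightarrow> Z \<rightarrow> 0\<close> is exact; a functor is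
  right exact if it is linear and preserves these exact sequences. As a linear functor preserves
  finite direct sums, this amounts to the preservation of finite colimits.
\<close>

definition right_exact ::
  "('o, 'a, 'k, 'z) lincat_scheme \<Rightarrow> ('p, 'b, 'k, 'y) lincat_scheme \<Rightarrow>
   ('o, 'a, 'p, 'b, 'x) func_scheme \<Rightarrow> bool" where
  "right_exact A B F \<longleftrightarrow> linear_functor A B F \<and>
     (\<forall>f p. is_cokernel A f p \<longrightarrow> is_cokernel B (far F f) (far F p))"

definition faithful ::
  "('o, 'a, 'k, 'z) lincat_scheme \<Rightarrow> ('o, 'a, 'p, 'b, 'x) func_scheme \<Rightarrow> bool" where
  "faithful A F \<longleftrightarrow>
     (\<forall>X \<in> obs A. \<forall>Y \<in> obs A. \<forall>f \<in> homset A X Y. \<forall>g \<in> homset A X Y.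
        far F f = far F g \<longrightarrow> f = g)"

definition id_func :: "('o, 'a, 'o, 'a) func" where
  "id_func = \<lparr>fob = (\<lambda>X. X), far = (\<lambda>f. f)\<rparr>"

definition comp_func ::
  "('p, 'b, 'q, 'c, 'y) func_scheme \<Rightarrow> ('o, 'a, 'p, 'b, 'x) func_scheme \<Rightarrow> ('o, 'a, 'q, 'c) func"
  where "comp_func G F = \<lparr>fob = (\<lambda>X. fob G (fob F X)), far = (\<lambda>f. far G (far F f))\<rparr>"

definition natural ::
  "('o, 'a, 'k, 'z) lincat_scheme \<Rightarrow> ('p, 'b, 'k, 'y) lincat_scheme \<Rightarrow>
   ('o, 'a, 'p, 'b, 'x) func_scheme \<Rightarrow> ('o, 'a, 'p, 'b, 'w) func_scheme \<Rightarrow> ('o \<Rightarrow> 'b) \<Rightarrow> bool"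
  where
  "natural A B F G t \<longleftrightarrow>
     (\<forall>X \<in> obs A. t X \<in> homset B (fob F X) (fob G X)) \<and>
     (\<forall>X Y. \<forall>f \<in> homset A X Y. t Y \<cdot>\<^bsub>B\<^esub> far F f = far G f \<cdot>\<^bsub>B\<^esub> t X)"

definition naturally_isomorphic ::
  "('o, 'a, 'k, 'z) lincat_scheme \<Rightarrow> ('p, 'b, 'k, 'y) lincat_scheme \<Rightarrow>
   ('o, 'a, 'p, 'b, 'x) func_scheme \<Rightarrow> ('o, 'a, 'p, 'b, 'w) func_scheme \<Rightarrow> bool" where
  "naturally_isomorphic A B F G \<longleftrightarrow>
     (\<exists>t. natural A B F G t \<and> (\<forall>X \<in> obs A. is_iso B (t X)))"

definition equivalence_of_categories ::
  "('o, 'a, 'k::field, 'z) lincat_scheme \<Rightarrow> ('p, 'b, 'k, 'y) lincat_scheme \<Rightarrow>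
   ('o, 'a, 'p, 'b, 'x) func_scheme \<Rightarrow> bool" where
  "equivalence_of_categories A B F \<longleftrightarrow>
     linear_category A \<and> linear_category B \<and> linear_functor A B F \<and>
     (\<exists>G :: ('p, 'b, 'o, 'a) func. linear_functor B A G \<and>
        naturally_isomorphic A A (comp_func G F) id_func \<and>
        naturally_isomorphic B B (comp_func F G) id_func)"


section \<open>Abelian monoidal categories and their module categories\<close>

record ('o, 'a, 'k) moncat = "('o, 'a, 'k) lincat" +
  tensor_ob :: "'o \<Rightarrow> 'o \<Rightarrow> 'o" (infixr "\<otimes>\<index>" 75)
  tensor_ar :: "'a \<Rightarrow> 'a \<Rightarrow> 'a" (infixr "\<odot>\<index>" 75)
  unit_ob :: "'o" ("\<one>\<index>")
  assoc :: "'o \<Rightarrow> 'o \<Rightarrow> 'o \<Rightarrow> 'a"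
  lunit :: "'o \<Rightarrow> 'a"
  runit :: "'o \<Rightarrow> 'a"

definition bilinear_functor ::
  "('u, 'c, 'k, 'z) lincat_scheme \<Rightarrow> ('o, 'a, 'k, 'y) lincat_scheme \<Rightarrow>
   ('p, 'b, 'k, 'x) lincat_scheme \<Rightarrow> ('u \<Rightarrow> 'o \<Rightarrow> 'p) \<Rightarrow> ('c \<Rightarrow> 'a \<Rightarrow> 'b) \<Rightarrow> bool" where
  "bilinear_functor C A B H h \<longleftrightarrow>
     (\<forall>V \<in> obs C. \<forall>M \<in> obs A. H V M \<in> obs B) \<and>
     (\<forall>V V' M M'. \<forall>f \<in> homset C V V'. \<forall>g \<in> homset A M M'. h f g \<in> homset B (H V M) (H V' M')) \<and>
     (\<forall>V \<in> obs C. \<forall>M \<in> obs A. h (ide C V) (ide A M) = ide B (H V M)) \<and>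
     (\<forall>V V' V'' M M' M''. \<forall>f \<in> homset C V V'. \<forall>f' \<in> homset C V' V''.
        \<forall>g \<in> homset A M M'. \<forall>g' \<in> homset A M' M''.
          h (f' \<cdot>\<^bsub>C\<^esub> f) (g' \<cdot>\<^bsub>A\<^esub> g) = h f' g' \<cdot>\<^bsub>B\<^esub> h f g) \<and>
     (\<forall>V V' M M'. \<forall>f \<in> homset C V V'. \<forall>f' \<in> homset C V V'. \<forall>g \<in> homset A M M'.
        h (f \<oplus>\<^bsub>C\<^esub> f') g = h f g \<oplus>\<^bsub>B\<^esub> h f' g) \<and>
     (\<forall>V V' M M'. \<forall>f \<in> homset C V V'. \<forall>g \<in> homset A M M'. \<forall>g' \<in> homset A M M'.
        h f (g \<oplus>\<^bsub>A\<^esub> g') = h f g \<oplus>\<^bsub>B\<^esub> h f g') \<and>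
     (\<forall>V V' M M' c. \<forall>f \<in> homset C V V'. \<forall>g \<in> homset A M M'.
        h (c \<star>\<^bsub>C\<^esub> f) g = c \<star>\<^bsub>B\<^esub> h f g \<and> h f (c \<star>\<^bsub>A\<^esub> g) = c \<star>\<^bsub>B\<^esub> h f g)"

locale abelian_monoidal_category = abelian_category C
  for C :: "('o, 'a, 'k::field, 'z) moncat_scheme" (structure) +
  assumes tensor_bilinear: "bilinear_functor C C C (tensor_ob C) (tensor_ar C)"
    and unit_obs: "\<one> \<in> obs C"
    and assoc_hom: "\<lbrakk>U \<in> obs C; V \<in> obs C; W \<in> obs C\<rbrakk> \<Longrightarrow>
        assoc C U V W \<in> homset C ((U \<otimes> V) \<otimes> W) (U \<otimes> (V \<otimes> W))"
    and assoc_iso: "\<lbrakk>U \<in> obs C; V \<in> obs C; W \<in> obs C\<rbrakk> \<Longrightarrow> is_iso C (assoc C U V W)"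
    and assoc_natural: "\<lbrakk>f \<in> homset C U U'; g \<in> homset C V V'; h \<in> homset C W W'\<rbrakk> \<Longrightarrow>
        assoc C U' V' W' \<cdot> ((f \<odot> g) \<odot> h) = (f \<odot> (g \<odot> h)) \<cdot> assoc C U V W"
    and lunit_hom: "V \<in> obs C \<Longrightarrow> lunit C V \<in> homset C (\<one> \<otimes> V) V"
    and lunit_iso: "V \<in> obs C \<Longrightarrow> is_iso C (lunit C V)"
    and lunit_natural: "f \<in> homset C V V' \<Longrightarrow> lunit C V' \<cdot> (ide C \<one> \<odot> f) = f \<cdot> lunit C V"
    and runit_hom: "V \<in> obs C \<Longrightarrow> runit C V \<in> homset C (V \<otimes> \<one>) V"
    and runit_iso: "V \<in> obs C \<Longrightarrow> is_iso C (runit C V)"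
    and runit_natural: "f \<in> homset C V V' \<Longrightarrow> runit C V' \<cdot> (f \<odot> ide C \<one>) = f \<cdot> runit C V"
    and pentagon: "\<lbrakk>U \<in> obs C; V \<in> obs C; W \<in> obs C; X \<in> obs C\<rbrakk> \<Longrightarrow>
        (ide C U \<odot> assoc C V W X) \<cdot> assoc C U (V \<otimes> W) X \<cdot> (assoc C U V W \<odot> ide C X)
          = assoc C U V (W \<otimes> X) \<cdot> assoc C (U \<otimes> V) W X"
    and triangle: "\<lbrakk>V \<in> obs C; W \<in> obs C\<rbrakk> \<Longrightarrow>
        (ide C V \<odot> lunit C W) \<cdot> assoc C V \<one> W = runit C V \<odot> ide C W"

text \<open>
  \<open>'v\<close> and \<open>'w\<close> are the types of objects and arrows of the acting monoidal category. The associator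
  \<open>massoc\<close> goes from \<open>(V \<otimes> W) \<rhd> M\<close> to \<open>V \<rhd> (W \<rhd> M)\<close>; \<open>\<unrhd>\<close> is the action on arrows.
\<close>

record ('v, 'w, 'o, 'a, 'k) modcat = "('o, 'a, 'k) lincat" +
  act_ob :: "'v \<Rightarrow> 'o \<Rightarrow> 'o" (infixr "\<rhd>\<index>" 75)
  act_ar :: "'w \<Rightarrow> 'a \<Rightarrow> 'a" (infixr "\<unrhd>\<index>" 75)
  massoc :: "'v \<Rightarrow> 'v \<Rightarrow> 'o \<Rightarrow> 'a"
  munit :: "'o \<Rightarrow> 'a"

definition act_left :: "('v, 'w, 'k, 'z) moncat_scheme \<Rightarrow> ('v, 'w, 'o, 'a, 'k, 'y) modcat_scheme \<Rightarrow>
   'v \<Rightarrow> ('o, 'a, 'o, 'a) func" where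
  "act_left C A V = \<lparr>fob = (\<lambda>M. V \<rhd>\<^bsub>A\<^esub> M), far = (\<lambda>g. ide C V \<unrhd>\<^bsub>A\<^esub> g)\<rparr>"

definition act_right :: "('v, 'w, 'o, 'a, 'k, 'y) modcat_scheme \<Rightarrow> 'o \<Rightarrow> ('v, 'w, 'o, 'a) func" where
  "act_right A M = \<lparr>fob = (\<lambda>V. V \<rhd>\<^bsub>A\<^esub> M), far = (\<lambda>f. f \<unrhd>\<^bsub>A\<^esub> ide A M)\<rparr>"

locale abelian_module_category = abelian_monoidal_category C + A: abelian_category A
  for C :: "('v, 'w, 'k::field, 'z) moncat_scheme" (structure)
    and A :: "('v, 'w, 'o, 'a, 'k, 'y) modcat_scheme" +
  assumes act_bilinear: "bilinear_functor C A A (act_ob A) (act_ar A)"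
    and massoc_hom: "\<lbrakk>V \<in> obs C; W \<in> obs C; M \<in> obs A\<rbrakk> \<Longrightarrow>
        massoc A V W M \<in> homset A ((V \<otimes> W) \<rhd>\<^bsub>A\<^esub> M) (V \<rhd>\<^bsub>A\<^esub> (W \<rhd>\<^bsub>A\<^esub> M))"
    and massoc_iso: "\<lbrakk>V \<in> obs C; W \<in> obs C; M \<in> obs A\<rbrakk> \<Longrightarrow> is_iso A (massoc A V W M)"
    and massoc_natural: "\<lbrakk>f \<in> homset C V V'; f' \<in> homset C W W'; g \<in> homset A M M'\<rbrakk> \<Longrightarrow>
        massoc A V' W' M' \<cdot>\<^bsub>A\<^esub> ((f \<odot> f') \<unrhd>\<^bsub>A\<^esub> g)
          = (f \<unrhd>\<^bsub>A\<^esub> (f' \<unrhd>\<^bsub>A\<^esub> g)) \<cdot>\<^bsub>A\<^esub> massoc A V W M"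
    and munit_hom: "M \<in> obs A \<Longrightarrow> munit A M \<in> homset A (\<one> \<rhd>\<^bsub>A\<^esub> M) M"
    and munit_iso: "M \<in> obs A \<Longrightarrow> is_iso A (munit A M)"
    and munit_natural: "g \<in> homset A M M' \<Longrightarrow>
        munit A M' \<cdot>\<^bsub>A\<^esub> (ide C \<one> \<unrhd>\<^bsub>A\<^esub> g) = g \<cdot>\<^bsub>A\<^esub> munit A M"
    and module_pentagon: "\<lbrakk>U \<in> obs C; V \<in> obs C; W \<in> obs C; M \<in> obs A\<rbrakk> \<Longrightarrow>
        (ide C U \<unrhd>\<^bsub>A\<^esub> massoc A V W M) \<cdot>\<^bsub>A\<^esub> massoc A U (V \<otimes> W) M
            \<cdot>\<^bsub>A\<^esub> (assoc C U V W \<unrhd>\<^bsub>A\<^esub> ide A M)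
          = massoc A U V (W \<rhd>\<^bsub>A\<^esub> M) \<cdot>\<^bsub>A\<^esub> massoc A (U \<otimes> V) W M"
    and module_triangle: "\<lbrakk>V \<in> obs C; M \<in> obs A\<rbrakk> \<Longrightarrow>
        (ide C V \<unrhd>\<^bsub>A\<^esub> munit A M) \<cdot>\<^bsub>A\<^esub> massoc A V \<one> M = runit C V \<unrhd>\<^bsub>A\<^esub> ide A M"
    and act_left_right_exact: "V \<in> obs C \<Longrightarrow> right_exact A A (act_left C A V)"
    and act_right_right_exact: "M \<in> obs A \<Longrightarrow> right_exact C A (act_right A M)"


section \<open>Lax module functors and module transformations\<close>

record ('v, 'o, 'a, 'p, 'b) laxfun = "('o, 'a, 'p, 'b) func" +
  lax :: "'v \<Rightarrow> 'o \<Rightarrow> 'b"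

definition lax_module_functor ::
  "('v, 'w, 'k, 'z) moncat_scheme \<Rightarrow> ('v, 'w, 'o, 'a, 'k, 'y) modcat_scheme \<Rightarrow>
   ('v, 'w, 'p, 'b, 'k, 'x) modcat_scheme \<Rightarrow> ('v, 'o, 'a, 'p, 'b, 'u) laxfun_scheme \<Rightarrow> bool" where
  "lax_module_functor C A B F \<longleftrightarrow> linear_functor A B F \<and>
     (\<forall>V \<in> obs C. \<forall>M \<in> obs A.
        lax F V M \<in> homset B (V \<rhd>\<^bsub>B\<^esub> fob F M) (fob F (V \<rhd>\<^bsub>A\<^esub> M))) \<and>
     (\<forall>V V' M M'. \<forall>f \<in> homset C V V'. \<forall>g \<in> homset A M M'.
        far F (f \<unrhd>\<^bsub>A\<^esub> g) \<cdot>\<^bsub>B\<^esub> lax F V M = lax F V' M' \<cdot>\<^bsub>B\<^esub> (f \<unrhd>\<^bsub>B\<^esub> far F g)) \<and>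
     (\<forall>V \<in> obs C. \<forall>W \<in> obs C. \<forall>M \<in> obs A.
        far F (massoc A V W M) \<cdot>\<^bsub>B\<^esub> lax F (V \<otimes>\<^bsub>C\<^esub> W) M
          = lax F V (W \<rhd>\<^bsub>A\<^esub> M) \<cdot>\<^bsub>B\<^esub> (ide C V \<unrhd>\<^bsub>B\<^esub> lax F W M) \<cdot>\<^bsub>B\<^esub> massoc B V W (fob F M)) \<and>
     (\<forall>M \<in> obs A. far F (munit A M) \<cdot>\<^bsub>B\<^esub> lax F \<one>\<^bsub>C\<^esub> M = munit B (fob F M))"

definition id_lax :: "('v, 'w, 'o, 'a, 'k, 'y) modcat_scheme \<Rightarrow> ('v, 'o, 'a, 'o, 'a) laxfun" where
  "id_lax A = \<lparr>fob = (\<lambda>M. M), far = (\<lambda>f. f), lax = (\<lambda>V M. ide A (V \<rhd>\<^bsub>A\<^esub> M))\<rparr>"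

text \<open>In \<open>comp_lax D G F\<close>, the category \<open>D\<close> is the target of \<open>G\<close>.\<close>

definition comp_lax ::
  "('q, 'c, 'k, 'z) lincat_scheme \<Rightarrow> ('v, 'p, 'b, 'q, 'c, 'y) laxfun_scheme \<Rightarrow>
   ('v, 'o, 'a, 'p, 'b, 'x) laxfun_scheme \<Rightarrow> ('v, 'o, 'a, 'q, 'c) laxfun" where
  "comp_lax D G F =
     \<lparr>fob = (\<lambda>M. fob G (fob F M)), far = (\<lambda>f. far G (far F f)),
      lax = (\<lambda>V M. far G (lax F V M) \<cdot>\<^bsub>D\<^esub> lax G V (fob F M))\<rparr>"

definition module_transformation ::
  "('v, 'w, 'k, 'z) moncat_scheme \<Rightarrow> ('v, 'w, 'o, 'a, 'k, 'y) modcat_scheme \<Rightarrow>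
   ('v, 'w, 'p, 'b, 'k, 'x) modcat_scheme \<Rightarrow> ('v, 'o, 'a, 'p, 'b, 's) laxfun_scheme \<Rightarrow>
   ('v, 'o, 'a, 'p, 'b, 'r) laxfun_scheme \<Rightarrow> ('o \<Rightarrow> 'b) \<Rightarrow> bool" where
  "module_transformation C A B F G t \<longleftrightarrow> natural A B F G t \<and>
     (\<forall>V \<in> obs C. \<forall>M \<in> obs A.
        t (V \<rhd>\<^bsub>A\<^esub> M) \<cdot>\<^bsub>B\<^esub> lax F V M = lax G V M \<cdot>\<^bsub>B\<^esub> (ide C V \<unrhd>\<^bsub>B\<^esub> t M))"

text \<open>
  Functors that serve as objects of a functor category, and the component families of its arrows,
  are taken to be \<^const>\<open>undefined\<close> off the carriers, so that equality of objects and of arrows has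
  the intended meaning.
\<close>

definition lax_extensional ::
  "('v, 'w, 'k, 'z) moncat_scheme \<Rightarrow> ('o, 'a, 'k, 'y) lincat_scheme \<Rightarrow>
   ('v, 'o, 'a, 'p, 'b, 'x) laxfun_scheme \<Rightarrow> bool" where
  "lax_extensional C A F \<longleftrightarrow> fob F \<in> extensional (obs A) \<and> far F \<in> extensional (arrs A) \<and>
     (\<forall>V M. \<not> (V \<in> obs C \<and> M \<in> obs A) \<longrightarrow> lax F V M = undefined)"

text \<open>
  The linear category with object set \<open>X\<close>, a set of functors from \<open>A\<close> to \<open>B\<close>, whose arrows are
  the triples (source, components, target) with components satisfying \<open>P\<close>.
\<close>

definition transformation_category ::
  "('o, 'a, 'k, 'z) lincat_scheme \<Rightarrow> ('p, 'b, 'k, 'y) lincat_scheme \<Rightarrow>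
   ('o, 'a, 'p, 'b, 'x) func_scheme set \<Rightarrow>
   (('o, 'a, 'p, 'b, 'x) func_scheme \<Rightarrow> ('o, 'a, 'p, 'b, 'x) func_scheme \<Rightarrow> ('o \<Rightarrow> 'b) \<Rightarrow> bool) \<Rightarrow>
   (('o, 'a, 'p, 'b, 'x) func_scheme,
    ('o, 'a, 'p, 'b, 'x) func_scheme \<times> ('o \<Rightarrow> 'b) \<times> ('o, 'a, 'p, 'b, 'x) func_scheme, 'k) lincat"
  where
  "transformation_category A B X P =
     \<lparr>obs = X,
      arrs = {(F, t, G). F \<in> X \<and> G \<in> X \<and> t \<in> extensional (obs A) \<and> P F G t},
      src = (\<lambda>(F, t, G). F),
      trg = (\<lambda>(F, t, G). G),
      ide = (\<lambda>F. (F, \<lambda>M \<in> obs A. ide B (fob F M), F)),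
      cmp = (\<lambda>(G', s, H) (F, t, G). (F, \<lambda>M \<in> obs A. s M \<cdot>\<^bsub>B\<^esub> t M, H)),
      zro = (\<lambda>F G. (F, \<lambda>M \<in> obs A. zro B (fob F M) (fob G M), G)),
      plus_arr = (\<lambda>(F, s, G) (F', t, G'). (F, \<lambda>M \<in> obs A. s M \<oplus>\<^bsub>B\<^esub> t M, G)),
      scale_arr = (\<lambda>c (F, t, G). (F, \<lambda>M \<in> obs A. c \<star>\<^bsub>B\<^esub> t M, G))\<rparr>"

definition LaxRex ::
  "('v, 'w, 'k, 'z) moncat_scheme \<Rightarrow> ('v, 'w, 'o, 'a, 'k, 'y) modcat_scheme \<Rightarrow>
   ('v, 'w, 'p, 'b, 'k, 'x) modcat_scheme \<Rightarrow>
   (('v, 'o, 'a, 'p, 'b) laxfun,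
    ('v, 'o, 'a, 'p, 'b) laxfun \<times> ('o \<Rightarrow> 'b) \<times> ('v, 'o, 'a, 'p, 'b) laxfun, 'k) lincat" where
  "LaxRex C A B = transformation_category A B
     {F. lax_module_functor C A B F \<and> right_exact A B F \<and> lax_extensional C A F}
     (module_transformation C A B)"


section \<open>Lax module monads and biact functors\<close>

record ('v, 'o, 'a) laxmonad = "('v, 'o, 'a, 'o, 'a) laxfun" +
  eta :: "'o \<Rightarrow> 'a"
  mu :: "'o \<Rightarrow> 'a"

definition lax_module_monad ::
  "('v, 'w, 'k, 'z) moncat_scheme \<Rightarrow> ('v, 'w, 'o, 'a, 'k, 'y) modcat_scheme \<Rightarrow>
   ('v, 'o, 'a, 'x) laxmonad_scheme \<Rightarrow> bool" where
  "lax_module_monad C A T \<longleftrightarrow> lax_module_functor C A A T \<and>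
     module_transformation C A A (id_lax A) T (eta T) \<and>
     module_transformation C A A (comp_lax A T T) T (mu T) \<and>
     (\<forall>M \<in> obs A.
        mu T M \<cdot>\<^bsub>A\<^esub> eta T (fob T M) = ide A (fob T M) \<and>
        mu T M \<cdot>\<^bsub>A\<^esub> far T (eta T M) = ide A (fob T M) \<and>
        mu T M \<cdot>\<^bsub>A\<^esub> mu T (fob T M) = mu T M \<cdot>\<^bsub>A\<^esub> far T (mu T M))"

record ('v, 'o, 'a) biactfun = "('v, 'o, 'a, 'o, 'a) laxfun" +
  la :: "'o \<Rightarrow> 'a"
  ra :: "'o \<Rightarrow> 'a"

definition biact_functor ::
  "('v, 'w, 'k, 'z) moncat_scheme \<Rightarrow> ('v, 'w, 'o, 'a, 'k, 'y) modcat_scheme \<Rightarrow>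
   ('v, 'o, 'a, 'x) laxmonad_scheme \<Rightarrow> ('v, 'o, 'a, 'u) laxmonad_scheme \<Rightarrow>
   ('v, 'o, 'a, 's) biactfun_scheme \<Rightarrow> bool" where
  "biact_functor C A S T F \<longleftrightarrow> lax_module_functor C A A F \<and> right_exact A A F \<and>
     module_transformation C A A (comp_lax A S F) F (la F) \<and>
     module_transformation C A A (comp_lax A F T) F (ra F) \<and>
     (\<forall>M \<in> obs A.
        la F M \<cdot>\<^bsub>A\<^esub> eta S (fob F M) = ide A (fob F M) \<and>
        la F M \<cdot>\<^bsub>A\<^esub> mu S (fob F M) = la F M \<cdot>\<^bsub>A\<^esub> far S (la F M) \<and>
        ra F M \<cdot>\<^bsub>A\<^esub> far F (eta T M) = ide A (fob F M) \<and>
        ra F M \<cdot>\<^bsub>A\<^esub> far F (mu T M) = ra F M \<cdot>\<^bsub>A\<^esub> ra F (fob T M) \<and>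
        la F M \<cdot>\<^bsub>A\<^esub> far S (ra F M) = ra F M \<cdot>\<^bsub>A\<^esub> la F (fob T M))"

definition biact_morphism ::
  "('v, 'w, 'k, 'z) moncat_scheme \<Rightarrow> ('v, 'w, 'o, 'a, 'k, 'y) modcat_scheme \<Rightarrow>
   ('v, 'o, 'a, 'x) laxmonad_scheme \<Rightarrow> ('v, 'o, 'a, 'u) laxmonad_scheme \<Rightarrow>
   ('v, 'o, 'a, 's) biactfun_scheme \<Rightarrow> ('v, 'o, 'a, 's) biactfun_scheme \<Rightarrow> ('o \<Rightarrow> 'a) \<Rightarrow> bool" where
  "biact_morphism C A S T F G t \<longleftrightarrow> module_transformation C A A F G t \<and>
     (\<forall>M \<in> obs A.
        t M \<cdot>\<^bsub>A\<^esub> la F M = la G M \<cdot>\<^bsub>A\<^esub> far S (t M) \<and>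
        t M \<cdot>\<^bsub>A\<^esub> ra F M = ra G M \<cdot>\<^bsub>A\<^esub> t (fob T M))"

definition Biact ::
  "('v, 'w, 'k, 'z) moncat_scheme \<Rightarrow> ('v, 'w, 'o, 'a, 'k, 'y) modcat_scheme \<Rightarrow>
   ('v, 'o, 'a, 'x) laxmonad_scheme \<Rightarrow> ('v, 'o, 'a, 'u) laxmonad_scheme \<Rightarrow>
   (('v, 'o, 'a) biactfun, ('v, 'o, 'a) biactfun \<times> ('o \<Rightarrow> 'a) \<times> ('v, 'o, 'a) biactfun, 'k) lincat"
  where
  "Biact C A S T = transformation_category A A
     {F. biact_functor C A S T F \<and> lax_extensional C A F \<and>
         la F \<in> extensional (obs A) \<and> ra F \<in> extensional (obs A)}
     (biact_morphism C A S T)"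


section \<open>The Eilenberg--Moore category\<close>

text \<open>
  An object is a pair \<open>(M, \<nabla>)\<close>. An arrow is a triple (source, underlying arrow, target), since the
  same underlying arrow may be a morphism for several choices of actions.
\<close>

type_synonym ('o, 'a) em_ob = "'o \<times> 'a"
type_synonym ('o, 'a) em_ar = "('o \<times> 'a) \<times> 'a \<times> ('o \<times> 'a)"

definition und :: "('o, 'a) em_ar \<Rightarrow> 'a" where
  "und h = fst (snd h)"

definition EM ::
  "('o, 'a, 'k, 'y) lincat_scheme \<Rightarrow> ('v, 'o, 'a, 'x) laxmonad_scheme \<Rightarrow>
   (('o, 'a) em_ob, ('o, 'a) em_ar, 'k) lincat" where
  "EM A T =
     \<lparr>obs = {(M, n). M \<in> obs A \<and> n \<in> homset A (fob T M) M \<and>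
               n \<cdot>\<^bsub>A\<^esub> eta T M = ide A M \<and> n \<cdot>\<^bsub>A\<^esub> mu T M = n \<cdot>\<^bsub>A\<^esub> far T n},
      arrs = {((M, n), f, (M', n')).
               M \<in> obs A \<and> n \<in> homset A (fob T M) M \<and>
               n \<cdot>\<^bsub>A\<^esub> eta T M = ide A M \<and> n \<cdot>\<^bsub>A\<^esub> mu T M = n \<cdot>\<^bsub>A\<^esub> far T n \<and>
               M' \<in> obs A \<and> n' \<in> homset A (fob T M') M' \<and>
               n' \<cdot>\<^bsub>A\<^esub> eta T M' = ide A M' \<and> n' \<cdot>\<^bsub>A\<^esub> mu T M' = n' \<cdot>\<^bsub>A\<^esub> far T n' \<and>
               f \<in> homset A M M' \<and> f \<cdot>\<^bsub>A\<^esub> n = n' \<cdot>\<^bsub>A\<^esub> far T f},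
      src = (\<lambda>(X, f, Y). X),
      trg = (\<lambda>(X, f, Y). Y),
      ide = (\<lambda>X. (X, ide A (fst X), X)),
      cmp = (\<lambda>(Y', g, Z) (X, f, Y). (X, g \<cdot>\<^bsub>A\<^esub> f, Z)),
      zro = (\<lambda>X Y. (X, zro A (fst X) (fst Y), Y)),
      plus_arr = (\<lambda>(X, f, Y) (X', g, Y'). (X, f \<oplus>\<^bsub>A\<^esub> g, Y)),
      scale_arr = (\<lambda>c (X, f, Y). (X, c \<star>\<^bsub>A\<^esub> f, Y))\<rparr>"

definition free_ob :: "('v, 'o, 'a, 'x) laxmonad_scheme \<Rightarrow> 'o \<Rightarrow> ('o, 'a) em_ob" where
  "free_ob T M = (fob T M, mu T M)"

definition free_ar ::
  "('o, 'a, 'k, 'y) lincat_scheme \<Rightarrow> ('v, 'o, 'a, 'x) laxmonad_scheme \<Rightarrow> 'a \<Rightarrow> ('o, 'a) em_ar" where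
  "free_ar A T f = (free_ob T (src A f), far T f, free_ob T (trg A f))"

definition counit :: "('v, 'o, 'a, 'x) laxmonad_scheme \<Rightarrow> ('o, 'a) em_ob \<Rightarrow> ('o, 'a) em_ar" where
  "counit T X = (free_ob T (fst X), snd X, X)"


section \<open>The Linton module structure on the Eilenberg--Moore category\<close>

definition linton_left ::
  "('v, 'w, 'k, 'z) moncat_scheme \<Rightarrow> ('v, 'w, 'o, 'a, 'k, 'y) modcat_scheme \<Rightarrow>
   ('v, 'o, 'a, 'x) laxmonad_scheme \<Rightarrow> 'v \<Rightarrow> ('o, 'a) em_ob \<Rightarrow> ('o, 'a) em_ar" where
  "linton_left C A T V X =
     (free_ob T (V \<rhd>\<^bsub>A\<^esub> fob T (fst X)),
      far T (ide C V \<unrhd>\<^bsub>A\<^esub> snd X),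
      free_ob T (V \<rhd>\<^bsub>A\<^esub> fst X))"

definition linton_right ::
  "('v, 'w, 'o, 'a, 'k, 'y) modcat_scheme \<Rightarrow>
   ('v, 'o, 'a, 'x) laxmonad_scheme \<Rightarrow> 'v \<Rightarrow> 'o \<Rightarrow> ('o, 'a) em_ar" where
  "linton_right A T V M =
     (free_ob T (V \<rhd>\<^bsub>A\<^esub> fob T M),
      mu T (V \<rhd>\<^bsub>A\<^esub> M) \<cdot>\<^bsub>A\<^esub> far T (lax T V M),
      free_ob T (V \<rhd>\<^bsub>A\<^esub> M))"

text \<open>
  The module structure depends on a choice of coequalizers: \<open>pr V X\<close> is the chosen projection
  from the free module on \<open>V \<rhd> M\<close> onto \<open>V \<blacktriangleright> X\<close>, for \<open>X = (M, \<nabla>)\<close>.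
\<close>

definition linton_coequalizers ::
  "('v, 'w, 'k, 'z) moncat_scheme \<Rightarrow> ('v, 'w, 'o, 'a, 'k, 'y) modcat_scheme \<Rightarrow>
   ('v, 'o, 'a, 'x) laxmonad_scheme \<Rightarrow> ('v \<Rightarrow> ('o, 'a) em_ob \<Rightarrow> ('o, 'a) em_ar) \<Rightarrow> bool" where
  "linton_coequalizers C A T pr \<longleftrightarrow>
     (\<forall>V \<in> obs C. \<forall>X \<in> obs (EM A T).
        is_coequalizer (EM A T) (linton_left C A T V X) (linton_right A T V (fst X)) (pr V X))"

definition linton_q ::
  "('v, 'w, 'o, 'a, 'k, 'y) modcat_scheme \<Rightarrow> ('v, 'o, 'a, 'x) laxmonad_scheme \<Rightarrow>
   ('v \<Rightarrow> ('o, 'a) em_ob \<Rightarrow> ('o, 'a) em_ar) \<Rightarrow> 'v \<Rightarrow> ('o, 'a) em_ob \<Rightarrow> 'a" where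
  "linton_q A T pr V X = und (pr V X) \<cdot>\<^bsub>A\<^esub> eta T (V \<rhd>\<^bsub>A\<^esub> fst X)"

definition linton_ob ::
  "('o, 'a, 'k, 'y) lincat_scheme \<Rightarrow> ('v, 'o, 'a, 'x) laxmonad_scheme \<Rightarrow>
   ('v \<Rightarrow> ('o, 'a) em_ob \<Rightarrow> ('o, 'a) em_ar) \<Rightarrow> 'v \<Rightarrow> ('o, 'a) em_ob \<Rightarrow> ('o, 'a) em_ob" where
  "linton_ob A T pr V X = trg (EM A T) (pr V X)"

text \<open>The action on a pair of arrows is the arrow induced between the coequalizers.\<close>

definition linton_ar ::
  "('v, 'w, 'k, 'z) moncat_scheme \<Rightarrow> ('v, 'w, 'o, 'a, 'k, 'y) modcat_scheme \<Rightarrow>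
   ('v, 'o, 'a, 'x) laxmonad_scheme \<Rightarrow> ('v \<Rightarrow> ('o, 'a) em_ob \<Rightarrow> ('o, 'a) em_ar) \<Rightarrow>
   'w \<Rightarrow> ('o, 'a) em_ar \<Rightarrow> ('o, 'a) em_ar" where
  "linton_ar C A T pr f g =
     (let V = src C f; V' = trg C f; X = src (EM A T) g; X' = trg (EM A T) g in
      THE h. h \<in> homset (EM A T) (linton_ob A T pr V X) (linton_ob A T pr V' X') \<and>
        h \<cdot>\<^bsub>EM A T\<^esub> pr V X = pr V' X' \<cdot>\<^bsub>EM A T\<^esub> free_ar A T (f \<unrhd>\<^bsub>A\<^esub> und g))"

definition linton_assoc ::
  "('v, 'w, 'k, 'z) moncat_scheme \<Rightarrow> ('v, 'w, 'o, 'a, 'k, 'y) modcat_scheme \<Rightarrow>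
   ('v, 'o, 'a, 'x) laxmonad_scheme \<Rightarrow> ('v \<Rightarrow> ('o, 'a) em_ob \<Rightarrow> ('o, 'a) em_ar) \<Rightarrow>
   'v \<Rightarrow> 'v \<Rightarrow> ('o, 'a) em_ob \<Rightarrow> ('o, 'a) em_ar" where
  "linton_assoc C A T pr V W X =
     (THE h. is_iso (EM A T) h \<and>
        h \<in> homset (EM A T) (linton_ob A T pr (V \<otimes>\<^bsub>C\<^esub> W) X)
                            (linton_ob A T pr V (linton_ob A T pr W X)) \<and>
        und h \<cdot>\<^bsub>A\<^esub> linton_q A T pr (V \<otimes>\<^bsub>C\<^esub> W) X
          = linton_q A T pr V (linton_ob A T pr W X)
              \<cdot>\<^bsub>A\<^esub> (ide C V \<unrhd>\<^bsub>A\<^esub> linton_q A T pr W X) \<cdot>\<^bsub>A\<^esub> massoc A V W (fst X))"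

definition linton_unit ::
  "('v, 'w, 'k, 'z) moncat_scheme \<Rightarrow> ('v, 'w, 'o, 'a, 'k, 'y) modcat_scheme \<Rightarrow>
   ('v, 'o, 'a, 'x) laxmonad_scheme \<Rightarrow> ('v \<Rightarrow> ('o, 'a) em_ob \<Rightarrow> ('o, 'a) em_ar) \<Rightarrow>
   ('o, 'a) em_ob \<Rightarrow> ('o, 'a) em_ar" where
  "linton_unit C A T pr X =
     (THE h. is_iso (EM A T) h \<and> h \<in> homset (EM A T) (linton_ob A T pr \<one>\<^bsub>C\<^esub> X) X \<and>
        und h \<cdot>\<^bsub>A\<^esub> linton_q A T pr \<one>\<^bsub>C\<^esub> X = munit A (fst X))"

definition EMmod ::
  "('v, 'w, 'k, 'z) moncat_scheme \<Rightarrow> ('v, 'w, 'o, 'a, 'k, 'y) modcat_scheme \<Rightarrow>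
   ('v, 'o, 'a, 'x) laxmonad_scheme \<Rightarrow> ('v \<Rightarrow> ('o, 'a) em_ob \<Rightarrow> ('o, 'a) em_ar) \<Rightarrow>
   ('v, 'w, ('o, 'a) em_ob, ('o, 'a) em_ar, 'k) modcat" where
  "EMmod C A T pr = lincat.extend (EM A T)
     \<lparr>act_ob = linton_ob A T pr,
      act_ar = linton_ar C A T pr,
      massoc = linton_assoc C A T pr,
      munit = linton_unit C A T pr\<rparr>"

text \<open>
  The canonical isomorphism from \<open>V \<blacktriangleright> T M\<close> to \<open>T (V \<rhd> M)\<close> is induced by the universal property
  from the second of the two Linton maps, which is a split coequalizer of the pair at the free
  module \<open>T M\<close>.
\<close>

definition free_functor ::
  "('v, 'w, 'o, 'a, 'k, 'y) modcat_scheme \<Rightarrow>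
   ('v, 'o, 'a, 'x) laxmonad_scheme \<Rightarrow> ('v \<Rightarrow> ('o, 'a) em_ob \<Rightarrow> ('o, 'a) em_ar) \<Rightarrow>
   ('v, 'o, 'a, ('o, 'a) em_ob, ('o, 'a) em_ar) laxfun" where
  "free_functor A T pr =
     \<lparr>fob = free_ob T,
      far = free_ar A T,
      lax = (\<lambda>V M. THE h.
        h \<in> homset (EM A T) (linton_ob A T pr V (free_ob T M)) (free_ob T (V \<rhd>\<^bsub>A\<^esub> M)) \<and>
        h \<cdot>\<^bsub>EM A T\<^esub> pr V (free_ob T M) = linton_right A T V M)\<rparr>"

definition forgetful_functor ::
  "('v, 'w, 'o, 'a, 'k, 'y) modcat_scheme \<Rightarrow> ('v, 'o, 'a, 'x) laxmonad_scheme \<Rightarrow>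
   ('v \<Rightarrow> ('o, 'a) em_ob \<Rightarrow> ('o, 'a) em_ar) \<Rightarrow>
   ('v, ('o, 'a) em_ob, ('o, 'a) em_ar, 'o, 'a) laxfun" where
  "forgetful_functor A T pr = \<lparr>fob = fst, far = und, lax = linton_q A T pr\<rparr>"


section \<open>The comparison functor\<close>

text \<open>
  \<open>prS\<close> and \<open>prT\<close> are the chosen Linton coequalizers for \<open>S\<close> and \<open>T\<close>. The restrictions only
  produce values that are \<^const>\<open>undefined\<close> off the carriers.
\<close>

definition CEW_ob ::
  "('v, 'w, 'k, 'z) moncat_scheme \<Rightarrow> ('v, 'w, 'o, 'a, 'k, 'y) modcat_scheme \<Rightarrow>
   ('v, 'o, 'a, 'x) laxmonad_scheme \<Rightarrow> ('v \<Rightarrow> ('o, 'a) em_ob \<Rightarrow> ('o, 'a) em_ar) \<Rightarrow>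
   ('v, 'o, 'a, 'u) laxmonad_scheme \<Rightarrow> ('v \<Rightarrow> ('o, 'a) em_ob \<Rightarrow> ('o, 'a) em_ar) \<Rightarrow>
   ('v, ('o, 'a) em_ob, ('o, 'a) em_ar, ('o, 'a) em_ob, ('o, 'a) em_ar) laxfun \<Rightarrow>
   ('v, 'o, 'a) biactfun" where
  "CEW_ob C A S prS T prT \<Phi> =
     (let L = free_functor A T prT; R = forgetful_functor A S prS;
          F = comp_lax A R (comp_lax (EM A S) \<Phi> L) in
      \<lparr>fob = restrict (fob F) (obs A),
       far = restrict (far F) (arrs A),
       lax = (\<lambda>V M. if V \<in> obs C \<and> M \<in> obs A then lax F V M else undefined),
       la = (\<lambda>M \<in> obs A. far R (counit S (fob \<Phi> (fob L M)))),
       ra = (\<lambda>M \<in> obs A. far R (far \<Phi> (counit T (fob L M))))\<rparr>)"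

definition CEW ::
  "('v, 'w, 'k, 'z) moncat_scheme \<Rightarrow> ('v, 'w, 'o, 'a, 'k, 'y) modcat_scheme \<Rightarrow>
   ('v, 'o, 'a, 'x) laxmonad_scheme \<Rightarrow> ('v \<Rightarrow> ('o, 'a) em_ob \<Rightarrow> ('o, 'a) em_ar) \<Rightarrow>
   ('v, 'o, 'a, 'u) laxmonad_scheme \<Rightarrow> ('v \<Rightarrow> ('o, 'a) em_ob \<Rightarrow> ('o, 'a) em_ar) \<Rightarrow>
   (('v, ('o, 'a) em_ob, ('o, 'a) em_ar, ('o, 'a) em_ob, ('o, 'a) em_ar) laxfun,
    ('v, ('o, 'a) em_ob, ('o, 'a) em_ar, ('o, 'a) em_ob, ('o, 'a) em_ar) laxfun \<times>
      (('o, 'a) em_ob \<Rightarrow> ('o, 'a) em_ar) \<times>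
      ('v, ('o, 'a) em_ob, ('o, 'a) em_ar, ('o, 'a) em_ob, ('o, 'a) em_ar) laxfun,
    ('v, 'o, 'a) biactfun,
    ('v, 'o, 'a) biactfun \<times> ('o \<Rightarrow> 'a) \<times> ('v, 'o, 'a) biactfun) func" where
  "CEW C A S prS T prT =
     (let L = free_functor A T prT; R = forgetful_functor A S prS in
      \<lparr>fob = CEW_ob C A S prS T prT,
       far = (\<lambda>(\<Phi>, t, \<Psi>).
         (CEW_ob C A S prS T prT \<Phi>,
          \<lambda>M \<in> obs A. far R (t (fob L M)),
          CEW_ob C A S prS T prT \<Psi>))\<rparr>)"

end

theory Submission
  imports Defs
begin

text \<open>
  The Linton action is handled through its universal property: \<open>q V X\<close> is universal among the
  arrows \<open>f : V \<rhd> M \<rightarrow> N\<close> with \<open>f \<cdot> (V \<unrhd> \<nabla>) = \<nabla> \<cdot> T f \<cdot> T\<^sub>a\<close>, so that identities between arrows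
  out of \<open>V \<blacktriangleright> X\<close> are checked after precomposition with \<open>q\<close>, in the underlying category.

  Every \<open>T\<close>-module \<open>X\<close> is the coequalizer of \<open>L T M \<rightrightarrows> L M\<close>, and a right exact \<open>\<Phi>\<close> preserves it. Hence
  a transformation \<open>\<Phi> \<rightarrow> \<Psi>\<close> is determined by its components at free modules, and compatible
  components at free modules extend; it is enough to test compatibility with the \<open>\<C>\<close>-action at free
  modules because \<open>V \<blacktriangleright> -\<close> preserves these epimorphisms and \<open>L\<close> is strong. Conversely, a biact functor \<open>F\<close>
  is the image of \<open>X \<mapsto> coeq (F \<nabla>, F\<^sub>r\<^sub>a : F T M \<rightrightarrows> F M)\<close>: at free modules this coequalizer is split
  by \<open>F \<eta>\<close> and returns \<open>F\<close>.
\<close>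

section \<open>Linear categories and right exact functors\<close>

text \<open>Right exactness enters in three places. For \<open>T\<close> and \<open>S\<close> it
  lets cokernels formed in \<open>A\<close> carry a unique module structure, so that coequalizers of
  modules, the chosen Linton ones included, are coequalizers in \<open>A\<close>. For
  \<open>V \<rhd> -\<close> it makes the images of these coequalizers cancellable in
  \<open>A\<close>. For \<Phi> it keeps the canonical presentation of a module exact. The obstacle
  is that \<open>q V X\<close> is cancelled only against arrows underlying module morphisms. Hence
  every arrow out of a Linton product is first shown to be balanced, then lifted to modules, and
  only then compared on \<open>q\<close>. Balancedness itself is an identity in \<open>A\<close> and
  is tested on images of coequalizers under \<open>T\<close>, \<open>S\<close> and
  \<open>V \<rhd> -\<close>. The structure map of \<open>T\<close> need not be invertible, while the
  one of \<open>L\<close> is: the Linton quotient absorbs the laxness. This is what allows a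
  structure map at a free module to be cancelled. The equivalence is obtained from full faithfulness
  and essential surjectivity, so the inverse construction is carried out on objects only; there it
  is the relative tensor product of \<open>F\<close> and \<open>X\<close> over
  \<open>T\<close>.\<close>

lemma in_homset: "f \<in> homset A X Y \<longleftrightarrow> f \<in> arrs A \<and> src A f = X \<and> trg A f = Y"
  by (simp add: homset_def)

context linear_category
begin

declare src_obs [simp] trg_obs [simp]

lemma ide_arr [simp]:
  assumes "X \<in> obs A"
  shows "ide A X \<in> arrs A" "src A (ide A X) = X" "trg A (ide A X) = X"
  using ide_hom[OF assms] by (auto simp: in_homset)

lemma cmp_arr [simp]:
  assumes "f \<in> arrs A" "g \<in> arrs A" "src A g = trg A f"
  shows "g \<cdot> f \<in> arrs A" "src A (g \<cdot> f) = src A f" "trg A (g \<cdot> f) = trg A g"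
  using cmp_hom[of f "src A f" "trg A f" g "trg A g"] assms by (auto simp: in_homset)

lemma ide_cmp [simp]: "f \<in> arrs A \<Longrightarrow> trg A f = Y \<Longrightarrow> ide A Y \<cdot> f = f"
  using ide_left[of f "src A f" Y] by (auto simp: in_homset)

lemma cmp_ide [simp]: "f \<in> arrs A \<Longrightarrow> src A f = X \<Longrightarrow> f \<cdot> ide A X = f"
  using ide_right[of f X "trg A f"] by (auto simp: in_homset)

lemma assoc_right [simp]:
  "\<lbrakk>f \<in> arrs A; g \<in> arrs A; h \<in> arrs A; src A g = trg A f; src A h = trg A g\<rbrakk>
    \<Longrightarrow> (h \<cdot> g) \<cdot> f = h \<cdot> (g \<cdot> f)"
  using cmp_assoc[of f "src A f" "trg A f" g "trg A g" h "trg A h"] by (auto simp: in_homset)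

text \<open>
  Composites are normalised to right-nested form, so an equation between composites is also needed
  with a further arrow composed on the right. A prime in a fact name marks this version.
\<close>

lemma whisker:
  "\<lbrakk>b \<cdot> f = c; f \<in> arrs A; b \<in> arrs A; src A b = trg A f; r \<in> arrs A; trg A r = src A f\<rbrakk>
    \<Longrightarrow> b \<cdot> (f \<cdot> r) = c \<cdot> r"
  using assoc_right[of r f b] by auto

lemma zro_arr [simp]:
  assumes "X \<in> obs A" "Y \<in> obs A"
  shows "zro A X Y \<in> arrs A" "src A (zro A X Y) = X" "trg A (zro A X Y) = Y"
  using zro_hom[OF assms] by (auto simp: in_homset)

lemma plus_arr [simp]:
  assumes "f \<in> arrs A" "g \<in> arrs A" "src A f = src A g" "trg A f = trg A g"
  shows "f \<oplus> g \<in> arrs A" "src A (f \<oplus> g) = src A g" "trg A (f \<oplus> g) = trg A g"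
  using plus_hom[of f "src A f" "trg A f" g] assms by (auto simp: in_homset)

lemma scale_arr [simp]:
  assumes "f \<in> arrs A"
  shows "c \<star> f \<in> arrs A" "src A (c \<star> f) = src A f" "trg A (c \<star> f) = trg A f"
  using scale_hom[of f "src A f" "trg A f" c] assms by (auto simp: in_homset)

lemma plus_cmp:
  "\<lbrakk>f \<in> arrs A; g \<in> arrs A; h \<in> arrs A; src A g = trg A f; src A h = trg A f; trg A g = trg A h\<rbrakk>
    \<Longrightarrow> (g \<oplus> h) \<cdot> f = (g \<cdot> f) \<oplus> (h \<cdot> f)"
  using cmp_plus_left[of f "src A f" "trg A f" g "trg A g" h] by (auto simp: in_homset)

lemma cmp_plus:
  "\<lbrakk>f \<in> arrs A; g \<in> arrs A; h \<in> arrs A; src A f = src A g; trg A f = trg A g; src A h = trg A f\<rbrakk>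
    \<Longrightarrow> h \<cdot> (f \<oplus> g) = (h \<cdot> f) \<oplus> (h \<cdot> g)"
  using cmp_plus_right[of f "src A f" "trg A f" g h "trg A h"] by (auto simp: in_homset)

lemma scale_cmp:
  "\<lbrakk>f \<in> arrs A; g \<in> arrs A; src A g = trg A f\<rbrakk> \<Longrightarrow> (c \<star> g) \<cdot> f = c \<star> (g \<cdot> f)"
  using cmp_scale_left[of f "src A f" "trg A f" g "trg A g"] by (auto simp: in_homset)

lemma cmp_scale:
  "\<lbrakk>f \<in> arrs A; g \<in> arrs A; src A g = trg A f\<rbrakk> \<Longrightarrow> g \<cdot> (c \<star> f) = c \<star> (g \<cdot> f)"
  using cmp_scale_right[of f "src A f" "trg A f" g "trg A g"] by (auto simp: in_homset)

lemma plus_right_assoc: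
  "\<lbrakk>f \<in> arrs A; g \<in> arrs A; h \<in> arrs A; src A g = src A f; trg A g = trg A f; src A h = src A f;
    trg A h = trg A f\<rbrakk> \<Longrightarrow> (f \<oplus> g) \<oplus> h = f \<oplus> (g \<oplus> h)"
  using plus_assoc by (auto simp: in_homset)

lemma plus_arr_commute:
  "\<lbrakk>f \<in> arrs A; g \<in> arrs A; src A g = src A f; trg A g = trg A f\<rbrakk> \<Longrightarrow> f \<oplus> g = g \<oplus> f"
  using plus_commute by (auto simp: in_homset)

lemma scale_arr_distrib:
  "\<lbrakk>f \<in> arrs A; g \<in> arrs A; src A g = src A f; trg A g = trg A f\<rbrakk>
    \<Longrightarrow> c \<star> (f \<oplus> g) = (c \<star> f) \<oplus> (c \<star> g)"
  using scale_plus by (auto simp: in_homset)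

lemma scale_arr_simps:
  assumes "f \<in> arrs A"
  shows "src A f = X \<Longrightarrow> trg A f = Y \<Longrightarrow> f \<oplus> zro A X Y = f"
    "(c + d) \<star> f = (c \<star> f) \<oplus> (d \<star> f)" "c \<star> (d \<star> f) = (c * d) \<star> f" "1 \<star> f = f"
  using assms plus_zro plus_scale scale_scale scale_one by (auto simp: in_homset)

text \<open>Cancel \<open>f\<close> with an additive inverse. The axioms on composition and the
  notion of a linear functor speak of sums, not of zero arrows; this criterion recovers the
  behaviour of zero arrows from additivity.\<close>

lemma plus_idem_zro:
  assumes "f \<in> arrs A" "f \<oplus> f = f"
  shows "f = zro A (src A f) (trg A f)"
proof -
  have f: "f \<in> homset A (src A f) (trg A f)"
    using assms by (simp add: in_homset)
  obtain g where g: "g \<in> homset A (src A f) (trg A f)" "f \<oplus> g = zro A (src A f) (trg A f)"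
    using plus_inverse[OF f] by blast
  have "f = f \<oplus> (f \<oplus> g)"
    using plus_zro[OF f] g by simp
  also have "\<dots> = f \<oplus> g"
    using plus_assoc[OF f f g(1)] assms by simp
  finally show ?thesis
    using g by simp
qed

lemma scale_0:
  assumes "f \<in> arrs A"
  shows "0 \<star> f = zro A (src A f) (trg A f)"
  using plus_idem_zro[of "0 \<star> f"] plus_scale[of f "src A f" "trg A f" 0 0] assms
  by (auto simp: in_homset)

lemma scale_minus_1:
  assumes "f \<in> arrs A"
  shows "f \<oplus> (-1) \<star> f = zro A (src A f) (trg A f)"
proof -
  have f: "f \<in> homset A (src A f) (trg A f)"
    using assms by (simp add: in_homset)
  have "f \<oplus> (-1) \<star> f = (1 + (-1)) \<star> f"
    using plus_scale[OF f, of 1 "-1"] scale_one[OF f] by simp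
  then show ?thesis
    using scale_0[OF assms] by simp
qed

lemma zro_cmp [simp]:
  assumes "f \<in> arrs A" "trg A f = Y" "Z \<in> obs A"
  shows "zro A Y Z \<cdot> f = zro A (src A f) Z"
proof -
  have Y: "Y \<in> obs A"
    using assms src_obs trg_obs by auto
  then show ?thesis
    using plus_idem_zro[of "zro A Y Z \<cdot> f"] plus_cmp[of f "zro A Y Z" "zro A Y Z"]
      plus_zro[of "zro A Y Z" Y Z] assms
    by (simp add: in_homset)
qed

lemma cmp_zro [simp]:
  assumes "f \<in> arrs A" "src A f = Y" "X \<in> obs A"
  shows "f \<cdot> zro A X Y = zro A X (trg A f)"
proof -
  have Y: "Y \<in> obs A"
    using assms src_obs trg_obs by auto
  then show ?thesis
    using plus_idem_zro[of "f \<cdot> zro A X Y"] cmp_plus[of "zro A X Y" "zro A X Y" f]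
      plus_zro[of "zro A X Y" X Y] assms
    by (simp add: in_homset)
qed

section \<open>Cokernels, coequalizers and isomorphisms in a linear category\<close>

lemma diff_eq_zro_iff:
  assumes "f \<in> arrs A" "g \<in> arrs A" "src A f = src A g" "trg A f = trg A g"
  shows "f \<oplus> (-1) \<star> g = zro A (src A g) (trg A g) \<longleftrightarrow> f = g"
proof
  have f: "f \<in> homset A (src A g) (trg A g)" and g: "g \<in> homset A (src A g) (trg A g)"
    using assms by (auto simp: in_homset)
  note g' = scale_hom[OF g, of "-1"]
  show "f = g" if z: "f \<oplus> (-1) \<star> g = zro A (src A g) (trg A g)"
  proof -
    have "g = g \<oplus> (f \<oplus> (-1) \<star> g)"
      using z plus_zro[OF g] by simp
    also have "\<dots> = f \<oplus> (g \<oplus> (-1) \<star> g)"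
      using plus_assoc[OF g f g'] plus_assoc[OF f g g'] plus_commute[OF f g] by simp
    also have "\<dots> = f"
      using scale_minus_1[OF assms(2)] plus_zro[OF f] by simp
    finally show ?thesis ..
  qed
  show "f \<oplus> (-1) \<star> g = zro A (src A g) (trg A g)" if "f = g"
    unfolding that using assms(2) by (rule scale_minus_1)
qed

text \<open>Composition is additive, so \<open>h\<close> kills the difference exactly when it
  identifies \<open>f\<close> and \<open>g\<close>. This is the bridge between right exactness and
  the existence of cokernels on one side and the coequalizers of the Linton construction on the
  other.\<close>

lemma cokernel_diff_iff_coequalizer:
  assumes "f \<in> arrs A" "g \<in> arrs A" "src A f = src A g" "trg A f = trg A g"
  shows "is_cokernel A (f \<oplus> (-1) \<star> g) p \<longleftrightarrow> is_coequalizer A f g p"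
proof -
  have *: "h \<cdot> (f \<oplus> (-1) \<star> g) = zro A (src A g) (trg A h) \<longleftrightarrow> h \<cdot> f = h \<cdot> g"
    if "h \<in> arrs A" "src A h = trg A g" for h
  proof -
    have "h \<cdot> (f \<oplus> (-1) \<star> g) = (h \<cdot> f) \<oplus> (-1) \<star> (h \<cdot> g)"
      using that assms by (simp add: cmp_plus cmp_scale)
    then show ?thesis
      using diff_eq_zro_iff[of "h \<cdot> f" "h \<cdot> g"] that assms by simp
  qed
  have **: "h \<cdot> (f \<oplus> (-1) \<star> g) = zro A (src A g) Z \<longleftrightarrow> h \<cdot> f = h \<cdot> g"
    if "h \<in> homset A (trg A g) Z" for h Z
    using that * by (auto simp: in_homset)
  have "g \<in> homset A (src A g) (trg A g)"
    using assms by (simp add: in_homset)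
  then show ?thesis
    using assms unfolding is_cokernel_def is_coequalizer_def
    by (simp add: * ** cong: conj_cong ball_cong)
qed

lemma coequalizerD:
  assumes "is_coequalizer A f g p"
  shows "f \<in> arrs A" "g \<in> arrs A" "p \<in> arrs A" "src A g = src A f" "trg A g = trg A f"
    "src A p = trg A f" "p \<cdot> f = p \<cdot> g"
  using assms by (auto simp: is_coequalizer_def in_homset)

lemma coequalizer_factor:
  assumes "is_coequalizer A f g p" "h \<in> arrs A" "src A h = trg A f" "h \<cdot> f = h \<cdot> g"
  obtains u where "u \<in> arrs A" "src A u = trg A p" "trg A u = trg A h" "u \<cdot> p = h"
  using assms unfolding is_coequalizer_def by (metis in_homset)

lemma coequalizer_epi:
  assumes "is_coequalizer A f g p" "u \<in> arrs A" "v \<in> arrs A" "src A u = trg A p" "src A v = trg A p"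
    "u \<cdot> p = v \<cdot> p"
  shows "u = v"
proof -
  note d = coequalizerD[OF assms(1)]
  have "trg A u = trg A v"
    using assms d cmp_arr(3)[of p u] cmp_arr(3)[of p v] by simp
  moreover have "\<exists>!w. w \<in> homset A (trg A p) (trg A u) \<and> w \<cdot> p = u \<cdot> p"
    using assms(1,2,4) d assoc_right[of f p u] assoc_right[of g p u]
    unfolding is_coequalizer_def by (simp add: in_homset)
  ultimately show ?thesis
    using assms by (auto simp: in_homset)
qed

lemma coequalizerI:
  assumes "f \<in> arrs A" "g \<in> arrs A" "p \<in> arrs A" "src A g = src A f" "trg A g = trg A f"
    "src A p = trg A f" "p \<cdot> f = p \<cdot> g"
    and ex: "\<And>h. \<lbrakk>h \<in> arrs A; src A h = trg A f; h \<cdot> f = h \<cdot> g\<rbrakk>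
      \<Longrightarrow> \<exists>u. u \<in> arrs A \<and> src A u = trg A p \<and> trg A u = trg A h \<and> u \<cdot> p = h"
    and epi: "\<And>u v. \<lbrakk>u \<in> arrs A; v \<in> arrs A; src A u = trg A p; src A v = trg A p; trg A u = trg A v;
        u \<cdot> p = v \<cdot> p\<rbrakk> \<Longrightarrow> u = v"
  shows "is_coequalizer A f g p"
  unfolding is_coequalizer_def
proof (intro conjI allI ballI impI)
  fix Z h assume h: "h \<in> homset A (trg A f) Z" "h \<cdot> f = h \<cdot> g"
  show "\<exists>!u. u \<in> homset A (trg A p) Z \<and> u \<cdot> p = h"
    using ex[of h] h epi by (intro ex_ex1I) (auto simp: in_homset)
qed (use assms in \<open>auto simp: in_homset\<close>)

text \<open>Cokernels are the coequalizers with a zero arrow, so they inherit all of the above.\<close>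

lemma cokernel_iff_coequalizer:
  "is_cokernel A f p \<longleftrightarrow> f \<in> arrs A \<and> is_coequalizer A f (zro A (src A f) (trg A f)) p"
proof (cases "f \<in> arrs A")
  case True
  have "zro A (src A f) (trg A f) \<in> homset A (src A f) (trg A f)"
    using True by (auto simp: in_homset)
  then show ?thesis
    using True unfolding is_cokernel_def is_coequalizer_def
    by (auto simp: in_homset)
qed (simp add: is_cokernel_def)

lemma cokernelD:
  assumes "is_cokernel A f p"
  shows "f \<in> arrs A" "p \<in> arrs A" "src A p = trg A f" "p \<cdot> f = zro A (src A f) (trg A p)"
  using assms by (auto simp: is_cokernel_def)

lemma cokernel_epi:
  assumes "is_cokernel A f p" "u \<in> arrs A" "v \<in> arrs A" "src A u = trg A p" "src A v = trg A p"
    "u \<cdot> p = v \<cdot> p"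
  shows "u = v"
  using assms coequalizer_epi unfolding cokernel_iff_coequalizer by metis

lemma cokernel_factor:
  assumes "is_cokernel A f p" "h \<in> arrs A" "src A h = trg A f" "h \<cdot> f = zro A (src A f) (trg A h)"
  obtains u where "u \<in> arrs A" "src A u = trg A p" "trg A u = trg A h" "u \<cdot> p = h"
  using assms unfolding is_cokernel_def by (metis in_homset)

lemma cokernelI:
  assumes "f \<in> arrs A" "p \<in> arrs A" "src A p = trg A f" "p \<cdot> f = zro A (src A f) (trg A p)"
    and ex: "\<And>h. \<lbrakk>h \<in> arrs A; src A h = trg A f; h \<cdot> f = zro A (src A f) (trg A h)\<rbrakk>
      \<Longrightarrow> \<exists>u. u \<in> arrs A \<and> src A u = trg A p \<and> trg A u = trg A h \<and> u \<cdot> p = h"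
    and epi: "\<And>u v. \<lbrakk>u \<in> arrs A; v \<in> arrs A; src A u = trg A p; src A v = trg A p; trg A u = trg A v;
        u \<cdot> p = v \<cdot> p\<rbrakk> \<Longrightarrow> u = v"
  shows "is_cokernel A f p"
  unfolding is_cokernel_def
proof (intro conjI allI ballI impI)
  fix Z h assume h: "h \<in> homset A (trg A f) Z" "h \<cdot> f = zro A (src A f) Z"
  show "\<exists>!u. u \<in> homset A (trg A p) Z \<and> u \<cdot> p = h"
    using ex[of h] h epi by (intro ex_ex1I) (auto simp: in_homset)
qed (use assms in \<open>auto simp: in_homset\<close>)

lemma isoI:
  assumes "f \<in> arrs A" "g \<in> arrs A" "src A g = trg A f" "trg A g = src A f"
    "g \<cdot> f = ide A (src A f)" "f \<cdot> g = ide A (trg A f)"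
  shows "is_iso A f"
  using assms unfolding is_iso_def by (auto simp: in_homset)

lemma isoE:
  assumes "is_iso A f"
  obtains g where "f \<in> arrs A" "g \<in> arrs A" "src A g = trg A f" "trg A g = src A f"
    "g \<cdot> f = ide A (src A f)" "f \<cdot> g = ide A (trg A f)"
  using assms unfolding is_iso_def by (auto simp: in_homset)

lemma iso_mono:
  assumes "is_iso A f" "u \<in> arrs A" "v \<in> arrs A" "trg A u = src A f" "trg A v = src A f"
    "f \<cdot> u = f \<cdot> v"
  shows "u = v"
proof -
  obtain g where g: "f \<in> arrs A" "g \<in> arrs A" "src A g = trg A f" "trg A g = src A f"
    "g \<cdot> f = ide A (src A f)" "f \<cdot> g = ide A (trg A f)"
    using assms(1) by (rule isoE)
  have "g \<cdot> (f \<cdot> u) = g \<cdot> (f \<cdot> v)"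
    using assms by simp
  then show ?thesis
    using g assms(2-5) whisker[OF g(5)] by simp
qed

lemma iso_epi:
  assumes "is_iso A f" "u \<in> arrs A" "v \<in> arrs A" "src A u = trg A f" "src A v = trg A f"
    "u \<cdot> f = v \<cdot> f"
  shows "u = v"
proof -
  obtain g where g: "f \<in> arrs A" "g \<in> arrs A" "src A g = trg A f" "trg A g = src A f"
    "g \<cdot> f = ide A (src A f)" "f \<cdot> g = ide A (trg A f)"
    using assms(1) by (rule isoE)
  have "u = (u \<cdot> f) \<cdot> g" "v = (v \<cdot> f) \<cdot> g"
    using g assms(2-5) by simp_all
  then show ?thesis
    using assms(6) by simp
qed

lemma cokernel_unique:
  assumes p: "is_cokernel A f p" and p': "is_cokernel A f p'"
  obtains i where "is_iso A i" "i \<in> arrs A" "src A i = trg A p" "trg A i = trg A p'" "i \<cdot> p = p'"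
proof -
  note [simp] = cokernelD[OF p] cokernelD(2,3)[OF p']
  obtain i where i: "i \<in> arrs A" "src A i = trg A p" "trg A i = trg A p'" "i \<cdot> p = p'"
    using cokernel_factor[OF p, of p'] cokernelD(4)[OF p'] by auto
  obtain j where j: "j \<in> arrs A" "src A j = trg A p'" "trg A j = trg A p" "j \<cdot> p' = p"
    using cokernel_factor[OF p', of p] cokernelD(4)[OF p] by auto
  have "j \<cdot> i = ide A (trg A p)"
    by (rule cokernel_epi[OF p]) (use i j in simp_all)
  moreover have "i \<cdot> j = ide A (trg A p')"
    by (rule cokernel_epi[OF p']) (use i j in simp_all)
  ultimately show ?thesis
    using i j that isoI[of i j] by simp
qed

lemma cokernel_iso:
  assumes p: "is_cokernel A f p" and i: "is_iso A i" "src A i = trg A p"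
  shows "is_cokernel A f (i \<cdot> p)"
proof -
  obtain j where j: "i \<in> arrs A" "j \<in> arrs A" "src A j = trg A i" "trg A j = src A i"
    "j \<cdot> i = ide A (src A i)" "i \<cdot> j = ide A (trg A i)"
    using i(1) by (rule isoE)
  note [simp] = cokernelD[OF p] j i(2)
  show ?thesis
  proof (rule cokernelI)
    fix h assume h: "h \<in> arrs A" "src A h = trg A f" "h \<cdot> f = zro A (src A f) (trg A h)"
    obtain u where u: "u \<in> arrs A" "src A u = trg A p" "trg A u = trg A h" "u \<cdot> p = h"
      using cokernel_factor[OF p h] .
    have "(u \<cdot> j) \<cdot> (i \<cdot> p) = h"
      using u whisker[OF j(5), of p] by simp
    then show "\<exists>u. u \<in> arrs A \<and> src A u = trg A (i \<cdot> p) \<and> trg A u = trg A h \<and> u \<cdot> (i \<cdot> p) = h"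
      using u by (intro exI[of _ "u \<cdot> j"]) simp
  next
    fix u v
    assume uv: "u \<in> arrs A" "v \<in> arrs A" "src A u = trg A (i \<cdot> p)" "src A v = trg A (i \<cdot> p)"
      "u \<cdot> (i \<cdot> p) = v \<cdot> (i \<cdot> p)"
    have "u \<cdot> i = v \<cdot> i"
      using uv by - (rule cokernel_epi[OF p], simp_all)
    then show "u = v"
      using uv by - (rule iso_epi[OF i(1)], simp_all)
  qed (use cokernelD(4)[OF p] in simp_all)
qed

end

subsection \<open>Linear functors\<close>

locale linfunctor = A: linear_category A + B: linear_category B
  for A :: "('o, 'a, 'k::field, 'z) lincat_scheme"
    and B :: "('p, 'b, 'k, 'y) lincat_scheme" +
  fixes F :: "('o, 'a, 'p, 'b, 'x) func_scheme"
  assumes linear: "linear_functor A B F"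
begin

lemma fob_obs [simp]: "X \<in> obs A \<Longrightarrow> fob F X \<in> obs B"
  using linear by (simp add: linear_functor_def)

lemma far_arr [simp]:
  assumes "f \<in> arrs A"
  shows "far F f \<in> arrs B" "src B (far F f) = fob F (src A f)" "trg B (far F f) = fob F (trg A f)"
  using linear assms by (auto simp: linear_functor_def in_homset)

lemma far_ide [simp]: "X \<in> obs A \<Longrightarrow> far F (ide A X) = ide B (fob F X)"
  using linear by (simp add: linear_functor_def)

lemma far_cmp [simp]:
  "\<lbrakk>f \<in> arrs A; g \<in> arrs A; src A g = trg A f\<rbrakk> \<Longrightarrow> far F (g \<cdot>\<^bsub>A\<^esub> f) = far F g \<cdot>\<^bsub>B\<^esub> far F f"
  using linear by (simp add: linear_functor_def in_homset)

lemma far_eq: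
  "\<lbrakk>g \<cdot>\<^bsub>A\<^esub> f = h; f \<in> arrs A; g \<in> arrs A; src A g = trg A f\<rbrakk> \<Longrightarrow> far F g \<cdot>\<^bsub>B\<^esub> far F f = far F h"
  by auto

lemma far_plus [simp]:
  "\<lbrakk>f \<in> arrs A; g \<in> arrs A; src A f = src A g; trg A f = trg A g\<rbrakk>
    \<Longrightarrow> far F (f \<oplus>\<^bsub>A\<^esub> g) = far F f \<oplus>\<^bsub>B\<^esub> far F g"
  using linear by (simp add: linear_functor_def in_homset)

lemma far_scale [simp]: "f \<in> arrs A \<Longrightarrow> far F (c \<star>\<^bsub>A\<^esub> f) = c \<star>\<^bsub>B\<^esub> far F f"
  using linear by (simp add: linear_functor_def in_homset)

lemma far_zro [simp]:
  assumes "X \<in> obs A" "Y \<in> obs A"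
  shows "far F (zro A X Y) = zro B (fob F X) (fob F Y)"
  using B.plus_idem_zro[of "far F (zro A X Y)"] far_plus[of "zro A X Y" "zro A X Y"]
    A.plus_zro[of "zro A X Y" X Y] assms
  by (simp add: in_homset)

lemma far_iso:
  assumes "is_iso A f"
  shows "is_iso B (far F f)"
proof -
  obtain g where g: "f \<in> arrs A" "g \<in> arrs A" "src A g = trg A f" "trg A g = src A f"
    "g \<cdot>\<^bsub>A\<^esub> f = ide A (src A f)" "f \<cdot>\<^bsub>A\<^esub> g = ide A (trg A f)"
    using assms by (rule A.isoE)
  then show ?thesis
    using far_cmp[of f g] far_cmp[of g f] by (intro B.isoI[of _ "far F g"]) simp_all
qed

text \<open>A linear functor commutes with differences, and a coequalizer is a cokernel of the
  difference.\<close>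

lemma right_exact_coequalizer:
  assumes "right_exact A B F" "is_coequalizer A f g p"
  shows "is_coequalizer B (far F f) (far F g) (far F p)"
proof -
  note [simp] = A.coequalizerD[OF assms(2)]
  have "is_cokernel A (f \<oplus>\<^bsub>A\<^esub> (-1) \<star>\<^bsub>A\<^esub> g) p"
    using assms(2) by (subst A.cokernel_diff_iff_coequalizer) simp_all
  then have "is_cokernel B (far F (f \<oplus>\<^bsub>A\<^esub> (-1) \<star>\<^bsub>A\<^esub> g)) (far F p)"
    using assms(1) unfolding right_exact_def by blast
  then have "is_cokernel B (far F f \<oplus>\<^bsub>B\<^esub> (-1) \<star>\<^bsub>B\<^esub> far F g) (far F p)"
    by simp
  then show ?thesis
    by (subst B.cokernel_diff_iff_coequalizer[symmetric]) simp_all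
qed

end

lemma right_exact_linear: "right_exact A B F \<Longrightarrow> linear_functor A B F"
  by (simp add: right_exact_def)

text \<open>Objects of the functor categories are undefined off the carriers, whereas composites of
  functors are not. This lemma and its variants for right exact and lax module functors pass between
  the two.\<close>

lemma linear_functor_cong:
  assumes "linear_category A" "linear_functor A B F" "\<And>X. X \<in> obs A \<Longrightarrow> fob G X = fob F X"
    "\<And>f. f \<in> arrs A \<Longrightarrow> far G f = far F f"
  shows "linear_functor A B G"
proof -
  interpret linear_category A by fact
  have *: "\<And>X Y f. f \<in> homset A X Y \<Longrightarrow> fob G X = fob F X \<and> fob G Y = fob F Y \<and> far G f = far F f"
    using assms(3,4) src_obs trg_obs by (auto simp: in_homset)
  show ?thesis
    using assms(2) unfolding linear_functor_def
    apply (intro conjI)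
         apply (simp add: assms(3))
        apply (simp add: *)
       apply (simp add: assms(3,4))
      apply (metis * cmp_hom)
     apply (metis * plus_hom)
    apply (metis * scale_hom)
    done
qed

lemma right_exact_cong:
  assumes "linear_category A" "right_exact A B F" "\<And>X. X \<in> obs A \<Longrightarrow> fob G X = fob F X"
    "\<And>f. f \<in> arrs A \<Longrightarrow> far G f = far F f"
  shows "right_exact A B G"
  unfolding right_exact_def
proof (intro conjI allI impI)
  show "linear_functor A B G"
    using assms by (intro linear_functor_cong[OF assms(1) _ assms(3,4)]) (simp_all add: right_exact_def)
  show "is_cokernel B (far G f) (far G p)" if "is_cokernel A f p" for f p
    using that assms(2,4) linear_category.cokernelD[OF assms(1) that] by (simp add: right_exact_def)
qed

lemma linear_functor_comp:
  assumes F: "linear_functor A B F" and G: "linear_functor B D G"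
    and H: "\<And>X. fob H X = fob G (fob F X)" "\<And>f. far H f = far G (far F f)"
  shows "linear_functor A D H"
  unfolding linear_functor_def H
proof (intro conjI allI ballI)
  fix X Y Z f g c
  have F1: "\<And>X Y f. f \<in> homset A X Y \<Longrightarrow> far F f \<in> homset B (fob F X) (fob F Y)"
    and G1: "\<And>X Y f. f \<in> homset B X Y \<Longrightarrow> far G f \<in> homset D (fob G X) (fob G Y)"
    using F G by (simp_all add: linear_functor_def)
  assume f: "f \<in> homset A X Y"
  show "far G (far F f) \<in> homset D (fob G (fob F X)) (fob G (fob F Y))"
    using f F1 G1 by blast
  show "far G (far F (c \<star>\<^bsub>A\<^esub> f)) = c \<star>\<^bsub>D\<^esub> far G (far F f)"
    using F G F1[OF f] f unfolding linear_functor_def by metis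
  show "far G (far F (g \<cdot>\<^bsub>A\<^esub> f)) = far G (far F g) \<cdot>\<^bsub>D\<^esub> far G (far F f)"
    if "g \<in> homset A Y Z"
    using F G F1[OF f] F1[OF that] f that unfolding linear_functor_def by metis
  show "far G (far F (f \<oplus>\<^bsub>A\<^esub> g)) = far G (far F f) \<oplus>\<^bsub>D\<^esub> far G (far F g)"
    if "g \<in> homset A X Y"
    using F G F1[OF f] F1[OF that] f that unfolding linear_functor_def by metis
qed (use F G in \<open>simp_all add: linear_functor_def\<close>)

lemma right_exact_comp:
  assumes "right_exact A B F" "right_exact B D G"
    "\<And>X. fob H X = fob G (fob F X)" "\<And>f. far H f = far G (far F f)"
  shows "right_exact A D H"
  using assms linear_functor_comp[of A B F D G H] by (simp add: right_exact_def)

subsection \<open>Fully faithful and essentially surjective functors\<close>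

text \<open>Choose for every \<open>Y\<close> an object \<open>P Y\<close> with an isomorphism
  \<open>e Y\<close> from its image to \<open>Y\<close>, with inverse \<open>d Y\<close>. The
  quasi-inverse sends \<open>g\<close> to the preimage of its conjugate by these isomorphisms;
  faithfulness transfers functoriality and linearity from \<open>B\<close> to
  \<open>A\<close>.\<close>

lemma equivalence_of_categoriesI:
  assumes A: "linear_category A" and B: "linear_category B" and lin: "linear_functor A B F"
    and faith: "faithful A F"
    and full: "\<And>X Y g. \<lbrakk>X \<in> obs A; Y \<in> obs A; g \<in> homset B (fob F X) (fob F Y)\<rbrakk>
      \<Longrightarrow> \<exists>f \<in> homset A X Y. far F f = g"
    and surj: "\<And>Y. Y \<in> obs B \<Longrightarrow> \<exists>X \<in> obs A. \<exists>e \<in> homset B (fob F X) Y. is_iso B e"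
  shows "equivalence_of_categories A B F"
proof -
  interpret F: linfunctor A B F
    using A B lin by (simp add: linfunctor_def linfunctor_axioms_def)
  have "\<exists>X e d. X \<in> obs A \<and> e \<in> homset B (fob F X) Y \<and> d \<in> homset B Y (fob F X) \<and>
      d \<cdot>\<^bsub>B\<^esub> e = ide B (fob F X) \<and> e \<cdot>\<^bsub>B\<^esub> d = ide B Y" if Y: "Y \<in> obs B" for Y
  proof -
    obtain X e where X: "X \<in> obs A" "e \<in> homset B (fob F X) Y" "is_iso B e"
      using surj[OF Y] by blast
    show ?thesis
      using F.B.isoE[OF X(3)] X by (metis in_homset)
  qed
  then obtain P e d where P [simp]: "\<And>Y. Y \<in> obs B \<Longrightarrow> P Y \<in> obs A"
    and "\<And>Y. Y \<in> obs B \<Longrightarrow> e Y \<in> homset B (fob F (P Y)) Y"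
    and "\<And>Y. Y \<in> obs B \<Longrightarrow> d Y \<in> homset B Y (fob F (P Y))"
    and de: "\<And>Y. Y \<in> obs B \<Longrightarrow> d Y \<cdot>\<^bsub>B\<^esub> e Y = ide B (fob F (P Y))"
    and ed: "\<And>Y. Y \<in> obs B \<Longrightarrow> e Y \<cdot>\<^bsub>B\<^esub> d Y = ide B Y"
    by metis
  then have [simp]: "\<And>Y. Y \<in> obs B \<Longrightarrow> e Y \<in> arrs B" "\<And>Y. Y \<in> obs B \<Longrightarrow> src B (e Y) = fob F (P Y)"
    "\<And>Y. Y \<in> obs B \<Longrightarrow> trg B (e Y) = Y" "\<And>Y. Y \<in> obs B \<Longrightarrow> d Y \<in> arrs B"
    "\<And>Y. Y \<in> obs B \<Longrightarrow> src B (d Y) = Y" "\<And>Y. Y \<in> obs B \<Longrightarrow> trg B (d Y) = fob F (P Y)"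
    by (simp_all add: in_homset)
  note de' = F.B.whisker[OF de] and ed' = F.B.whisker[OF ed]
  \<comment> \<open>Fullness provides such an arrow, and faithfulness makes the choice
    unique.\<close>
  define Q where
    "Q g = (SOME f. f \<in> homset A (P (src B g)) (P (trg B g)) \<and>
      far F f = d (trg B g) \<cdot>\<^bsub>B\<^esub> (g \<cdot>\<^bsub>B\<^esub> e (src B g)))" for g
  have Q: "Q g \<in> homset A (P (src B g)) (P (trg B g)) \<and>
      far F (Q g) = d (trg B g) \<cdot>\<^bsub>B\<^esub> (g \<cdot>\<^bsub>B\<^esub> e (src B g))" if "g \<in> arrs B" for g
    unfolding Q_def
  proof (rule someI_ex)
    show "\<exists>f. f \<in> homset A (P (src B g)) (P (trg B g)) \<and>
        far F f = d (trg B g) \<cdot>\<^bsub>B\<^esub> (g \<cdot>\<^bsub>B\<^esub> e (src B g))"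
      using full[of "P (src B g)" "P (trg B g)" "d (trg B g) \<cdot>\<^bsub>B\<^esub> (g \<cdot>\<^bsub>B\<^esub> e (src B g))"] that
      by (auto simp: in_homset)
  qed
  then have [simp]: "\<And>g. g \<in> arrs B \<Longrightarrow> Q g \<in> arrs A" "\<And>g. g \<in> arrs B \<Longrightarrow> src A (Q g) = P (src B g)"
    "\<And>g. g \<in> arrs B \<Longrightarrow> trg A (Q g) = P (trg B g)"
    "\<And>g. g \<in> arrs B \<Longrightarrow> far F (Q g) = d (trg B g) \<cdot>\<^bsub>B\<^esub> (g \<cdot>\<^bsub>B\<^esub> e (src B g))"
    by (simp_all add: in_homset)
  have inj: "f = g" if "f \<in> arrs A" "g \<in> arrs A" "src A f = src A g" "trg A f = trg A g"
    "far F f = far F g" for f g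
    using faith[unfolded faithful_def, rule_format, of "src A g" "trg A g" f g] that
    by (simp add: in_homset)
  define G where "G = \<lparr>fob = P, far = Q\<rparr>"
  have linG: "linear_functor B A G"
    unfolding linear_functor_def G_def func.simps
  proof (intro conjI allI ballI)
    show "Q (ide B X) = ide A (P X)" if "X \<in> obs B" for X
      using that by (intro inj) (simp_all add: de)
  next
    fix X Y Z f g c assume f: "f \<in> homset B X Y"
    then have [simp]: "f \<in> arrs B" "src B f = X" "trg B f = Y" "X \<in> obs B" "Y \<in> obs B"
      using F.B.src_obs F.B.trg_obs by (auto simp: in_homset)
    show "Q f \<in> homset A (P X) (P Y)"
      by (simp add: in_homset)
    show "Q (c \<star>\<^bsub>B\<^esub> f) = c \<star>\<^bsub>A\<^esub> Q f"
      by (intro inj) (simp_all add: F.B.cmp_scale F.B.scale_cmp)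
    show "Q (g \<cdot>\<^bsub>B\<^esub> f) = Q g \<cdot>\<^bsub>A\<^esub> Q f" if "g \<in> homset B Y Z"
      using that by (intro inj) (auto simp: in_homset ed')
    show "Q (f \<oplus>\<^bsub>B\<^esub> g) = Q f \<oplus>\<^bsub>A\<^esub> Q g" if "g \<in> homset B X Y"
      using that by (intro inj) (auto simp: in_homset F.B.plus_cmp F.B.cmp_plus)
  qed simp
  \<comment> \<open>The component of the first natural isomorphism is the preimage of
    \<open>e\<close> at an object in the image of \<open>F\<close>; its inverse will be the preimage
    of \<open>d\<close>.\<close>
  have "\<exists>u. u \<in> homset A (P (fob F X)) X \<and> far F u = e (fob F X)" if "X \<in> obs A" for X
    using full[of "P (fob F X)" X "e (fob F X)"] that by (auto simp: in_homset)
  then obtain u where u: "\<And>X. X \<in> obs A \<Longrightarrow> u X \<in> homset A (P (fob F X)) X \<and> far F (u X) = e (fob F X)"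
    by metis
  then have [simp]: "\<And>X. X \<in> obs A \<Longrightarrow> u X \<in> arrs A" "\<And>X. X \<in> obs A \<Longrightarrow> src A (u X) = P (fob F X)"
    "\<And>X. X \<in> obs A \<Longrightarrow> trg A (u X) = X" "\<And>X. X \<in> obs A \<Longrightarrow> far F (u X) = e (fob F X)"
    by (simp_all add: in_homset)
  have "naturally_isomorphic A A (comp_func G F) id_func"
    unfolding naturally_isomorphic_def natural_def comp_func_def id_func_def G_def func.simps
  proof (intro exI[of _ u] conjI ballI allI)
    show "u Y \<cdot>\<^bsub>A\<^esub> Q (far F f) = f \<cdot>\<^bsub>A\<^esub> u X" if "f \<in> homset A X Y" for X Y f
      using that by (intro inj) (auto simp: in_homset ed')
    fix X assume [simp]: "X \<in> obs A"
    obtain v where v: "v \<in> homset A X (P (fob F X))" "far F v = d (fob F X)"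
      using full[of X "P (fob F X)" "d (fob F X)"] by (auto simp: in_homset)
    then show "is_iso A (u X)"
      by (intro F.A.isoI[of _ v] inj) (auto simp: in_homset ed de)
  qed (simp add: in_homset)
  moreover have "naturally_isomorphic B B (comp_func F G) id_func"
    unfolding naturally_isomorphic_def natural_def comp_func_def id_func_def G_def func.simps
  proof (intro exI[of _ e] conjI ballI allI)
    show "e Y \<cdot>\<^bsub>B\<^esub> far F (Q f) = f \<cdot>\<^bsub>B\<^esub> e X" if "f \<in> homset B X Y" for X Y f
      using that by (auto simp: in_homset ed')
    show "is_iso B (e Y)" if "Y \<in> obs B" for Y
      using that by (intro F.B.isoI[of _ "d Y"]) (simp_all add: ed de)
  qed (simp add: in_homset)
  ultimately show ?thesis
    using A B lin linG unfolding equivalence_of_categories_def by blast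
qed

section \<open>Module categories, lax module functors and their transformations\<close>

text \<open>The data to which lax module functors and module transformations refer. Both
  \<open>A\<close> and the Eilenberg--Moore categories with the Linton action are instances, so the
  composition of lax functors and the linear structure on transformations are treated once for all
  of them.\<close>

locale module_action = C: linear_category C + A: linear_category A
  for C :: "('v, 'w, 'k::field, 'z) moncat_scheme"
    and A :: "('v, 'w, 'o, 'a, 'k, 'y) modcat_scheme" (structure) +
  assumes act: "bilinear_functor C A A (act_ob A) (act_ar A)"
    and tensor_obs [simp]: "\<lbrakk>V \<in> obs C; W \<in> obs C\<rbrakk> \<Longrightarrow> V \<otimes>\<^bsub>C\<^esub> W \<in> obs C"
    and unit_obs [simp]: "\<one>\<^bsub>C\<^esub> \<in> obs C"
    and massoc_homset: "\<lbrakk>V \<in> obs C; W \<in> obs C; M \<in> obs A\<rbrakk> \<Longrightarrow>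
        massoc A V W M \<in> homset A ((V \<otimes>\<^bsub>C\<^esub> W) \<rhd> M) (V \<rhd> (W \<rhd> M))"
    and munit_homset: "M \<in> obs A \<Longrightarrow> munit A M \<in> homset A (\<one>\<^bsub>C\<^esub> \<rhd> M) M"
begin

lemma act_obs [simp]: "\<lbrakk>V \<in> obs C; M \<in> obs A\<rbrakk> \<Longrightarrow> V \<rhd> M \<in> obs A"
  using act by (simp add: bilinear_functor_def)

lemma act_arr [simp]:
  assumes "f \<in> arrs C" "g \<in> arrs A"
  shows "f \<unrhd> g \<in> arrs A" "src A (f \<unrhd> g) = src C f \<rhd> src A g" "trg A (f \<unrhd> g) = trg C f \<rhd> trg A g"
  using act assms by (auto simp: bilinear_functor_def in_homset)

lemma act_ide [simp]: "\<lbrakk>V \<in> obs C; M \<in> obs A\<rbrakk> \<Longrightarrow> ide C V \<unrhd> ide A M = ide A (V \<rhd> M)"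
  using act by (simp add: bilinear_functor_def)

lemma act_cmp:
  "\<lbrakk>f \<in> arrs C; f' \<in> arrs C; src C f' = trg C f; g \<in> arrs A; g' \<in> arrs A; src A g' = trg A g\<rbrakk>
    \<Longrightarrow> (f' \<cdot>\<^bsub>C\<^esub> f) \<unrhd> (g' \<cdot> g) = (f' \<unrhd> g') \<cdot> (f \<unrhd> g)"
  using act by (simp add: bilinear_functor_def in_homset)

lemma ide_act_cmp [simp]:
  "\<lbrakk>V \<in> obs C; g \<in> arrs A; g' \<in> arrs A; src A g' = trg A g\<rbrakk>
    \<Longrightarrow> ide C V \<unrhd> (g' \<cdot> g) = (ide C V \<unrhd> g') \<cdot> (ide C V \<unrhd> g)"
  using act_cmp[of "ide C V" "ide C V" g g'] by simp

lemma ide_act_plus [simp]: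
  "\<lbrakk>V \<in> obs C; g \<in> arrs A; g' \<in> arrs A; src A g' = src A g; trg A g' = trg A g\<rbrakk>
    \<Longrightarrow> ide C V \<unrhd> (g \<oplus> g') = (ide C V \<unrhd> g) \<oplus> (ide C V \<unrhd> g')"
  using act[unfolded bilinear_functor_def, THEN conjunct2, THEN conjunct2, THEN conjunct2,
      THEN conjunct2, THEN conjunct2, THEN conjunct1]
  by (simp add: in_homset)

lemma ide_act_scale [simp]:
  "\<lbrakk>V \<in> obs C; g \<in> arrs A\<rbrakk> \<Longrightarrow> ide C V \<unrhd> (c \<star> g) = c \<star> (ide C V \<unrhd> g)"
  using act[unfolded bilinear_functor_def, THEN conjunct2, THEN conjunct2, THEN conjunct2,
      THEN conjunct2, THEN conjunct2, THEN conjunct2]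
  by (simp add: in_homset)

lemma linear_act_left: "V \<in> obs C \<Longrightarrow> linear_functor A A (act_left C A V)"
  by (auto simp: linear_functor_def act_left_def in_homset)

lemma massoc_arr [simp]:
  assumes "V \<in> obs C" "W \<in> obs C" "M \<in> obs A"
  shows "massoc A V W M \<in> arrs A" "src A (massoc A V W M) = (V \<otimes>\<^bsub>C\<^esub> W) \<rhd> M"
    "trg A (massoc A V W M) = V \<rhd> (W \<rhd> M)"
  using massoc_homset[OF assms] by (simp_all add: in_homset)

lemma munit_arr [simp]:
  assumes "M \<in> obs A"
  shows "munit A M \<in> arrs A" "src A (munit A M) = \<one>\<^bsub>C\<^esub> \<rhd> M" "trg A (munit A M) = M"
  using munit_homset[OF assms] by (simp_all add: in_homset)

end

locale lax_functor = A: module_action C A + B: module_action C B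
  for C :: "('v, 'w, 'k::field, 'z) moncat_scheme"
    and A :: "('v, 'w, 'o, 'a, 'k, 'y) modcat_scheme"
    and B :: "('v, 'w, 'p, 'b, 'k, 'x) modcat_scheme" +
  fixes F :: "('v, 'o, 'a, 'p, 'b, 'u) laxfun_scheme"
  assumes lax_module: "lax_module_functor C A B F"

sublocale lax_functor \<subseteq> linfunctor A B F
  using lax_module by unfold_locales (simp add: lax_module_functor_def)

context lax_functor
begin

lemma lax_arr [simp]:
  assumes "V \<in> obs C" "M \<in> obs A"
  shows "lax F V M \<in> arrs B" "src B (lax F V M) = V \<rhd>\<^bsub>B\<^esub> fob F M"
    "trg B (lax F V M) = fob F (V \<rhd>\<^bsub>A\<^esub> M)"
  using lax_module assms by (simp_all add: lax_module_functor_def in_homset)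

lemma lax_natural:
  "\<lbrakk>f \<in> arrs C; g \<in> arrs A; src C f = V; src A g = M\<rbrakk> \<Longrightarrow>
    far F (f \<unrhd>\<^bsub>A\<^esub> g) \<cdot>\<^bsub>B\<^esub> lax F V M = lax F (trg C f) (trg A g) \<cdot>\<^bsub>B\<^esub> (f \<unrhd>\<^bsub>B\<^esub> far F g)"
  using lax_module by (simp add: lax_module_functor_def in_homset)

lemma lax_natural_ide:
  "\<lbrakk>V \<in> obs C; g \<in> arrs A; src A g = M\<rbrakk> \<Longrightarrow>
    far F (ide C V \<unrhd>\<^bsub>A\<^esub> g) \<cdot>\<^bsub>B\<^esub> lax F V M = lax F V (trg A g) \<cdot>\<^bsub>B\<^esub> (ide C V \<unrhd>\<^bsub>B\<^esub> far F g)"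
  using lax_natural[of "ide C V" g V M] by simp

lemma lax_natural_ide_rev:
  "\<lbrakk>V \<in> obs C; g \<in> arrs A; trg A g = M\<rbrakk> \<Longrightarrow>
    lax F V M \<cdot>\<^bsub>B\<^esub> (ide C V \<unrhd>\<^bsub>B\<^esub> far F g) = far F (ide C V \<unrhd>\<^bsub>A\<^esub> g) \<cdot>\<^bsub>B\<^esub> lax F V (src A g)"
  using lax_natural_ide by auto

lemma lax_massoc:
  "\<lbrakk>V \<in> obs C; W \<in> obs C; M \<in> obs A\<rbrakk> \<Longrightarrow> far F (massoc A V W M) \<cdot>\<^bsub>B\<^esub> lax F (V \<otimes>\<^bsub>C\<^esub> W) M
    = lax F V (W \<rhd>\<^bsub>A\<^esub> M) \<cdot>\<^bsub>B\<^esub> ((ide C V \<unrhd>\<^bsub>B\<^esub> lax F W M) \<cdot>\<^bsub>B\<^esub> massoc B V W (fob F M))"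
  using lax_module by (simp add: lax_module_functor_def)

lemma lax_munit:
  "M \<in> obs A \<Longrightarrow> far F (munit A M) \<cdot>\<^bsub>B\<^esub> lax F \<one>\<^bsub>C\<^esub> M = munit B (fob F M)"
  using lax_module by (simp add: lax_module_functor_def)

lemmas lax_natural_ide' = B.A.whisker[OF lax_natural_ide]
lemmas lax_natural_ide_rev' = B.A.whisker[OF lax_natural_ide_rev]

end

lemma lax_module_functor_cong:
  assumes F: "lax_module_functor C A B F" and "module_action C A"
    and ob: "\<And>M. M \<in> obs A \<Longrightarrow> fob G M = fob F M"
    and ar: "\<And>f. f \<in> arrs A \<Longrightarrow> far G f = far F f"
    and lx: "\<And>V M. \<lbrakk>V \<in> obs C; M \<in> obs A\<rbrakk> \<Longrightarrow> lax G V M = lax F V M"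
  shows "lax_module_functor C A B G"
proof -
  interpret module_action C A by fact
  have "linear_functor A B G"
    by (rule linear_functor_cong[OF A.linear_category_axioms _ ob ar])
      (use F in \<open>simp_all add: lax_module_functor_def\<close>)
  moreover have "far G (f \<unrhd>\<^bsub>A\<^esub> g) \<cdot>\<^bsub>B\<^esub> lax G V M = lax G V' M' \<cdot>\<^bsub>B\<^esub> (f \<unrhd>\<^bsub>B\<^esub> far G g)"
    if "f \<in> homset C V V'" "g \<in> homset A M M'" for V V' M M' f g
  proof -
    have "f \<in> arrs C" "g \<in> arrs A" "V \<in> obs C" "M \<in> obs A" "V' \<in> obs C" "M' \<in> obs A"
      using that by (auto simp: in_homset)
    then show ?thesis
      using F that by (simp add: ob ar lx lax_module_functor_def)
  qed
  ultimately show ?thesis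
    using F unfolding lax_module_functor_def
    by (simp add: ob ar lx)
qed

lemma lax_module_functor_comp:
  assumes "module_action C A" "module_action C B" "module_action C D"
    and "lax_module_functor C A B F" "lax_module_functor C B D G"
  shows "lax_module_functor C A D (comp_lax D G F)"
proof -
  interpret F: lax_functor C A B F
    using assms by (simp add: lax_functor_def lax_functor_axioms_def)
  interpret G: lax_functor C B D G
    using assms by (simp add: lax_functor_def lax_functor_axioms_def)
  show ?thesis
    unfolding lax_module_functor_def
  proof (intro conjI ballI allI)
    show "linear_functor A D (comp_lax D G F)"
      using F.linear G.linear by (rule linear_functor_comp) (simp_all add: comp_lax_def)
  next
    fix V V' M M' f g
    assume "f \<in> homset C V V'" "g \<in> homset A M M'"
    then have fg: "f \<in> arrs C" "src C f = V" "trg C f = V'" "g \<in> arrs A" "src A g = M" "trg A g = M'"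
      "V \<in> obs C" "V' \<in> obs C" "M \<in> obs A" "M' \<in> obs A"
      by (auto simp: in_homset)
    have "far G (far F (f \<unrhd>\<^bsub>A\<^esub> g)) \<cdot>\<^bsub>D\<^esub> (far G (lax F V M) \<cdot>\<^bsub>D\<^esub> lax G V (fob F M)) =
      far G (far F (f \<unrhd>\<^bsub>A\<^esub> g) \<cdot>\<^bsub>B\<^esub> lax F V M) \<cdot>\<^bsub>D\<^esub> lax G V (fob F M)"
      using fg by simp
    also have "\<dots> = far G (lax F V' M') \<cdot>\<^bsub>D\<^esub> (far G (f \<unrhd>\<^bsub>B\<^esub> far F g) \<cdot>\<^bsub>D\<^esub> lax G V (fob F M))"
      using fg by (simp add: F.lax_natural)
    also have "\<dots> = far G (lax F V' M') \<cdot>\<^bsub>D\<^esub> (lax G V' (fob F M') \<cdot>\<^bsub>D\<^esub> (f \<unrhd>\<^bsub>D\<^esub> far G (far F g)))"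
      using fg by (simp add: G.lax_natural)
    finally show "far (comp_lax D G F) (f \<unrhd>\<^bsub>A\<^esub> g) \<cdot>\<^bsub>D\<^esub> lax (comp_lax D G F) V M =
      lax (comp_lax D G F) V' M' \<cdot>\<^bsub>D\<^esub> (f \<unrhd>\<^bsub>D\<^esub> far (comp_lax D G F) g)"
      using fg by (simp add: comp_lax_def)
  next
    fix V W M
    assume [simp]: "V \<in> obs C" "W \<in> obs C" "M \<in> obs A"
    let ?V = "ide C V" and ?M = "fob F M"
    have "far G (far F (massoc A V W M)) \<cdot>\<^bsub>D\<^esub> (far G (lax F (V \<otimes>\<^bsub>C\<^esub> W) M) \<cdot>\<^bsub>D\<^esub> lax G (V \<otimes>\<^bsub>C\<^esub> W) ?M) =
      far G (far F (massoc A V W M) \<cdot>\<^bsub>B\<^esub> lax F (V \<otimes>\<^bsub>C\<^esub> W) M) \<cdot>\<^bsub>D\<^esub> lax G (V \<otimes>\<^bsub>C\<^esub> W) ?M"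
      by simp
    also have "\<dots> = far G (lax F V (W \<rhd>\<^bsub>A\<^esub> M)) \<cdot>\<^bsub>D\<^esub> (lax G V (fob F (W \<rhd>\<^bsub>A\<^esub> M)) \<cdot>\<^bsub>D\<^esub>
        ((?V \<unrhd>\<^bsub>D\<^esub> far G (lax F W M)) \<cdot>\<^bsub>D\<^esub> ((?V \<unrhd>\<^bsub>D\<^esub> lax G W ?M) \<cdot>\<^bsub>D\<^esub> massoc D V W (fob G ?M))))"
      by (subst F.lax_massoc) (simp_all add: G.lax_massoc G.lax_natural_ide')
    finally show "far (comp_lax D G F) (massoc A V W M) \<cdot>\<^bsub>D\<^esub> lax (comp_lax D G F) (V \<otimes>\<^bsub>C\<^esub> W) M =
      lax (comp_lax D G F) V (W \<rhd>\<^bsub>A\<^esub> M) \<cdot>\<^bsub>D\<^esub> (?V \<unrhd>\<^bsub>D\<^esub> lax (comp_lax D G F) W M) \<cdot>\<^bsub>D\<^esub>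
        massoc D V W (fob (comp_lax D G F) M)"
      by (simp add: comp_lax_def)
  next
    fix M
    assume [simp]: "M \<in> obs A"
    have "far G (far F (munit A M)) \<cdot>\<^bsub>D\<^esub> (far G (lax F \<one>\<^bsub>C\<^esub> M) \<cdot>\<^bsub>D\<^esub> lax G \<one>\<^bsub>C\<^esub> (fob F M)) =
      far G (far F (munit A M) \<cdot>\<^bsub>B\<^esub> lax F \<one>\<^bsub>C\<^esub> M) \<cdot>\<^bsub>D\<^esub> lax G \<one>\<^bsub>C\<^esub> (fob F M)"
      by simp
    also have "\<dots> = munit D (fob G (fob F M))"
      by (subst F.lax_munit) (simp_all add: G.lax_munit)
    finally show "far (comp_lax D G F) (munit A M) \<cdot>\<^bsub>D\<^esub> lax (comp_lax D G F) \<one>\<^bsub>C\<^esub> M =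
      munit D (fob (comp_lax D G F) M)"
      by (simp add: comp_lax_def)
  qed (simp add: comp_lax_def in_homset)
qed

subsection \<open>Categories of transformations\<close>

lemma in_transformation_category:
  "h \<in> homset (transformation_category A B \<X> P) F G \<longleftrightarrow>
    F \<in> \<X> \<and> G \<in> \<X> \<and> (\<exists>t \<in> extensional (obs A). P F G t \<and> h = (F, t, G))"
  by (auto simp: homset_def transformation_category_def)

lemma transformation_category_simps [simp]:
  "obs (transformation_category A B \<X> P) = \<X>"
  "ide (transformation_category A B \<X> P) F = (F, \<lambda>M \<in> obs A. ide B (fob F M), F)"
  "zro (transformation_category A B \<X> P) F G = (F, \<lambda>M \<in> obs A. zro B (fob F M) (fob G M), G)"
  "(G', t, H) \<cdot>\<^bsub>transformation_category A B \<X> P\<^esub> (F, s, G) = (F, \<lambda>M \<in> obs A. t M \<cdot>\<^bsub>B\<^esub> s M, H)"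
  "(F, s, G) \<oplus>\<^bsub>transformation_category A B \<X> P\<^esub> (F', t, G'') = (F, \<lambda>M \<in> obs A. s M \<oplus>\<^bsub>B\<^esub> t M, G)"
  "c \<star>\<^bsub>transformation_category A B \<X> P\<^esub> (F, s, G) = (F, \<lambda>M \<in> obs A. c \<star>\<^bsub>B\<^esub> s M, G)"
  "src (transformation_category A B \<X> P) (F, s, G) = F"
  "trg (transformation_category A B \<X> P) (F, s, G) = G"
  by (simp_all add: transformation_category_def)

text \<open>All operations are componentwise and components are extensional, so each law holds
  pointwise in \<open>B\<close>; only closure of \<open>P\<close> under the operations is left to
  the caller. Serves for both \<open>LaxRex\<close> and \<open>Biact\<close>.\<close>

lemma linear_transformation_category:
  assumes "linear_category B"
    and ob: "\<And>F M. \<lbrakk>F \<in> \<X>; M \<in> obs A\<rbrakk> \<Longrightarrow> fob F M \<in> obs B"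
    and hom: "\<And>F G t M. \<lbrakk>F \<in> \<X>; G \<in> \<X>; P F G t; M \<in> obs A\<rbrakk> \<Longrightarrow> t M \<in> homset B (fob F M) (fob G M)"
    and ide: "\<And>F. F \<in> \<X> \<Longrightarrow> P F F (\<lambda>M \<in> obs A. ide B (fob F M))"
    and cmp: "\<And>F G H s t. \<lbrakk>F \<in> \<X>; G \<in> \<X>; H \<in> \<X>; P F G s; P G H t\<rbrakk>
      \<Longrightarrow> P F H (\<lambda>M \<in> obs A. t M \<cdot>\<^bsub>B\<^esub> s M)"
    and zro: "\<And>F G. \<lbrakk>F \<in> \<X>; G \<in> \<X>\<rbrakk> \<Longrightarrow> P F G (\<lambda>M \<in> obs A. zro B (fob F M) (fob G M))"
    and plus: "\<And>F G s t. \<lbrakk>F \<in> \<X>; G \<in> \<X>; P F G s; P F G t\<rbrakk> \<Longrightarrow> P F G (\<lambda>M \<in> obs A. s M \<oplus>\<^bsub>B\<^esub> t M)"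
    and scale: "\<And>F G s c. \<lbrakk>F \<in> \<X>; G \<in> \<X>; P F G s\<rbrakk> \<Longrightarrow> P F G (\<lambda>M \<in> obs A. c \<star>\<^bsub>B\<^esub> s M)"
  shows "linear_category (transformation_category A B \<X> P)"
proof -
  interpret B: linear_category B by fact
  have hom': "t M \<in> arrs B \<and> src B (t M) = fob F M \<and> trg B (t M) = fob G M"
    if "F \<in> \<X>" "G \<in> \<X>" "P F G t" "M \<in> obs A" for F G t M
    using hom[OF that] by (simp add: in_homset)
  have eq: "s = t" if "s \<in> extensional (obs A)" "t \<in> extensional (obs A)"
    "\<And>M. M \<in> obs A \<Longrightarrow> s M = t M" for s t :: "_ \<Rightarrow> _"
    using that by (rule extensionalityI)
  show ?thesis
  proof (unfold_locales, unfold in_transformation_category)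
    fix F G f
    assume "F \<in> \<X> \<and> G \<in> \<X> \<and> (\<exists>t\<in>extensional (obs A). P F G t \<and> f = (F, t, G))"
    then obtain t where t: "F \<in> \<X>" "G \<in> \<X>" "t \<in> extensional (obs A)" "P F G t" "f = (F, t, G)"
      by blast
    have g: "(\<lambda>M\<in>obs A. (- 1) \<star>\<^bsub>B\<^esub> t M) \<in> extensional (obs A)" "P F G (\<lambda>M\<in>obs A. (- 1) \<star>\<^bsub>B\<^esub> t M)"
      using scale[of F G t "-1"] t by auto
    have "f \<oplus>\<^bsub>transformation_category A B \<X> P\<^esub> (F, \<lambda>M\<in>obs A. (- 1) \<star>\<^bsub>B\<^esub> t M, G) =
        zro (transformation_category A B \<X> P) F G"
      using t by (auto intro!: restrict_ext simp: B.scale_minus_1 hom')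
    then show "\<exists>g\<in>homset (transformation_category A B \<X> P) F G.
        f \<oplus>\<^bsub>transformation_category A B \<X> P\<^esub> g = zro (transformation_category A B \<X> P) F G"
      using t(1,2) g unfolding in_transformation_category
      by (intro bexI[of _ "(F, \<lambda>M\<in>obs A. (- 1) \<star>\<^bsub>B\<^esub> t M, G)"]) (auto simp: in_transformation_category)
  next
    fix f assume "f \<in> arrs (transformation_category A B \<X> P)"
    then show "src (transformation_category A B \<X> P) f \<in> obs (transformation_category A B \<X> P)"
      "trg (transformation_category A B \<X> P) f \<in> obs (transformation_category A B \<X> P)"
      by (auto simp: transformation_category_def)
  qed (auto simp: hom' ob ide cmp zro plus scale in_homset B.plus_right_assoc B.scale_arr_distrib
      B.scale_arr_simps B.plus_cmp B.cmp_plus B.scale_cmp B.cmp_scale intro!: eq B.plus_arr_commute)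
qed

lemma module_transformation_hom:
  "\<lbrakk>module_transformation C A B F G t; M \<in> obs A\<rbrakk> \<Longrightarrow> t M \<in> homset B (fob F M) (fob G M)"
  by (simp add: module_transformation_def natural_def)

lemma module_transformation_arr:
  assumes "module_transformation C A B F G t" "M \<in> obs A"
  shows "t M \<in> arrs B" "src B (t M) = fob F M" "trg B (t M) = fob G M"
  using module_transformation_hom[OF assms] by (simp_all add: in_homset)

lemma module_transformation_natural:
  assumes "module_transformation C A B F G t" "f \<in> arrs A" "src A f = X"
  shows "t (trg A f) \<cdot>\<^bsub>B\<^esub> far F f = far G f \<cdot>\<^bsub>B\<^esub> t X"
  using assms unfolding module_transformation_def natural_def by (auto simp: in_homset)

lemma module_transformation_lax:
  assumes "module_transformation C A B F G t" "V \<in> obs C" "M \<in> obs A"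
  shows "t (V \<rhd>\<^bsub>A\<^esub> M) \<cdot>\<^bsub>B\<^esub> lax F V M = lax G V M \<cdot>\<^bsub>B\<^esub> (ide C V \<unrhd>\<^bsub>B\<^esub> t M)"
  using assms unfolding module_transformation_def by blast

lemma module_transformationI:
  assumes "linear_category A"
    and "\<And>M. M \<in> obs A \<Longrightarrow> t M \<in> arrs B \<and> src B (t M) = fob F M \<and> trg B (t M) = fob G M"
    and "\<And>f. f \<in> arrs A \<Longrightarrow> t (trg A f) \<cdot>\<^bsub>B\<^esub> far F f = far G f \<cdot>\<^bsub>B\<^esub> t (src A f)"
    and "\<And>V M. \<lbrakk>V \<in> obs C; M \<in> obs A\<rbrakk> \<Longrightarrow>
      t (V \<rhd>\<^bsub>A\<^esub> M) \<cdot>\<^bsub>B\<^esub> lax F V M = lax G V M \<cdot>\<^bsub>B\<^esub> (ide C V \<unrhd>\<^bsub>B\<^esub> t M)"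
  shows "module_transformation C A B F G t"
  using assms unfolding module_transformation_def natural_def by (auto simp: in_homset)

locale lax_functors = F: lax_functor C A B F + G: lax_functor C A B G for C A B F G
begin

lemma module_transformation_zro:
  "module_transformation C A B F G (\<lambda>M \<in> obs A. zro B (fob F M) (fob G M))"
proof (rule module_transformationI)
  fix V M assume [simp]: "V \<in> obs C" "M \<in> obs A"
  have "ide C V \<unrhd>\<^bsub>B\<^esub> zro B (fob F M) (fob G M) = zro B (V \<rhd>\<^bsub>B\<^esub> fob F M) (V \<rhd>\<^bsub>B\<^esub> fob G M)"
  proof -
    interpret linfunctor B B "act_left C B V"
      by unfold_locales (simp add: F.B.linear_act_left)
    show ?thesis
      using far_zro[of "fob F M" "fob G M"] by (simp add: act_left_def)
  qed
  then show "(\<lambda>M \<in> obs A. zro B (fob F M) (fob G M)) (V \<rhd>\<^bsub>A\<^esub> M) \<cdot>\<^bsub>B\<^esub> lax F V M =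
      lax G V M \<cdot>\<^bsub>B\<^esub> (ide C V \<unrhd>\<^bsub>B\<^esub> (\<lambda>M \<in> obs A. zro B (fob F M) (fob G M)) M)"
    by simp
qed (simp_all add: F.A.A.linear_category_axioms)

lemma module_transformation_plus:
  assumes s: "module_transformation C A B F G s" and t: "module_transformation C A B F G t"
  shows "module_transformation C A B F G (\<lambda>M \<in> obs A. s M \<oplus>\<^bsub>B\<^esub> t M)"
proof -
  note [simp] = module_transformation_arr[OF s] module_transformation_arr[OF t]
    module_transformation_natural[OF s] module_transformation_natural[OF t]
    module_transformation_lax[OF s] module_transformation_lax[OF t]
  show ?thesis
    by (rule module_transformationI)
      (simp_all add: F.A.A.linear_category_axioms F.B.A.plus_cmp F.B.A.cmp_plus)
qed

lemma module_transformation_scale: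
  assumes s: "module_transformation C A B F G s"
  shows "module_transformation C A B F G (\<lambda>M \<in> obs A. c \<star>\<^bsub>B\<^esub> s M)"
proof -
  note [simp] = module_transformation_arr[OF s] module_transformation_natural[OF s]
    module_transformation_lax[OF s]
  show ?thesis
    by (rule module_transformationI)
      (simp_all add: F.A.A.linear_category_axioms F.B.A.scale_cmp F.B.A.cmp_scale)
qed

lemma module_transformation_restrict_cmp:
  assumes H: "lax_functor C A B H"
    and s: "module_transformation C A B F G s" and t: "module_transformation C A B G H t"
  shows "module_transformation C A B F H (\<lambda>M \<in> obs A. t M \<cdot>\<^bsub>B\<^esub> s M)"
proof -
  interpret H: lax_functor C A B H by fact
  note [simp] = module_transformation_arr[OF s] module_transformation_arr[OF t]
    module_transformation_natural[OF s] module_transformation_lax[OF s]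
  note t' = F.B.A.whisker[OF module_transformation_natural[OF t]]
    F.B.A.whisker[OF module_transformation_lax[OF t]]
  show ?thesis
    by (rule module_transformationI)
      (simp_all add: F.A.A.linear_category_axioms t')
qed

end

lemma (in lax_functor) module_transformation_ide:
  "module_transformation C A B F F (\<lambda>M \<in> obs A. ide B (fob F M))"
  by (rule module_transformationI) (simp_all add: A.A.linear_category_axioms)

lemma linear_category_LaxRex:
  assumes "module_action C A" "module_action C B"
  shows "linear_category (LaxRex C A B)"
proof -
  interpret A: module_action C A by fact
  interpret B: module_action C B by fact
  have F: "lax_functor C A B F" if "lax_module_functor C A B F" for F
    using assms that by (simp add: lax_functor_def lax_functor_axioms_def)
  note FG = lax_functors.intro[OF F F]
  show ?thesis
    unfolding LaxRex_def
  proof (rule linear_transformation_category; (elim CollectE conjE)?)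
    show "fob F M \<in> obs B" if "lax_module_functor C A B F" "M \<in> obs A" for F M
      using that by (simp add: lax_module_functor_def linear_functor_def)
  qed (auto simp: B.A.linear_category_axioms module_transformation_hom
      intro: lax_functor.module_transformation_ide[OF F]
      lax_functors.module_transformation_zro[OF FG] lax_functors.module_transformation_plus[OF FG]
      lax_functors.module_transformation_scale[OF FG]
      lax_functors.module_transformation_restrict_cmp[OF FG F])
qed

sublocale abelian_module_category \<subseteq> act: module_action C A
  using tensor_bilinear unit_obs act_bilinear massoc_hom munit_hom
  by unfold_locales (simp_all add: bilinear_functor_def)

context abelian_module_category
begin

abbreviation comp_right (infixr "\<bullet>" 70)
  where "g \<bullet> f \<equiv> g \<cdot>\<^bsub>A\<^esub> f"

lemma massoc_natural_arr:
  "\<lbrakk>f \<in> arrs C; f' \<in> arrs C; g \<in> arrs A; src C f = V; src C f' = W; src A g = M\<rbrakk> \<Longrightarrow>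
    (f \<unrhd>\<^bsub>A\<^esub> (f' \<unrhd>\<^bsub>A\<^esub> g)) \<bullet> massoc A V W M =
    massoc A (trg C f) (trg C f') (trg A g) \<bullet> ((f \<odot> f') \<unrhd>\<^bsub>A\<^esub> g)"
  using massoc_natural[of f V "trg C f" f' W "trg C f'" g M "trg A g"] by (simp add: in_homset)

lemma tensor_ide: "\<lbrakk>V \<in> obs C; W \<in> obs C\<rbrakk> \<Longrightarrow> ide C V \<odot> ide C W = ide C (V \<otimes> W)"
  using tensor_bilinear by (simp add: bilinear_functor_def)

lemma massoc_natural_ide:
  "\<lbrakk>V \<in> obs C; W \<in> obs C; g \<in> arrs A; trg A g = N\<rbrakk> \<Longrightarrow>
    massoc A V W N \<bullet> (ide C (V \<otimes> W) \<unrhd>\<^bsub>A\<^esub> g) =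
    (ide C V \<unrhd>\<^bsub>A\<^esub> (ide C W \<unrhd>\<^bsub>A\<^esub> g)) \<bullet> massoc A V W (src A g)"
  using massoc_natural_arr[of "ide C V" "ide C W" g V W "src A g"] tensor_ide[of V W] by simp

lemma munit_natural_arr:
  "\<lbrakk>g \<in> arrs A; trg A g = N\<rbrakk> \<Longrightarrow>
    munit A N \<bullet> (ide C \<one> \<unrhd>\<^bsub>A\<^esub> g) = g \<bullet> munit A (src A g)"
  using munit_natural[of g "src A g" N] by (simp add: in_homset)

lemma act_left_linfunctor: "V \<in> obs C \<Longrightarrow> linfunctor A A (act_left C A V)"
  using act.linear_act_left by unfold_locales

text \<open>Right exactness of \<open>V \<rhd> -\<close>. It is applied below to underlying arrows
  of module coequalizers, where it makes \<open>V \<unrhd> und p\<close> cancellable in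
  \<open>A\<close>.\<close>

lemma act_left_coequalizer:
  assumes "V \<in> obs C" "is_coequalizer A f g p"
  shows "is_coequalizer A (ide C V \<unrhd>\<^bsub>A\<^esub> f) (ide C V \<unrhd>\<^bsub>A\<^esub> g) (ide C V \<unrhd>\<^bsub>A\<^esub> p)"
  using linfunctor.right_exact_coequalizer[OF act_left_linfunctor act_left_right_exact] assms
  by (fastforce simp: act_left_def)

end

section \<open>The Eilenberg--Moore category and its Linton module structure\<close>

locale linton = abelian_module_category C A
  for C :: "('v, 'w, 'k::field, 'z) moncat_scheme"
    and A :: "('v, 'w, 'o, 'a, 'k, 'y) modcat_scheme" (structure) +
  fixes T :: "('v, 'o, 'a, 'x) laxmonad_scheme"
    and pr :: "'v \<Rightarrow> ('o, 'a) em_ob \<Rightarrow> ('o, 'a) em_ar"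
  assumes monad: "lax_module_monad C A T"
    and rex: "right_exact A A T"
    and coequalizers: "linton_coequalizers C A T pr"

sublocale linton \<subseteq> fn: lax_functor C A A T
  using monad by unfold_locales (simp add: lax_module_monad_def)

context linton
begin

lemma eta_module: "module_transformation C A A (id_lax A) T (eta T)"
  and mu_module: "module_transformation C A A (comp_lax A T T) T (mu T)"
  using monad by (simp_all add: lax_module_monad_def)

lemma eta_arr [simp]:
  assumes "M \<in> obs A"
  shows "eta T M \<in> arrs A" "src A (eta T M) = M" "trg A (eta T M) = fob T M"
  using module_transformation_arr[OF eta_module assms] by (simp_all add: id_lax_def)

lemma mu_arr [simp]:
  assumes "M \<in> obs A"
  shows "mu T M \<in> arrs A" "src A (mu T M) = fob T (fob T M)" "trg A (mu T M) = fob T M"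
  using module_transformation_arr[OF mu_module assms] by (simp_all add: comp_lax_def)

lemma eta_natural:
  "\<lbrakk>f \<in> arrs A; src A f = X\<rbrakk> \<Longrightarrow> far T f \<bullet> eta T X = eta T (trg A f) \<bullet> f"
  using module_transformation_natural[OF eta_module] by (simp add: id_lax_def)

lemma mu_natural:
  "\<lbrakk>f \<in> arrs A; trg A f = X\<rbrakk> \<Longrightarrow> mu T X \<bullet> far T (far T f) = far T f \<bullet> mu T (src A f)"
  using module_transformation_natural[OF mu_module] by (auto simp add: comp_lax_def)

lemma eta_natural_rev:
  "\<lbrakk>f \<in> arrs A; trg A f = Y\<rbrakk> \<Longrightarrow> eta T Y \<bullet> f = far T f \<bullet> eta T (src A f)"
  using eta_natural by auto

lemma mu_natural_rev:
  "\<lbrakk>f \<in> arrs A; src A f = X\<rbrakk> \<Longrightarrow> far T f \<bullet> mu T X = mu T (trg A f) \<bullet> far T (far T f)"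
  using mu_natural by auto

lemma eta_lax:
  "\<lbrakk>V \<in> obs C; M \<in> obs A\<rbrakk> \<Longrightarrow> lax T V M \<bullet> (ide C V \<unrhd> eta T M) = eta T (V \<rhd> M)"
  using module_transformation_lax[OF eta_module] by (simp add: id_lax_def)

lemma mu_lax:
  "\<lbrakk>V \<in> obs C; M \<in> obs A\<rbrakk> \<Longrightarrow>
    mu T (V \<rhd> M) \<bullet> far T (lax T V M) \<bullet> lax T V (fob T M) = lax T V M \<bullet> (ide C V \<unrhd> mu T M)"
  using module_transformation_lax[OF mu_module] by (simp add: comp_lax_def)

lemma monad_laws [simp]:
  assumes "M \<in> obs A"
  shows "mu T M \<bullet> eta T (fob T M) = ide A (fob T M)"
    "mu T M \<bullet> far T (eta T M) = ide A (fob T M)"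
    "mu T M \<bullet> far T (mu T M) = mu T M \<bullet> mu T (fob T M)"
  using monad assms by (simp_all add: lax_module_monad_def)

lemmas mu_natural' = A.whisker[OF mu_natural]
lemmas mu_natural_rev' = A.whisker[OF mu_natural_rev]
lemmas monad_laws' [simp] = monad_laws[THEN A.whisker]

text \<open>
  \<^const>\<open>EMmod\<close> extends \<^const>\<open>EM\<close> by the action; terms are kept in the form with \<^const>\<open>EMmod\<close>, and
  the definitions that mention \<^const>\<open>EM\<close> are rewritten by \<open>EM_to_EMmod\<close>.
\<close>

abbreviation E where "E \<equiv> EMmod C A T pr"

lemma EMmod_fields:
  "obs E = obs (EM A T)" "arrs E = arrs (EM A T)" "src E = src (EM A T)" "trg E = trg (EM A T)"
  "ide E = ide (EM A T)" "cmp E = cmp (EM A T)" "zro E = zro (EM A T)"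
  "plus_arr E = plus_arr (EM A T)" "scale_arr E = scale_arr (EM A T)"
  "act_ob E = linton_ob A T pr" "act_ar E = linton_ar C A T pr"
  "massoc E = linton_assoc C A T pr" "munit E = linton_unit C A T pr"
  by (simp_all add: EMmod_def lincat.defs)

lemma EM_to_EMmod:
  "obs (EM A T) = obs E" "arrs (EM A T) = arrs E" "src (EM A T) = src E" "trg (EM A T) = trg E"
  "ide (EM A T) = ide E" "cmp (EM A T) = cmp E" "zro (EM A T) = zro E"
  "homset (EM A T) = homset E" "is_iso (EM A T) = is_iso E" "is_cokernel (EM A T) = is_cokernel E"
  "is_coequalizer (EM A T) = is_coequalizer E"
  by (simp_all add: EMmod_fields fun_eq_iff homset_def is_iso_def is_cokernel_def is_coequalizer_def)

lemma E_tuple [simp]: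
  "src E (X, f, Y) = X" "trg E (X, f, Y) = Y" "und (X, f, Y) = f"
  by (simp_all add: EMmod_fields EM_def und_def)

lemma E_ops [simp]:
  "und (ide E X) = ide A (fst X)" "und (zro E X Y) = zro A (fst X) (fst Y)"
  "und (g \<cdot>\<^bsub>E\<^esub> f) = und g \<bullet> und f" "und (f \<oplus>\<^bsub>E\<^esub> g) = und f \<oplus> und g"
  "und (c \<star>\<^bsub>E\<^esub> f) = c \<star> und f"
  by (simp_all add: EMmod_fields EM_def und_def split: prod.splits)

lemma E_obs:
  "X \<in> obs E \<longleftrightarrow> fst X \<in> obs A \<and> snd X \<in> homset A (fob T (fst X)) (fst X) \<and>
    snd X \<bullet> eta T (fst X) = ide A (fst X) \<and> snd X \<bullet> mu T (fst X) = snd X \<bullet> far T (snd X)"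
  by (auto simp: EMmod_fields EM_def)

lemma E_arrs:
  "h \<in> arrs E \<longleftrightarrow> src E h \<in> obs E \<and> trg E h \<in> obs E \<and>
    und h \<in> homset A (fst (src E h)) (fst (trg E h)) \<and>
    und h \<bullet> snd (src E h) = snd (trg E h) \<bullet> far T (und h)"
  by (cases h) (auto simp: EMmod_fields EM_def und_def)

lemma E_ob [simp]:
  assumes "X \<in> obs E"
  shows "fst X \<in> obs A" "snd X \<in> arrs A" "src A (snd X) = fob T (fst X)" "trg A (snd X) = fst X"
    "snd X \<bullet> eta T (fst X) = ide A (fst X)"
    "snd X \<bullet> far T (snd X) = snd X \<bullet> mu T (fst X)"
  using assms by (simp_all add: E_obs in_homset)

lemmas E_ob' [simp] = E_ob(5,6)[THEN A.whisker]

lemma und_arr [simp]: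
  assumes "h \<in> arrs E"
  shows "und h \<in> arrs A" "src A (und h) = fst (src E h)" "trg A (und h) = fst (trg E h)"
  using assms by (simp_all add: E_arrs[of h] in_homset)

lemma und_linear:
  "\<lbrakk>h \<in> arrs E; src E h = X\<rbrakk> \<Longrightarrow> und h \<bullet> snd X = snd (trg E h) \<bullet> far T (und h)"
  by (auto simp: E_arrs[of h])

lemmas und_linear' = A.whisker[OF und_linear]

lemma E_arrI:
  assumes "X \<in> obs E" "Y \<in> obs E" "f \<in> arrs A" "src A f = fst X" "trg A f = fst Y"
    "f \<bullet> snd X = snd Y \<bullet> far T f"
  shows "(X, f, Y) \<in> arrs E"
  using assms by (simp add: E_arrs in_homset)

lemma E_eqI: "\<lbrakk>src E f = src E g; trg E f = trg E g; und f = und g\<rbrakk> \<Longrightarrow> f = g"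
  by (cases f; cases g) (auto simp: EMmod_fields EM_def und_def)

lemma E_src_trg [simp]:
  "src E (ide E X) = X" "trg E (ide E X) = X" "src E (zro E X Y) = X" "trg E (zro E X Y) = Y"
  "src E (g \<cdot>\<^bsub>E\<^esub> f) = src E f" "trg E (g \<cdot>\<^bsub>E\<^esub> f) = trg E g"
  "src E (f \<oplus>\<^bsub>E\<^esub> g) = src E f" "trg E (f \<oplus>\<^bsub>E\<^esub> g) = trg E f"
  "src E (c \<star>\<^bsub>E\<^esub> f) = src E f" "trg E (c \<star>\<^bsub>E\<^esub> f) = trg E f"
  by (auto simp: EMmod_fields EM_def split: prod.splits)

lemma E_arr [simp]:
  assumes "f \<in> arrs E"
  shows "src E f \<in> obs E" "trg E f \<in> obs E"
  using assms by (simp_all add: E_arrs[of f])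

lemma E_closed:
  shows "X \<in> obs E \<Longrightarrow> ide E X \<in> arrs E"
    and "\<lbrakk>X \<in> obs E; Y \<in> obs E\<rbrakk> \<Longrightarrow> zro E X Y \<in> arrs E"
    and "\<lbrakk>f \<in> arrs E; g \<in> arrs E; src E g = trg E f\<rbrakk> \<Longrightarrow> g \<cdot>\<^bsub>E\<^esub> f \<in> arrs E"
    and "\<lbrakk>f \<in> arrs E; h \<in> arrs E; src E h = src E f; trg E h = trg E f\<rbrakk> \<Longrightarrow> f \<oplus>\<^bsub>E\<^esub> h \<in> arrs E"
    and "f \<in> arrs E \<Longrightarrow> c \<star>\<^bsub>E\<^esub> f \<in> arrs E"
  by (simp_all add: E_arrs[of "ide E _"] E_arrs[of "zro E _ _"] E_arrs[of "_ \<oplus>\<^bsub>E\<^esub> _"]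
    E_arrs[of "_ \<star>\<^bsub>E\<^esub> _"] E_arrs[of "_ \<cdot>\<^bsub>E\<^esub> _"] in_homset und_linear und_linear'
    A.scale_cmp A.cmp_scale A.plus_cmp A.cmp_plus)

lemma E_linear: "linear_category E"
proof (unfold_locales, unfold in_homset)
  fix W X Y Z f g h and c d :: 'k
  show "ide E X \<in> arrs E \<and> src E (ide E X) = X \<and> trg E (ide E X) = X" if "X \<in> obs E"
    using that by (simp add: E_closed)
  show "zro E X Y \<in> arrs E \<and> src E (zro E X Y) = X \<and> trg E (zro E X Y) = Y"
    if "X \<in> obs E" "Y \<in> obs E"
    using that by (simp add: E_closed)
  show "src E f \<in> obs E" "trg E f \<in> obs E" if "f \<in> arrs E"
    using that by simp_all
  assume f: "f \<in> arrs E \<and> src E f = X \<and> trg E f = Y"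
  show "ide E Y \<cdot>\<^bsub>E\<^esub> f = f" "f \<cdot>\<^bsub>E\<^esub> ide E X = f" "f \<oplus>\<^bsub>E\<^esub> zro E X Y = f" "1 \<star>\<^bsub>E\<^esub> f = f"
    "(c + d) \<star>\<^bsub>E\<^esub> f = c \<star>\<^bsub>E\<^esub> f \<oplus>\<^bsub>E\<^esub> d \<star>\<^bsub>E\<^esub> f" "c \<star>\<^bsub>E\<^esub> d \<star>\<^bsub>E\<^esub> f = (c * d) \<star>\<^bsub>E\<^esub> f"
    using f by (auto intro!: E_eqI simp: A.scale_arr_simps)
  show c: "c \<star>\<^bsub>E\<^esub> f \<in> arrs E \<and> src E (c \<star>\<^bsub>E\<^esub> f) = X \<and> trg E (c \<star>\<^bsub>E\<^esub> f) = Y" for c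
    using f by (simp add: E_closed)
  have "f \<oplus>\<^bsub>E\<^esub> ((-1) \<star>\<^bsub>E\<^esub> f) = zro E X Y"
    using f by (intro E_eqI) (auto simp: A.scale_minus_1)
  then show "\<exists>g\<in>homset E X Y. f \<oplus>\<^bsub>E\<^esub> g = zro E X Y"
    using c by (intro bexI[of _ "(-1) \<star>\<^bsub>E\<^esub> f"]) (simp_all add: in_homset)
  show "g \<cdot>\<^bsub>E\<^esub> f \<in> arrs E \<and> src E (g \<cdot>\<^bsub>E\<^esub> f) = X \<and> trg E (g \<cdot>\<^bsub>E\<^esub> f) = Z"
    "g \<cdot>\<^bsub>E\<^esub> c \<star>\<^bsub>E\<^esub> f = c \<star>\<^bsub>E\<^esub> (g \<cdot>\<^bsub>E\<^esub> f)" "(c \<star>\<^bsub>E\<^esub> g) \<cdot>\<^bsub>E\<^esub> f = c \<star>\<^bsub>E\<^esub> (g \<cdot>\<^bsub>E\<^esub> f)"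
    if "g \<in> arrs E \<and> src E g = Y \<and> trg E g = Z"
    using f that by (auto intro!: E_eqI E_closed simp: A.cmp_scale A.scale_cmp)
  show "f \<oplus>\<^bsub>E\<^esub> g \<in> arrs E \<and> src E (f \<oplus>\<^bsub>E\<^esub> g) = X \<and> trg E (f \<oplus>\<^bsub>E\<^esub> g) = Y"
    "f \<oplus>\<^bsub>E\<^esub> g = g \<oplus>\<^bsub>E\<^esub> f" "c \<star>\<^bsub>E\<^esub> (f \<oplus>\<^bsub>E\<^esub> g) = c \<star>\<^bsub>E\<^esub> f \<oplus>\<^bsub>E\<^esub> c \<star>\<^bsub>E\<^esub> g"
    if "g \<in> arrs E \<and> src E g = X \<and> trg E g = Y"
    using f that by (auto intro!: E_eqI E_closed A.plus_arr_commute A.scale_arr_distrib)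
  show "f \<oplus>\<^bsub>E\<^esub> g \<oplus>\<^bsub>E\<^esub> h = f \<oplus>\<^bsub>E\<^esub> (g \<oplus>\<^bsub>E\<^esub> h)"
    if "g \<in> arrs E \<and> src E g = X \<and> trg E g = Y" "h \<in> arrs E \<and> src E h = X \<and> trg E h = Y"
    using f that by (auto intro!: E_eqI A.plus_right_assoc)
  show "h \<cdot>\<^bsub>E\<^esub> (g \<cdot>\<^bsub>E\<^esub> f) = h \<cdot>\<^bsub>E\<^esub> g \<cdot>\<^bsub>E\<^esub> f"
    if "g \<in> arrs E \<and> src E g = Y \<and> trg E g = Z" "h \<in> arrs E \<and> src E h = Z \<and> trg E h = W"
    using f that by (auto intro!: E_eqI)
  show "h \<cdot>\<^bsub>E\<^esub> (f \<oplus>\<^bsub>E\<^esub> g) = h \<cdot>\<^bsub>E\<^esub> f \<oplus>\<^bsub>E\<^esub> h \<cdot>\<^bsub>E\<^esub> g"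
    if "g \<in> arrs E \<and> src E g = X \<and> trg E g = Y" "h \<in> arrs E \<and> src E h = Y \<and> trg E h = Z"
    using f that by (auto intro!: E_eqI simp: A.cmp_plus)
  show "(g \<oplus>\<^bsub>E\<^esub> h) \<cdot>\<^bsub>E\<^esub> f = g \<cdot>\<^bsub>E\<^esub> f \<oplus>\<^bsub>E\<^esub> h \<cdot>\<^bsub>E\<^esub> f"
    if "g \<in> arrs E \<and> src E g = Y \<and> trg E g = Z" "h \<in> arrs E \<and> src E h = Y \<and> trg E h = Z"
    using f that by (auto intro!: E_eqI simp: A.plus_cmp)
qed

end

sublocale linton \<subseteq> E: linear_category "EMmod C A T pr"
  by (rule E_linear)

context linton
begin

section \<open>Cokernels in the Eilenberg--Moore category\<close>

lemma und_eq: "g \<cdot>\<^bsub>E\<^esub> f = h \<Longrightarrow> und g \<bullet> und f = und h"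
  by auto

lemma far_cokernel: "is_cokernel A f p \<Longrightarrow> is_cokernel A (far T f) (far T p)"
  using rex by (simp add: right_exact_def)

text \<open>The arrow induced in \<open>A\<close> is automatically a module morphism: linearity is
  tested after \<open>far T (und p)\<close>, which is an epimorphism because \<open>T\<close>
  preserves the cokernel.\<close>

lemma reflect_cokernel:
  assumes f: "f \<in> arrs E" and p: "p \<in> arrs E" "src E p = trg E f"
    and coker: "is_cokernel A (und f) (und p)"
  shows "is_cokernel E f p"
proof (rule E.cokernelI)
  show "p \<cdot>\<^bsub>E\<^esub> f = zro E (src E f) (trg E p)"
    using A.cokernelD(4)[OF coker] f p by (intro E_eqI) simp_all
next
  fix h assume h: "h \<in> arrs E" "src E h = trg E f" "h \<cdot>\<^bsub>E\<^esub> f = zro E (src E f) (trg E h)"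
  have "und h \<bullet> und f = zro A (fst (src E f)) (fst (trg E h))"
    using und_eq[OF h(3)] by simp
  then obtain u where u: "u \<in> arrs A" "src A u = fst (trg E p)" "trg A u = fst (trg E h)"
    "u \<bullet> und p = und h"
    using A.cokernel_factor[OF coker, of "und h"] f h p by auto
  have Tu: "far T u \<bullet> far T (und p) = far T (und h)"
    using u p by (intro fn.far_eq[OF u(4)]) simp_all
  have "u \<bullet> snd (trg E p) = snd (trg E h) \<bullet> far T u"
  proof (rule A.cokernel_epi[OF far_cokernel[OF coker]])
    show "(u \<bullet> snd (trg E p)) \<bullet> far T (und p) = (snd (trg E h) \<bullet> far T u) \<bullet> far T (und p)"
      using f u p h Tu by (simp add: und_linear[symmetric] A.whisker[OF u(4)])
  qed (use f u p h in simp_all)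
  then have "(trg E p, u, trg E h) \<in> arrs E"
    using u p h by (intro E_arrI) simp_all
  moreover have "(trg E p, u, trg E h) \<cdot>\<^bsub>E\<^esub> p = h"
    by (rule E_eqI) (use u p h in simp_all)
  ultimately show "\<exists>u. u \<in> arrs E \<and> src E u = trg E p \<and> trg E u = trg E h \<and> u \<cdot>\<^bsub>E\<^esub> p = h"
    by (intro exI[of _ "(trg E p, u, trg E h)"]) simp
next
  fix u v assume uv: "u \<in> arrs E" "v \<in> arrs E" "src E u = trg E p" "src E v = trg E p"
    "trg E u = trg E v" "u \<cdot>\<^bsub>E\<^esub> p = v \<cdot>\<^bsub>E\<^esub> p"
  have "und u = und v"
    by (rule A.cokernel_epi[OF coker]) (use und_eq[OF uv(6)] uv(1-5) p in simp_all)
  then show "u = v"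
    using uv by (intro E_eqI) simp_all
qed (use assms in simp_all)

text \<open>As \<open>T\<close> preserves the cokernel \<open>p\<close>, the action descends along \<open>p\<close>.\<close>

lemma lift_cokernel:
  assumes f: "f \<in> arrs E" and p: "is_cokernel A (und f) p"
  obtains Z where "fst Z = trg A p" "is_cokernel E f (trg E f, p, Z)"
proof -
  let ?Y = "trg E f"
  note pD [simp] = A.cokernelD(2,3)[OF p]
  note Tp = far_cokernel[OF p]
  have "p \<bullet> snd ?Y \<bullet> far T (und f) = zro A (fob T (fst (src E f))) (trg A p)"
    using f A.whisker[OF A.cokernelD(4)[OF p], of "snd (src E f)"]
    by (simp add: und_linear[symmetric])
  then obtain n where n: "n \<in> arrs A" "src A n = fob T (trg A p)" "trg A n = trg A p"
    "n \<bullet> far T p = p \<bullet> snd ?Y"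
    using A.cokernel_factor[OF Tp, of "p \<bullet> snd ?Y"] f by auto
  note n' = A.whisker[OF n(4)]
  let ?Z = "(trg A p, n)"
  have "n \<bullet> eta T (trg A p) = ide A (trg A p)"
  proof (rule A.cokernel_epi[OF p])
    show "(n \<bullet> eta T (trg A p)) \<bullet> p = ide A (trg A p) \<bullet> p"
      using f n by (simp add: eta_natural[symmetric] n')
  qed (use f n in simp_all)
  moreover have "n \<bullet> mu T (trg A p) = n \<bullet> far T n"
  proof (rule A.cokernel_epi[OF far_cokernel[OF Tp]])
    have "far T n \<bullet> far T (far T p) = far T p \<bullet> far T (snd ?Y)"
      using f n(1-3) by (subst fn.far_eq[OF n(4)]) simp_all
    then show "(n \<bullet> mu T (trg A p)) \<bullet> far T (far T p) = (n \<bullet> far T n) \<bullet> far T (far T p)"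
      using f n by (simp add: mu_natural n')
  qed (use f n in simp_all)
  ultimately have Z: "?Z \<in> obs E"
    using n f by (simp add: E_obs in_homset)
  have "is_cokernel E f (?Y, p, ?Z)"
    using f n p Z by (intro reflect_cokernel E_arrI) simp_all
  then show ?thesis
    by (intro that[of ?Z]) simp_all
qed

text \<open>Some cokernel of \<open>f\<close> has as underlying arrow a cokernel in
  \<open>A\<close>, by \<open>lift_cokernel\<close>. Any other cokernel of \<open>f\<close> differs
  from it by an isomorphism, which stays one in \<open>A\<close>.\<close>

lemma und_cokernel:
  assumes "is_cokernel E f p"
  shows "is_cokernel A (und f) (und p)"
proof -
  note f = E.cokernelD[OF assms]
  obtain p' where p': "is_cokernel A (und f) p'"
    using A.cokernels[of "und f"] f by auto
  obtain Z where Z: "fst Z = trg A p'" "is_cokernel E f (trg E f, p', Z)"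
    using lift_cokernel[OF f(1) p'] .
  obtain i where i: "is_iso E i" "i \<in> arrs E" "src E i = Z" "trg E i = trg E p"
    "i \<cdot>\<^bsub>E\<^esub> (trg E f, p', Z) = p"
    using E.cokernel_unique[OF Z(2) assms] by (metis E_tuple(2))
  obtain j where j: "j \<in> arrs E" "src E j = trg E i" "trg E j = src E i"
    "j \<cdot>\<^bsub>E\<^esub> i = ide E (src E i)" "i \<cdot>\<^bsub>E\<^esub> j = ide E (trg E i)"
    using E.isoE[OF i(1)] by metis
  have "is_iso A (und i)"
    using i(2) j(1-3) und_eq[OF j(4)] und_eq[OF j(5)]
    by (intro A.isoI[of _ "und j"]) simp_all
  then have "is_cokernel A (und f) (und i \<bullet> p')"
    using i(2,3) Z(1) p' by (intro A.cokernel_iso) simp_all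
  then show ?thesis
    using und_eq[OF i(5)] by simp
qed

lemma und_coequalizer:
  assumes "is_coequalizer E f g p"
  shows "is_coequalizer A (und f) (und g) (und p)"
proof -
  note [simp] = E.coequalizerD[OF assms]
  have "is_cokernel E (f \<oplus>\<^bsub>E\<^esub> (-1) \<star>\<^bsub>E\<^esub> g) p"
    using assms by (subst E.cokernel_diff_iff_coequalizer) simp_all
  from und_cokernel[OF this] show ?thesis
    by (subst A.cokernel_diff_iff_coequalizer[symmetric]) simp_all
qed

section \<open>Free modules and the canonical presentation of a module\<close>

lemma free_ob_obs [simp]:
  "M \<in> obs A \<Longrightarrow> free_ob T M \<in> obs E" "fst (free_ob T M) = fob T M" "snd (free_ob T M) = mu T M"
  by (simp_all add: E_obs free_ob_def in_homset)

lemma free_ar_arr [simp]: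
  "f \<in> arrs A \<Longrightarrow> free_ar A T f \<in> arrs E" "src E (free_ar A T f) = free_ob T (src A f)"
  "trg E (free_ar A T f) = free_ob T (trg A f)" "und (free_ar A T f) = far T f"
  unfolding free_ar_def by (auto intro!: E_arrI simp: mu_natural)

lemma counit_arr [simp]:
  "X \<in> obs E \<Longrightarrow> counit T X \<in> arrs E" "src E (counit T X) = free_ob T (fst X)"
  "trg E (counit T X) = X" "und (counit T X) = snd X"
  unfolding counit_def by (auto intro!: E_arrI)

text \<open>On underlying arrows the fork is split by \<open>eta\<close>, so the factorization of
  \<open>h\<close> can only be \<open>und h \<bullet> eta T (fst X)\<close>; the remaining point is
  that this arrow is linear.\<close>

lemma counit_coequalizer:
  assumes [simp]: "X \<in> obs E"
  shows "is_coequalizer E (free_ar A T (snd X)) (counit T (free_ob T (fst X))) (counit T X)"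
proof (rule E.coequalizerI)
  show "counit T X \<cdot>\<^bsub>E\<^esub> free_ar A T (snd X) = counit T X \<cdot>\<^bsub>E\<^esub> counit T (free_ob T (fst X))"
    by (rule E_eqI) simp_all
next
  fix h assume "h \<in> arrs E" "src E h = trg E (free_ar A T (snd X))"
    and eq: "h \<cdot>\<^bsub>E\<^esub> free_ar A T (snd X) = h \<cdot>\<^bsub>E\<^esub> counit T (free_ob T (fst X))"
  then have h [simp]: "h \<in> arrs E" "src E h = free_ob T (fst X)"
    by simp_all
  let ?u = "und h \<bullet> eta T (fst X)"
  have *: "und h \<bullet> far T (snd X) = und h \<bullet> mu T (fst X)"
    using und_eq[OF eq] by simp
  have u: "?u \<bullet> snd X = und h"
    by (simp add: eta_natural_rev A.whisker[OF *])
  \<comment> \<open>Linearity of \<open>?u\<close>: precomposing this equation with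
    \<open>far T (eta T (fst X))\<close> turns the right-hand side into \<open>und h\<close> by a
    unit law, and \<open>und h\<close> equals \<open>?u \<bullet> snd X\<close>.\<close>
  have "snd (trg E h) \<bullet> far T (und h) = und h \<bullet> mu T (fst X)"
    using und_linear[of h] by simp
  from A.whisker[OF this, of "far T (eta T (fst X))"] have "(X, ?u, trg E h) \<in> arrs E"
    using u by (intro E_arrI) simp_all
  moreover have "(X, ?u, trg E h) \<cdot>\<^bsub>E\<^esub> counit T X = h"
    by (rule E_eqI) (use u in simp_all)
  ultimately show "\<exists>u. u \<in> arrs E \<and> src E u = trg E (counit T X) \<and> trg E u = trg E h \<and>
      u \<cdot>\<^bsub>E\<^esub> counit T X = h"
    by (intro exI[of _ "(X, ?u, trg E h)"]) simp
next
  fix u v assume uv: "u \<in> arrs E" "v \<in> arrs E" "src E u = trg E (counit T X)"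
    "src E v = trg E (counit T X)" "trg E u = trg E v" "u \<cdot>\<^bsub>E\<^esub> counit T X = v \<cdot>\<^bsub>E\<^esub> counit T X"
  have "und u = und (u \<cdot>\<^bsub>E\<^esub> counit T X) \<bullet> eta T (fst X)"
    using uv(1-4) by simp
  also have "\<dots> = und v"
    unfolding uv(6) using uv(1-4) by simp
  finally show "u = v"
    using uv(1-5) by (intro E_eqI) simp_all
qed simp_all

text \<open>The underlying arrow of a free arrow is its image under \<open>T\<close>, so cokernels
  are preserved by \<open>T\<close> and then reflected to modules. The bare record leaves the lax
  structure of \<open>L\<close> aside, which is available only after the Linton action has been
  studied.\<close>

lemma free_right_exact: "right_exact A E \<lparr>fob = free_ob T, far = free_ar A T\<rparr>"
  unfolding right_exact_def linear_functor_def
proof (intro conjI allI ballI impI)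
  fix f p assume *: "is_cokernel A f p"
  note [simp] = A.cokernelD[OF this]
  show "is_cokernel E (far \<lparr>fob = free_ob T, far = free_ar A T\<rparr> f) (far \<lparr>fob = free_ob T, far = free_ar A T\<rparr> p)"
    using far_cokernel[OF *] by (intro reflect_cokernel) simp_all
qed (auto simp: in_homset intro!: E_eqI)

lemma und_right_exact: "right_exact E A \<lparr>fob = fst, far = und\<rparr>"
  unfolding right_exact_def linear_functor_def
  by (auto simp: in_homset und_cokernel)

subsection \<open>The universal property of the Linton action\<close>

abbreviation q where "q \<equiv> linton_q A T pr"
abbreviation ob where "ob \<equiv> linton_ob A T pr"

lemma pr_coequalizer:
  "\<lbrakk>V \<in> obs C; X \<in> obs E\<rbrakk> \<Longrightarrow>
    is_coequalizer E (linton_left C A T V X) (linton_right A T V (fst X)) (pr V X)"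
  using coequalizers by (simp add: linton_coequalizers_def EM_to_EMmod)

lemma linton_pair_simps [simp]:
  "src E (linton_left C A T V X) = free_ob T (V \<rhd> fob T (fst X))"
  "trg E (linton_left C A T V X) = free_ob T (V \<rhd> fst X)"
  "und (linton_left C A T V X) = far T (ide C V \<unrhd> snd X)"
  "src E (linton_right A T V M) = free_ob T (V \<rhd> fob T M)"
  "trg E (linton_right A T V M) = free_ob T (V \<rhd> M)"
  "und (linton_right A T V M) = mu T (V \<rhd> M) \<bullet> far T (lax T V M)"
  by (simp_all add: linton_left_def linton_right_def)

lemma pr_arr [simp]:
  assumes "V \<in> obs C" "X \<in> obs E"
  shows "pr V X \<in> arrs E" "src E (pr V X) = free_ob T (V \<rhd> fst X)" "trg E (pr V X) = ob V X"
  using E.coequalizerD[OF pr_coequalizer[OF assms]] by (simp_all add: linton_ob_def EM_to_EMmod)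

lemma ob_obs [simp]: "\<lbrakk>V \<in> obs C; X \<in> obs E\<rbrakk> \<Longrightarrow> ob V X \<in> obs E"
  using E.trg_obs[of "pr V X"] by simp

lemma q_arr [simp]:
  assumes "V \<in> obs C" "X \<in> obs E"
  shows "q V X \<in> arrs A" "src A (q V X) = V \<rhd> fst X" "trg A (q V X) = fst (ob V X)"
  using assms by (simp_all add: linton_q_def)

text \<open>A module morphism out of a free module is the linear extension of its restriction along
  \<open>eta\<close>, and \<open>q\<close> is that restriction of \<open>pr\<close>. The formula
  lets \<open>pr\<close> be eliminated in favour of \<open>q\<close>.\<close>

lemma und_pr:
  assumes [simp]: "V \<in> obs C" "X \<in> obs E"
  shows "und (pr V X) = snd (ob V X) \<bullet> far T (q V X)"
  using und_linear'[of "pr V X" "free_ob T (V \<rhd> fst X)" "far T (eta T (V \<rhd> fst X))"]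
  by (simp add: linton_q_def)

text \<open>This is the Linton relation satisfied by \<open>pr\<close>, restricted along
  \<open>eta\<close>: letting \<open>T\<close> act on \<open>X\<close> before forming the product
  agrees with moving it outside by \<open>lax T\<close> and acting on the product.\<close>

lemma q_balanced:
  assumes [simp]: "V \<in> obs C" "X \<in> obs E"
  shows "q V X \<bullet> (ide C V \<unrhd> snd X) = snd (ob V X) \<bullet> far T (q V X) \<bullet> lax T V (fst X)"
proof -
  let ?p = "und (pr V X)"
  have "?p \<bullet> far T (ide C V \<unrhd> snd X) = ?p \<bullet> mu T (V \<rhd> fst X) \<bullet> far T (lax T V (fst X))"
    using arg_cong[OF E.coequalizerD(7)[OF pr_coequalizer[OF assms]], of und] by simp
  note * = A.whisker[OF this, of "eta T (V \<rhd> fob T (fst X))"]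
  have "q V X \<bullet> (ide C V \<unrhd> snd X) = ?p \<bullet> far T (ide C V \<unrhd> snd X) \<bullet> eta T (V \<rhd> fob T (fst X))"
    by (simp add: linton_q_def eta_natural)
  also have "\<dots> = ?p \<bullet> lax T V (fst X)"
    using * by (simp add: eta_natural)
  finally show ?thesis
    by (simp add: und_pr)
qed

lemmas q_balanced' = A.whisker[OF q_balanced]

text \<open>Extend \<open>f\<close> linearly to the free module on \<open>V \<rhd> fst X\<close>.
  The balancing hypothesis says precisely that the extension identifies the two Linton maps, hence
  it factors through \<open>pr\<close>.\<close>

lemma q_factor:
  assumes [simp]: "V \<in> obs C" "X \<in> obs E" "Y \<in> obs E"
    and f [simp]: "f \<in> arrs A" "src A f = V \<rhd> fst X" "trg A f = fst Y"
    and bal: "f \<bullet> (ide C V \<unrhd> snd X) = snd Y \<bullet> far T f \<bullet> lax T V (fst X)"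
  obtains h where "h \<in> arrs E" "src E h = ob V X" "trg E h = Y" "und h \<bullet> q V X = f"
proof -
  let ?h = "(free_ob T (V \<rhd> fst X), snd Y \<bullet> far T f, Y)"
  have h: "?h \<in> arrs E"
    by (rule E_arrI) (simp_all add: mu_natural_rev)
  have "far T f \<bullet> far T (ide C V \<unrhd> snd X) = far T (snd Y) \<bullet> far T (far T f) \<bullet> far T (lax T V (fst X))"
    using arg_cong[OF bal, of "far T"] by simp
  then have "?h \<cdot>\<^bsub>E\<^esub> linton_left C A T V X = ?h \<cdot>\<^bsub>E\<^esub> linton_right A T V (fst X)"
    by (intro E_eqI) (simp_all add: mu_natural')
  then obtain u where u: "u \<in> arrs E" "src E u = ob V X" "trg E u = Y" "u \<cdot>\<^bsub>E\<^esub> pr V X = ?h"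
    using h by (metis E.coequalizer_factor E_tuple linton_pair_simps(2) pr_arr(3) pr_coequalizer assms(1,2))
  have "und u \<bullet> q V X = und (u \<cdot>\<^bsub>E\<^esub> pr V X) \<bullet> eta T (V \<rhd> fst X)"
    using u(1-3) by (simp add: linton_q_def)
  also have "\<dots> = f"
    unfolding u(4) by (simp add: eta_natural)
  finally show ?thesis
    using u that by blast
qed

text \<open>Since \<open>h\<close> and \<open>k\<close> are linear, their composites with
  \<open>pr\<close> are determined by those with \<open>q\<close>, and \<open>pr\<close> can be
  cancelled. Linearity is what replaces \<open>q\<close> being an epimorphism.\<close>

lemma q_ext:
  assumes [simp]: "V \<in> obs C" "X \<in> obs E" and h: "h \<in> arrs E" "k \<in> arrs E" "src E h = ob V X"
    "src E k = ob V X" "trg E h = trg E k"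
    and eq: "und h \<bullet> q V X = und k \<bullet> q V X"
  shows "h = k"
proof (rule E.coequalizer_epi[OF pr_coequalizer[of V X]])
  have "far T (und h) \<bullet> far T (q V X) = far T (und k) \<bullet> far T (q V X)"
    using arg_cong[OF eq, of "far T"] h by simp
  then show "h \<cdot>\<^bsub>E\<^esub> pr V X = k \<cdot>\<^bsub>E\<^esub> pr V X"
    using h by (intro E_eqI) (simp_all add: und_pr und_linear')
qed (use h in simp_all)

section \<open>The Linton action on arrows and its coherence isomorphisms\<close>

lemma act_linton_ob: "act_ob E = ob"
  by (simp add: EMmod_fields)

lemma lax_natural_rev:
  "\<lbrakk>f \<in> arrs C; g \<in> arrs A; trg C f = V; trg A g = M\<rbrakk> \<Longrightarrow>
    lax T V M \<bullet> (f \<unrhd> far T g) = far T (f \<unrhd> g) \<bullet> lax T (src C f) (src A g)"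
  using fn.lax_natural by auto

lemma mu_lax_rev:
  "\<lbrakk>V \<in> obs C; M \<in> obs A\<rbrakk> \<Longrightarrow>
    lax T V M \<bullet> (ide C V \<unrhd> mu T M) = mu T (V \<rhd> M) \<bullet> far T (lax T V M) \<bullet> lax T V (fob T M)"
  by (simp add: mu_lax)

lemmas mu_lax_rev' = A.whisker[OF mu_lax_rev]

text \<open>The definite description in the definition is formulated with \<open>pr\<close>.
  Existence comes from the balancedness of the composite with \<open>q\<close>, uniqueness from
  cancelling \<open>pr\<close>; afterwards only the equation in \<open>A\<close> is used.\<close>

lemma linton_ar:
  assumes f [simp]: "f \<in> arrs C" "src C f = V" "trg C f = V'" "V \<in> obs C" "V' \<in> obs C"
    and g [simp]: "g \<in> arrs E" "src E g = X" "trg E g = X'" "X \<in> obs E" "X' \<in> obs E"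
  shows "linton_ar C A T pr f g \<in> homset E (ob V X) (ob V' X')"
    and "und (linton_ar C A T pr f g) \<bullet> q V X = q V' X' \<bullet> (f \<unrhd> und g)"
proof -
  let ?c = "q V' X' \<bullet> (f \<unrhd> und g)"
  have "(f \<unrhd> und g) \<bullet> (ide C V \<unrhd> snd X) = f \<unrhd> (und g \<bullet> snd X)"
    using act.act_cmp[of "ide C V" f "snd X" "und g"] by simp
  also have "\<dots> = f \<unrhd> (snd X' \<bullet> far T (und g))"
    by (simp add: und_linear)
  also have "\<dots> = (ide C V' \<unrhd> snd X') \<bullet> (f \<unrhd> far T (und g))"
    using act.act_cmp[of f "ide C V'" "far T (und g)" "snd X'"] by simp
  finally have "?c \<bullet> (ide C V \<unrhd> snd X) = snd (ob V' X') \<bullet> far T ?c \<bullet> lax T V (fst X)"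
    by (simp add: q_balanced' lax_natural_rev)
  then obtain h where h: "h \<in> arrs E" "src E h = ob V X" "trg E h = ob V' X'" "und h \<bullet> q V X = ?c"
    by (elim q_factor[of V X "ob V' X'" ?c, rotated 6]) simp_all
  have "far T (und h) \<bullet> far T (q V X) = far T (q V' X') \<bullet> far T (f \<unrhd> und g)"
    using h(1-3) by (subst fn.far_eq[OF h(4)]) simp_all
  then have h': "h \<cdot>\<^bsub>E\<^esub> pr V X = pr V' X' \<cdot>\<^bsub>E\<^esub> free_ar A T (f \<unrhd> und g)"
    using h(1-3) by (intro E_eqI) (simp_all add: und_pr und_linear')
  have "linton_ar C A T pr f g = h"
    unfolding linton_ar_def EM_to_EMmod Let_def f g in_homset
  proof (rule the_equality)
    show "(h \<in> arrs E \<and> src E h = ob V X \<and> trg E h = ob V' X') \<and>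
        h \<cdot>\<^bsub>E\<^esub> pr V X = pr V' X' \<cdot>\<^bsub>E\<^esub> free_ar A T (f \<unrhd> und g)"
      using h h' by simp
    show "k = h" if "(k \<in> arrs E \<and> src E k = ob V X \<and> trg E k = ob V' X') \<and>
        k \<cdot>\<^bsub>E\<^esub> pr V X = pr V' X' \<cdot>\<^bsub>E\<^esub> free_ar A T (f \<unrhd> und g)" for k
      by (rule E.coequalizer_epi[OF pr_coequalizer[of V X]]) (use that h h' in simp_all)
  qed
  then show "linton_ar C A T pr f g \<in> homset E (ob V X) (ob V' X')"
    "und (linton_ar C A T pr f g) \<bullet> q V X = ?c"
    using h by (simp_all add: in_homset)
qed

lemma double_whisker:
  "\<lbrakk>a \<bullet> b \<bullet> c = d; c \<in> arrs A; b \<in> arrs A; a \<in> arrs A; src A b = trg A c; src A a = trg A b;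
    r \<in> arrs A; trg A r = src A c\<rbrakk> \<Longrightarrow> a \<bullet> b \<bullet> c \<bullet> r = d \<bullet> r"
  by (metis A.assoc_right A.cmp_arr)

text \<open>
  The arrow \<open>V \<unrhd> q W X\<close> need not be an epimorphism of the underlying category. The next two lemmas
  instead use that \<open>V \<unrhd> pr W X\<close> is a coequalizer, by right exactness of the action.
\<close>

lemma double_ext:
  assumes [simp]: "V \<in> obs C" "W \<in> obs C" "X \<in> obs E"
    and h: "h \<in> arrs E" "k \<in> arrs E" "src E h = ob V (ob W X)" "src E k = ob V (ob W X)"
      "trg E h = trg E k"
    and eq: "und h \<bullet> q V (ob W X) \<bullet> (ide C V \<unrhd> q W X) = und k \<bullet> q V (ob W X) \<bullet> (ide C V \<unrhd> q W X)"
  shows "h = k"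
proof (rule q_ext)
  have *: "(und l \<bullet> q V (ob W X)) \<bullet> (ide C V \<unrhd> und (pr W X)) =
      snd (trg E l) \<bullet> far T (und l \<bullet> q V (ob W X) \<bullet> (ide C V \<unrhd> q W X)) \<bullet> lax T V (W \<rhd> fst X)"
    if "l \<in> arrs E" "src E l = ob V (ob W X)" for l
    using that by (simp add: und_pr q_balanced' und_linear' fn.lax_natural_ide_rev)
  note co = act_left_coequalizer[of V, OF _ und_coequalizer[OF pr_coequalizer[of W X]]]
  show "und h \<bullet> q V (ob W X) = und k \<bullet> q V (ob W X)"
    by (rule A.coequalizer_epi[OF co]) (use h in \<open>simp_all only: * eq\<close>, use h in simp_all)
qed (use h in simp_all)

lemma double_factor:
  assumes [simp]: "V \<in> obs C" "W \<in> obs C" "X \<in> obs E" "Y \<in> obs E"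
    and c [simp]: "c \<in> arrs A" "src A c = V \<rhd> (W \<rhd> fst X)" "trg A c = fst Y"
    and bal: "c \<bullet> (ide C V \<unrhd> (ide C W \<unrhd> snd X)) =
      snd Y \<bullet> far T c \<bullet> lax T V (W \<rhd> fst X) \<bullet> (ide C V \<unrhd> lax T W (fst X))"
  obtains h where "h \<in> arrs E" "src E h = ob V (ob W X)" "trg E h = Y"
    "und h \<bullet> q V (ob W X) \<bullet> (ide C V \<unrhd> q W X) = c"
proof -
  let ?M = "fst X" and ?V = "ide C V" and ?W = "ide C W"
  \<comment> \<open>The value forced on \<open>V \<rhd> T (W \<rhd> M)\<close>: for a linear
    \<open>h\<close> with the required composite, balancedness of
    \<open>und h \<bullet> q V (ob W X)\<close> leaves no other choice for its composite with
    \<open>V \<unrhd> und (pr W X)\<close>.\<close>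
  let ?d = "snd Y \<bullet> far T c \<bullet> lax T V (W \<rhd> ?M)"
  note co = act_left_coequalizer[of V, OF _ und_coequalizer[OF pr_coequalizer[of W X]]]
  have Tc: "far T c \<bullet> far T (?V \<unrhd> (?W \<unrhd> snd X)) = far T (snd Y) \<bullet> far T (far T c) \<bullet>
      far T (lax T V (W \<rhd> ?M)) \<bullet> far T (?V \<unrhd> lax T W ?M)"
    by (subst fn.far_eq[OF bal]) simp_all
  have "?d \<bullet> (?V \<unrhd> und (linton_left C A T W X)) = ?d \<bullet> (?V \<unrhd> und (linton_right A T W ?M))"
    by (simp add: fn.lax_natural_ide_rev fn.lax_natural_ide_rev' mu_lax_rev' mu_natural_rev' A.whisker[OF Tc])
  then obtain u where u: "u \<in> arrs A" "src A u = V \<rhd> fst (ob W X)" "trg A u = fst Y"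
    "u \<bullet> (?V \<unrhd> und (pr W X)) = ?d"
    using A.coequalizer_factor[OF co, of ?d] by auto
  have uq: "u \<bullet> (?V \<unrhd> q W X) = c"
  proof -
    have "u \<bullet> (?V \<unrhd> q W X) = ?d \<bullet> (?V \<unrhd> eta T (W \<rhd> ?M))"
      using u(1-3) A.whisker[OF u(4), of "?V \<unrhd> eta T (W \<rhd> ?M)"] by (simp add: linton_q_def)
    then show ?thesis
      by (simp add: eta_lax eta_natural)
  qed
  have Tu: "far T u \<bullet> far T (?V \<unrhd> und (pr W X)) = far T ?d"
    using u by (intro fn.far_eq) simp_all
  \<comment> \<open>Balancedness of \<open>u\<close> is tested after
    \<open>?V \<unrhd> far T (und (pr W X))\<close>, cancellable because both \<open>T\<close> and
    \<open>V \<rhd> -\<close> are right exact.\<close>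
  have "u \<bullet> (?V \<unrhd> snd (ob W X)) = snd Y \<bullet> far T u \<bullet> lax T V (fst (ob W X))"
  proof (rule A.coequalizer_epi[OF act_left_coequalizer[of V,
        OF _ fn.right_exact_coequalizer[OF rex und_coequalizer[OF pr_coequalizer[of W X]]]]])
    have "snd (ob W X) \<bullet> far T (und (pr W X)) = und (pr W X) \<bullet> mu T (W \<rhd> ?M)"
      using und_linear[of "pr W X"] by simp
    then have "(?V \<unrhd> snd (ob W X)) \<bullet> (?V \<unrhd> far T (und (pr W X))) =
        (?V \<unrhd> und (pr W X)) \<bullet> (?V \<unrhd> mu T (W \<rhd> ?M))"
      by (simp flip: act.ide_act_cmp)
    then show "(u \<bullet> (?V \<unrhd> snd (ob W X))) \<bullet> (?V \<unrhd> far T (und (pr W X))) =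
        (snd Y \<bullet> far T u \<bullet> lax T V (fst (ob W X))) \<bullet> (?V \<unrhd> far T (und (pr W X)))"
      using u(1-3) by (simp add: A.whisker[OF u(4)] fn.lax_natural_ide_rev A.whisker[OF Tu]
        mu_lax_rev mu_natural_rev')
  qed (use u(1-3) in simp_all)
  then obtain h where "h \<in> arrs E" "src E h = ob V (ob W X)" "trg E h = Y" "und h \<bullet> q V (ob W X) = u"
    by (elim q_factor[of V "ob W X" Y u, rotated 6]) (use u in simp_all)
  then show ?thesis
    using uq by (intro that[of h]) (simp_all add: A.whisker)
qed

text \<open>\<open>h\<close> comes from the universal property of \<open>q\<close> at the tensor
  product, its inverse \<open>k\<close> from \<open>double_factor\<close> applied to
  \<open>q\<close> after the inverse of \<open>massoc\<close>. The two composites are identities by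
  \<open>double_ext\<close> and \<open>q_ext\<close>. This shows that the definite description
  denotes.\<close>

lemma linton_assoc_iso:
  assumes [simp]: "V \<in> obs C" "W \<in> obs C" "X \<in> obs E"
  shows "linton_assoc C A T pr V W X \<in> homset E (ob (V \<otimes>\<^bsub>C\<^esub> W) X) (ob V (ob W X)) \<and>
    is_iso E (linton_assoc C A T pr V W X) \<and>
    und (linton_assoc C A T pr V W X) \<bullet> q (V \<otimes>\<^bsub>C\<^esub> W) X =
      q V (ob W X) \<bullet> (ide C V \<unrhd> q W X) \<bullet> massoc A V W (fst X)"
proof -
  let ?M = "fst X" and ?V = "ide C V" and ?W = "ide C W" and ?VW = "V \<otimes>\<^bsub>C\<^esub> W"
  let ?c = "q V (ob W X) \<bullet> (?V \<unrhd> q W X) \<bullet> massoc A V W ?M"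
  have Tm: "lax T V (W \<rhd> ?M) \<bullet> (?V \<unrhd> lax T W ?M) \<bullet> massoc A V W (fob T ?M) =
      far T (massoc A V W ?M) \<bullet> lax T ?VW ?M"
    by (simp add: fn.lax_massoc)
  have "(?V \<unrhd> q W X) \<bullet> (?V \<unrhd> (?W \<unrhd> snd X)) =
      (?V \<unrhd> snd (ob W X)) \<bullet> (?V \<unrhd> far T (q W X)) \<bullet> (?V \<unrhd> lax T W ?M)"
    by (simp add: q_balanced flip: act.ide_act_cmp)
  note Vq = A.whisker[OF this]
  have "?c \<bullet> (ide C ?VW \<unrhd> snd X) = snd (ob V (ob W X)) \<bullet> far T ?c \<bullet> lax T ?VW ?M"
    by (simp add: massoc_natural_ide Vq q_balanced' fn.lax_natural_ide_rev' Tm)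
  then obtain h where h: "h \<in> arrs E" "src E h = ob ?VW X" "trg E h = ob V (ob W X)" "und h \<bullet> q ?VW X = ?c"
    by (elim q_factor[of ?VW X "ob V (ob W X)" ?c, rotated 6]) simp_all
  obtain m where m: "m \<in> arrs A" "src A m = V \<rhd> (W \<rhd> ?M)" "trg A m = ?VW \<rhd> ?M"
    "m \<bullet> massoc A V W ?M = ide A (?VW \<rhd> ?M)" "massoc A V W ?M \<bullet> m = ide A (V \<rhd> (W \<rhd> ?M))"
    using A.isoE[OF massoc_iso[of V W ?M]] by auto
  let ?d = "q ?VW X \<bullet> m"
  have Tmm: "far T m \<bullet> far T (massoc A V W ?M) = far T (ide A (?VW \<rhd> ?M))"
    using m by (intro fn.far_eq) simp_all
  have "?d \<bullet> (?V \<unrhd> (?W \<unrhd> snd X)) =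
      snd (ob ?VW X) \<bullet> far T ?d \<bullet> lax T V (W \<rhd> ?M) \<bullet> (?V \<unrhd> lax T W ?M)"
  \<comment> \<open>Precomposing with the associator at \<open>T M\<close> brings back the tensor
    product, where \<open>q_balanced\<close> and \<open>lax_massoc\<close> apply.\<close>
  proof (rule A.iso_epi[OF massoc_iso[of V W "fob T ?M"]])
    have "(?V \<unrhd> (?W \<unrhd> snd X)) \<bullet> massoc A V W (fob T ?M) = massoc A V W ?M \<bullet> (ide C ?VW \<unrhd> snd X)"
      by (simp add: massoc_natural_ide)
    then show "(?d \<bullet> (?V \<unrhd> (?W \<unrhd> snd X))) \<bullet> massoc A V W (fob T ?M) =
      (snd (ob ?VW X) \<bullet> far T ?d \<bullet> lax T V (W \<rhd> ?M) \<bullet> (?V \<unrhd> lax T W ?M)) \<bullet> massoc A V W (fob T ?M)"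
      using m(1-3) by (simp add: Tm A.whisker[OF Tmm] A.whisker[OF m(4)] q_balanced)
  qed (use m in simp_all)
  then obtain k where k: "k \<in> arrs E" "src E k = ob V (ob W X)" "trg E k = ob ?VW X"
    "und k \<bullet> q V (ob W X) \<bullet> (?V \<unrhd> q W X) = ?d"
    by (elim double_factor[of V W X "ob ?VW X" ?d, rotated 7]) (use m in simp_all)
  have "h \<cdot>\<^bsub>E\<^esub> k = ide E (ob V (ob W X))"
    by (rule double_ext[of V W X]) (use h k m in \<open>simp_all add: A.whisker[OF h(4)]\<close>)
  moreover have "k \<cdot>\<^bsub>E\<^esub> h = ide E (ob ?VW X)"
    by (rule q_ext[of ?VW X]) (use h k m in \<open>simp_all add: double_whisker[OF k(4)]\<close>)
  ultimately have iso: "is_iso E h"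
    using h k by (intro E.isoI[of _ k]) simp_all
  have "linton_assoc C A T pr V W X = h"
    unfolding linton_assoc_def EM_to_EMmod in_homset
  proof (rule the_equality)
    show "is_iso E h \<and> (h \<in> arrs E \<and> src E h = ob ?VW X \<and> trg E h = ob V (ob W X)) \<and>
      und h \<bullet> q ?VW X = (q V (ob W X) \<bullet> (?V \<unrhd> q W X)) \<bullet> massoc A V W ?M"
      using iso h by simp
    show "l = h" if "is_iso E l \<and> (l \<in> arrs E \<and> src E l = ob ?VW X \<and> trg E l = ob V (ob W X)) \<and>
      und l \<bullet> q ?VW X = (q V (ob W X) \<bullet> (?V \<unrhd> q W X)) \<bullet> massoc A V W ?M" for l
      by (rule q_ext[of ?VW X]) (use that h in simp_all)
  qed
  then show ?thesis
    using h iso by (simp add: in_homset)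
qed

text \<open>The inverse is explicit: \<open>q\<close> after the inverse of \<open>munit\<close>. Its
  linearity is tested after the invertible \<open>munit\<close> at \<open>T M\<close>, where it
  becomes the balancedness of \<open>q\<close> at the unit object.\<close>

lemma linton_unit_iso:
  assumes [simp]: "X \<in> obs E"
  shows "linton_unit C A T pr X \<in> homset E (ob \<one>\<^bsub>C\<^esub> X) X \<and> is_iso E (linton_unit C A T pr X) \<and>
    und (linton_unit C A T pr X) \<bullet> q \<one>\<^bsub>C\<^esub> X = munit A (fst X)"
proof -
  let ?M = "fst X" and ?I = "\<one>\<^bsub>C\<^esub>"
  obtain h where h: "h \<in> arrs E" "src E h = ob ?I X" "trg E h = X" "und h \<bullet> q ?I X = munit A ?M"
    by (rule q_factor[of ?I X X "munit A ?M"]) (simp_all add: munit_natural_arr fn.lax_munit)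
  obtain m where m: "m \<in> arrs A" "src A m = ?M" "trg A m = ?I \<rhd> ?M"
    "m \<bullet> munit A ?M = ide A (?I \<rhd> ?M)" "munit A ?M \<bullet> m = ide A ?M"
    using A.isoE[OF munit_iso[of ?M]] by auto
  have Tmm: "far T m \<bullet> far T (munit A ?M) = far T (ide A (?I \<rhd> ?M))"
    using m by (intro fn.far_eq) simp_all
  have "(q ?I X \<bullet> m) \<bullet> snd X = snd (ob ?I X) \<bullet> far T (q ?I X \<bullet> m)"
  proof (rule A.iso_epi[OF munit_iso[of "fob T ?M"]])
    have "snd X \<bullet> munit A (fob T ?M) = munit A ?M \<bullet> (ide C ?I \<unrhd> snd X)"
      by (simp add: munit_natural_arr)
    then show "((q ?I X \<bullet> m) \<bullet> snd X) \<bullet> munit A (fob T ?M) =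
        (snd (ob ?I X) \<bullet> far T (q ?I X \<bullet> m)) \<bullet> munit A (fob T ?M)"
      using m(1-3) by (simp add: A.whisker[OF m(4)] q_balanced A.whisker[OF Tmm] flip: fn.lax_munit)
  qed (use m in simp_all)
  then have k: "(X, q ?I X \<bullet> m, ob ?I X) \<in> arrs E"
    using m by (intro E_arrI) simp_all
  have "h \<cdot>\<^bsub>E\<^esub> (X, q ?I X \<bullet> m, ob ?I X) = ide E X"
    by (rule E_eqI) (use h m in \<open>simp_all add: A.whisker[OF h(4)]\<close>)
  moreover have "(X, q ?I X \<bullet> m, ob ?I X) \<cdot>\<^bsub>E\<^esub> h = ide E (ob ?I X)"
    by (rule q_ext[of ?I X]) (use h k m in simp_all)
  ultimately have iso: "is_iso E h"
    using h k by (intro E.isoI[of _ "(X, q ?I X \<bullet> m, ob ?I X)"]) simp_all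
  have "linton_unit C A T pr X = h"
    unfolding linton_unit_def EM_to_EMmod in_homset
  proof (rule the_equality)
    show "is_iso E h \<and> (h \<in> arrs E \<and> src E h = ob ?I X \<and> trg E h = X) \<and> und h \<bullet> q ?I X = munit A ?M"
      using iso h by simp
    show "l = h" if "is_iso E l \<and> (l \<in> arrs E \<and> src E l = ob ?I X \<and> trg E l = X) \<and>
      und l \<bullet> q ?I X = munit A ?M" for l
      by (rule q_ext[of ?I X]) (use that h in simp_all)
  qed
  then show ?thesis
    using h iso by (simp add: in_homset)
qed

text \<open>Both sides of every law are linear arrows out of a Linton product, so
  \<open>q_ext\<close> reduces it to the corresponding law for the action on
  \<open>A\<close>.\<close>

lemma bilinear_linton: "bilinear_functor C E E (act_ob E) (act_ar E)"
proof -
  note ar = linton_ar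
  have ar_simps: "linton_ar C A T pr f g \<in> arrs E" "src E (linton_ar C A T pr f g) = ob (src C f) (src E g)"
    "trg E (linton_ar C A T pr f g) = ob (trg C f) (trg E g)"
    if "f \<in> arrs C" "g \<in> arrs E" for f g
    using linton_ar(1)[of f "src C f" "trg C f" g "src E g" "trg E g"] that by (simp_all add: in_homset)
  have ar_q: "und (linton_ar C A T pr f g) \<bullet> q V X = q (trg C f) (trg E g) \<bullet> (f \<unrhd> und g)"
    if "f \<in> arrs C" "g \<in> arrs E" "src C f = V" "src E g = X" for f g V X
    using linton_ar(2)[of f V "trg C f" g X "trg E g"] that by force
  note ar_q' = A.whisker[OF ar_q]
  have plus: "(f \<oplus>\<^bsub>C\<^esub> f') \<unrhd> g = (f \<unrhd> g) \<oplus> (f' \<unrhd> g)"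
    if "f \<in> homset C V V'" "f' \<in> homset C V V'" "g \<in> homset A M M'" for f f' g V V' M M'
    using act_bilinear[unfolded bilinear_functor_def, THEN conjunct2, THEN conjunct2,
      THEN conjunct2, THEN conjunct2, THEN conjunct1] that
    by blast
  have plus': "f \<unrhd> (g \<oplus> g') = (f \<unrhd> g) \<oplus> (f \<unrhd> g')"
    if "f \<in> homset C V V'" "g \<in> homset A M M'" "g' \<in> homset A M M'" for f g g' V V' M M'
    using act_bilinear[unfolded bilinear_functor_def, THEN conjunct2, THEN conjunct2,
      THEN conjunct2, THEN conjunct2, THEN conjunct2, THEN conjunct1] that
    by blast
  have scale: "(c \<star>\<^bsub>C\<^esub> f) \<unrhd> g = c \<star> (f \<unrhd> g)" "f \<unrhd> (c \<star> g) = c \<star> (f \<unrhd> g)"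
    if "f \<in> homset C V V'" "g \<in> homset A M M'" for c f g V V' M M'
    using act_bilinear[unfolded bilinear_functor_def, THEN conjunct2, THEN conjunct2,
      THEN conjunct2, THEN conjunct2, THEN conjunct2, THEN conjunct2] that
    by blast+
  show ?thesis
    unfolding bilinear_functor_def EMmod_fields(10,11)
  proof (intro conjI allI ballI)
    fix V V' V'' X X' X'' f f' g g' and c :: 'k
    show "ob V X \<in> obs E" "linton_ar C A T pr (ide C V) (ide E X) = ide E (ob V X)"
      if [simp]: "V \<in> obs C" "X \<in> obs E"
      by simp (rule q_ext[of V X]; simp add: ar_simps ar_q)
    assume "f \<in> homset C V V'" "g \<in> homset E X X'"
    then have fg: "f \<in> arrs C" "src C f = V" "trg C f = V'" "g \<in> arrs E" "src E g = X" "trg E g = X'"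
      "V \<in> obs C" "V' \<in> obs C" "X \<in> obs E" "X' \<in> obs E"
      by (auto simp: in_homset)
    then have h: "f \<in> homset C V V'" "und g \<in> homset A (fst X) (fst X')"
      by (simp_all add: in_homset)
    show "linton_ar C A T pr f g \<in> homset E (ob V X) (ob V' X')"
      using fg by (simp add: in_homset ar_simps)
    show "linton_ar C A T pr (f' \<cdot>\<^bsub>C\<^esub> f) (g' \<cdot>\<^bsub>E\<^esub> g) = linton_ar C A T pr f' g' \<cdot>\<^bsub>E\<^esub> linton_ar C A T pr f g"
      if "f' \<in> homset C V' V''" "g' \<in> homset E X' X''"
    proof (rule q_ext[of V X])
      have "V'' \<in> obs C" "X'' \<in> obs E"
        using that trg_obs E.trg_obs by (auto simp: in_homset)
      then show "und (linton_ar C A T pr (f' \<cdot>\<^bsub>C\<^esub> f) (g' \<cdot>\<^bsub>E\<^esub> g)) \<bullet> q V X =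
          und (linton_ar C A T pr f' g' \<cdot>\<^bsub>E\<^esub> linton_ar C A T pr f g) \<bullet> q V X"
        using fg that by (simp add: in_homset ar_simps ar_q ar_q' act.act_cmp)
    qed (use fg that in \<open>simp_all add: in_homset ar_simps\<close>)
    show "linton_ar C A T pr (f \<oplus>\<^bsub>C\<^esub> f') g = linton_ar C A T pr f g \<oplus>\<^bsub>E\<^esub> linton_ar C A T pr f' g"
      if "f' \<in> homset C V V'"
      by (rule q_ext[of V X])
        (use fg that plus[OF h(1) that h(2)] in
          \<open>simp_all add: in_homset ar_simps ar_q A.plus_cmp A.cmp_plus\<close>)
    show "linton_ar C A T pr f (g \<oplus>\<^bsub>E\<^esub> g') = linton_ar C A T pr f g \<oplus>\<^bsub>E\<^esub> linton_ar C A T pr f g'"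
      if "g' \<in> homset E X X'"
      by (rule q_ext[of V X])
        (use fg that plus'[OF h(1) h(2), of "und g'"] in
          \<open>simp_all add: in_homset ar_simps ar_q A.plus_cmp A.cmp_plus\<close>)
    show "linton_ar C A T pr (c \<star>\<^bsub>C\<^esub> f) g = c \<star>\<^bsub>E\<^esub> linton_ar C A T pr f g"
      "linton_ar C A T pr f (c \<star>\<^bsub>E\<^esub> g) = c \<star>\<^bsub>E\<^esub> linton_ar C A T pr f g"
      by (rule q_ext[of V X],
        use fg scale[OF h] in \<open>simp_all add: in_homset ar_simps ar_q A.scale_cmp A.cmp_scale\<close>)+
  qed
qed

end

sublocale linton \<subseteq> Em: module_action C "EMmod C A T pr"
  using bilinear_linton linton_assoc_iso linton_unit_iso
  by unfold_locales (simp_all add: EMmod_fields(10-13))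

subsection \<open>The free and forgetful functors\<close>

context linton
begin

declare act_linton_ob [simp]

lemma act_q:
  "\<lbrakk>f \<in> arrs C; g \<in> arrs E; src C f = V; src E g = X\<rbrakk> \<Longrightarrow>
    und (f \<unrhd>\<^bsub>E\<^esub> g) \<bullet> q V X = q (trg C f) (trg E g) \<bullet> (f \<unrhd> und g)"
  using linton_ar(2)[of f V "trg C f" g X "trg E g"] by (force simp: EMmod_fields(11))

lemma act_q_ide:
  "\<lbrakk>V \<in> obs C; g \<in> arrs E; src E g = X\<rbrakk> \<Longrightarrow>
    und (ide C V \<unrhd>\<^bsub>E\<^esub> g) \<bullet> q V X = q V (trg E g) \<bullet> (ide C V \<unrhd> und g)"
  using act_q[of "ide C V" g V X] by simp

lemma act_q_ide_rev:
  "\<lbrakk>V \<in> obs C; g \<in> arrs E; trg E g = Y\<rbrakk> \<Longrightarrow>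
    q V Y \<bullet> (ide C V \<unrhd> und g) = und (ide C V \<unrhd>\<^bsub>E\<^esub> g) \<bullet> q V (src E g)"
  using act_q_ide[of V g "src E g"] by simp

lemma massoc_q:
  "\<lbrakk>V \<in> obs C; W \<in> obs C; X \<in> obs E\<rbrakk> \<Longrightarrow> und (massoc E V W X) \<bullet> q (V \<otimes>\<^bsub>C\<^esub> W) X =
    q V (ob W X) \<bullet> (ide C V \<unrhd> q W X) \<bullet> massoc A V W (fst X)"
  using linton_assoc_iso by (simp add: EMmod_fields)

lemma munit_q: "X \<in> obs E \<Longrightarrow> und (munit E X) \<bullet> q \<one>\<^bsub>C\<^esub> X = munit A (fst X)"
  using linton_unit_iso by (simp add: EMmod_fields)

lemmas act_q' = A.whisker[OF act_q]
lemmas act_q_ide' = A.whisker[OF act_q_ide]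
lemmas massoc_q' = A.whisker[OF massoc_q]
lemmas munit_q' = A.whisker[OF munit_q]

lemma und_linear_rev:
  "\<lbrakk>h \<in> arrs E; trg E h = Y\<rbrakk> \<Longrightarrow> snd Y \<bullet> far T (und h) = und h \<bullet> snd (src E h)"
  using und_linear by auto

lemmas und_linear_rev' = A.whisker[OF und_linear_rev]

lemma q_balanced_rev:
  "\<lbrakk>V \<in> obs C; X \<in> obs E; M = fst X\<rbrakk> \<Longrightarrow>
    snd (ob V X) \<bullet> far T (q V X) \<bullet> lax T V M = q V X \<bullet> (ide C V \<unrhd> snd X)"
  by (simp add: q_balanced)

abbreviation R where "R \<equiv> forgetful_functor A T pr"
abbreviation L where "L \<equiv> free_functor A T pr"

lemma R_simps [simp]: "fob R = fst" "far R = und" "lax R = q"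
  by (simp_all add: forgetful_functor_def)

lemma R_right_exact: "right_exact E A R"
  by (rule right_exact_cong[OF E_linear und_right_exact]) simp_all

text \<open>With \<open>q\<close> as structure map, the three axioms are the equations by which the
  action on arrows, the associator and the unitor of the Linton structure are characterized.\<close>

lemma R_lax: "lax_module_functor C E A R"
  unfolding lax_module_functor_def
proof (intro conjI allI ballI)
  show "linear_functor E A R"
    using R_right_exact by (rule right_exact_linear)
  show "far R (f \<unrhd>\<^bsub>E\<^esub> g) \<bullet> lax R V X = lax R V' X' \<bullet> (f \<unrhd> far R g)"
    if "f \<in> homset C V V'" "g \<in> homset E X X'" for f g V V' X X'
    using that act_q[of f g V X] by (simp add: in_homset)
qed (simp_all add: in_homset massoc_q munit_q)

lemma L_simps [simp]: "fob L = free_ob T" "far L = free_ar A T"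
  by (simp_all add: free_functor_def)

lemma free_ext:
  "\<lbrakk>Y \<in> obs E; f \<in> arrs A; src A f = M; trg A f = fst Y\<rbrakk> \<Longrightarrow> (free_ob T M, snd Y \<bullet> far T f, Y) \<in> arrs E"
  by (rule E_arrI) (auto simp: mu_natural_rev)

text \<open>The balancing condition for \<open>lax T\<close> is that \<open>mu\<close> is a module
  transformation. The resulting equation says that the composite structure map of \<open>R\<close>
  after \<open>L\<close> is that of \<open>T\<close>.\<close>

lemma lax_L:
  assumes [simp]: "V \<in> obs C" "M \<in> obs A"
  shows "lax L V M \<in> homset E (ob V (free_ob T M)) (free_ob T (V \<rhd> M))"
    and "und (lax L V M) \<bullet> q V (free_ob T M) = lax T V M"
proof -
  let ?X = "free_ob T M" and ?Y = "free_ob T (V \<rhd> M)"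
  have "lax T V M \<bullet> (ide C V \<unrhd> snd ?X) = snd ?Y \<bullet> far T (lax T V M) \<bullet> lax T V (fst ?X)"
    by (simp add: mu_lax)
  then obtain h where h: "h \<in> arrs E" "src E h = ob V ?X" "trg E h = ?Y" "und h \<bullet> q V ?X = lax T V M"
    by (elim q_factor[of V ?X ?Y "lax T V M", rotated 6]) simp_all
  have "far T (und h) \<bullet> far T (q V ?X) = far T (lax T V M)"
    using h(1-3) by (intro fn.far_eq[OF h(4)]) simp_all
  then have h': "h \<cdot>\<^bsub>E\<^esub> pr V ?X = linton_right A T V M"
    using h(1-3) by (intro E_eqI) (simp_all add: und_pr und_linear')
  have "lax L V M = h"
    unfolding free_functor_def laxfun.simps EM_to_EMmod in_homset
  proof (rule the_equality)
    show "(h \<in> arrs E \<and> src E h = ob V ?X \<and> trg E h = ?Y) \<and> h \<cdot>\<^bsub>E\<^esub> pr V ?X = linton_right A T V M"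
      using h h' by simp
    show "k = h" if "(k \<in> arrs E \<and> src E k = ob V ?X \<and> trg E k = ?Y) \<and>
        k \<cdot>\<^bsub>E\<^esub> pr V ?X = linton_right A T V M" for k
      by (rule E.coequalizer_epi[OF pr_coequalizer[of V ?X]]) (use that h h' in simp_all)
  qed
  then show "lax L V M \<in> homset E (ob V ?X) ?Y" "und (lax L V M) \<bullet> q V ?X = lax T V M"
    using h by (simp_all add: in_homset)
qed

lemma lax_L_arr [simp]:
  assumes "V \<in> obs C" "M \<in> obs A"
  shows "lax L V M \<in> arrs E" "src E (lax L V M) = ob V (free_ob T M)"
    "trg E (lax L V M) = free_ob T (V \<rhd> M)"
  using lax_L(1)[OF assms] by (simp_all add: in_homset)

lemmas lax_L' = A.whisker[OF lax_L(2)]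

lemma L_right_exact: "right_exact A E L"
  by (rule right_exact_cong[OF A.linear_category_axioms free_right_exact]) simp_all

lemma L_lax: "lax_module_functor C A E L"
  unfolding lax_module_functor_def
proof (intro conjI allI ballI)
  show "linear_functor A E L"
    using L_right_exact by (rule right_exact_linear)
next
  fix V V' M M' f g
  assume "f \<in> homset C V V'" "g \<in> homset A M M'"
  then have fg: "f \<in> arrs C" "src C f = V" "trg C f = V'" "g \<in> arrs A" "src A g = M" "trg A g = M'"
    "V \<in> obs C" "V' \<in> obs C" "M \<in> obs A" "M' \<in> obs A"
    by (auto simp: in_homset)
  show "far L (f \<unrhd> g) \<cdot>\<^bsub>E\<^esub> lax L V M = lax L V' M' \<cdot>\<^bsub>E\<^esub> (f \<unrhd>\<^bsub>E\<^esub> far L g)"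
    by (rule q_ext[of V "free_ob T M"])
      (use fg in \<open>simp_all add: lax_L lax_L' act_q fn.lax_natural\<close>)
next
  fix V W M
  assume [simp]: "V \<in> obs C" "W \<in> obs C" "M \<in> obs A"
  have *: "(ide C V \<unrhd> und (lax L W M)) \<bullet> (ide C V \<unrhd> q W (free_ob T M)) = ide C V \<unrhd> lax T W M"
    by (simp add: lax_L flip: act.ide_act_cmp)
  show "far L (massoc A V W M) \<cdot>\<^bsub>E\<^esub> lax L (V \<otimes>\<^bsub>C\<^esub> W) M =
      lax L V (W \<rhd> M) \<cdot>\<^bsub>E\<^esub> (ide C V \<unrhd>\<^bsub>E\<^esub> lax L W M) \<cdot>\<^bsub>E\<^esub> massoc E V W (fob L M)"
    by (rule q_ext[of "V \<otimes>\<^bsub>C\<^esub> W" "free_ob T M"])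
      (simp_all add: lax_L lax_L' massoc_q act_q_ide' A.whisker[OF *] fn.lax_massoc)
next
  fix M assume [simp]: "M \<in> obs A"
  show "far L (munit A M) \<cdot>\<^bsub>E\<^esub> lax L \<one>\<^bsub>C\<^esub> M = munit E (fob L M)"
    by (rule q_ext[of "\<one>\<^bsub>C\<^esub>" "free_ob T M"]) (simp_all add: lax_L munit_q fn.lax_munit)
qed (simp_all add: in_homset)

text \<open>The inverse is the linear extension of \<open>q\<close> after
  \<open>V \<unrhd> eta\<close>. Naturality of \<open>lax T\<close> and the unit laws of the monad
  give both identities.\<close>

lemma lax_L_iso:
  assumes [simp]: "V \<in> obs C" "M \<in> obs A"
  shows "is_iso E (lax L V M)"
proof -
  let ?X = "free_ob T M"
  let ?f = "q V ?X \<bullet> (ide C V \<unrhd> eta T M)"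
  let ?k = "(free_ob T (V \<rhd> M), snd (ob V ?X) \<bullet> far T ?f, ob V ?X)"
  have k: "?k \<in> arrs E"
    by (rule free_ext) simp_all
  have "far T (und (lax L V M)) \<bullet> far T (q V ?X) = far T (lax T V M)"
    by (intro fn.far_eq lax_L) simp_all
  note 1 = A.whisker[OF this]
  have 2: "far T (lax T V M) \<bullet> far T (ide C V \<unrhd> eta T M) = far T (eta T (V \<rhd> M))"
    by (intro fn.far_eq eta_lax) simp_all
  have "(ide C V \<unrhd> mu T M) \<bullet> (ide C V \<unrhd> far T (eta T M)) = ide A (V \<rhd> fob T M)"
    by (simp flip: act.ide_act_cmp)
  note 3 = this
  \<comment> \<open>Balancedness of \<open>q\<close> at the free module turns the left-hand side
    into \<open>q\<close> after \<open>V \<unrhd> mu\<close> and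
    \<open>V \<unrhd> far T eta\<close>, and these two cancel by the previous fact.\<close>
  have 4: "snd (ob V ?X) \<bullet> far T (q V ?X) \<bullet> lax T V (fob T M) \<bullet> (ide C V \<unrhd> far T (eta T M)) = q V ?X"
    using q_balanced'[of V ?X "ide C V \<unrhd> far T (eta T M)"] 3 by simp
  have "lax L V M \<cdot>\<^bsub>E\<^esub> ?k = ide E (free_ob T (V \<rhd> M))"
    by (rule E_eqI) (simp_all add: und_linear' 1 2)
  moreover have "?k \<cdot>\<^bsub>E\<^esub> lax L V M = ide E (ob V ?X)"
    by (rule q_ext[of V ?X]) (use k in \<open>simp_all add: lax_L 4 fn.lax_natural_ide\<close>)
  ultimately show ?thesis
    using k by (intro E.isoI[of _ ?k]) simp_all
qed

text \<open>This is what makes the right action on \<open>R \<Phi> L\<close> a module transformation.\<close>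

lemma lax_L_counit:
  assumes [simp]: "V \<in> obs C" "M \<in> obs A"
  shows "counit T (free_ob T (V \<rhd> M)) \<cdot>\<^bsub>E\<^esub> (free_ar A T (lax T V M) \<cdot>\<^bsub>E\<^esub> lax L V (fob T M)) =
    lax L V M \<cdot>\<^bsub>E\<^esub> (ide C V \<unrhd>\<^bsub>E\<^esub> counit T (free_ob T M))"
  by (rule q_ext[of V "free_ob T (fob T M)"]) (simp_all add: lax_L act_q_ide lax_L' mu_lax)

end

section \<open>The comparison functor\<close>

locale linton_pair = abelian_module_category C A + S: linton C A S prS + T: linton C A T prT
  for C :: "('v, 'w, 'k::field) moncat"
    and A :: "('v, 'w, 'o, 'a, 'k) modcat" (structure)
    and S :: "('v, 'o, 'a) laxmonad" and prS :: "'v \<Rightarrow> ('o, 'a) em_ob \<Rightarrow> ('o, 'a) em_ar"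
    and T :: "('v, 'o, 'a) laxmonad" and prT :: "'v \<Rightarrow> ('o, 'a) em_ob \<Rightarrow> ('o, 'a) em_ar"
begin

abbreviation K where "K \<equiv> CEW C A S prS T prT"

lemma lax_endofunctor: "lax_module_functor C A A F \<Longrightarrow> lax_functor C A A F"
  by unfold_locales

lemma biactI: "biact_functor C A S T F \<Longrightarrow> lax_functor C A A F"
  by (simp add: biact_functor_def lax_endofunctor)

lemma biact_morphism_module: "biact_morphism C A S T F G t \<Longrightarrow> module_transformation C A A F G t"
  by (simp add: biact_morphism_def)

lemma biact_arr:
  assumes "biact_functor C A S T F" "M \<in> obs A"
  shows "la F M \<in> arrs A" "src A (la F M) = fob S (fob F M)" "trg A (la F M) = fob F M"
    "ra F M \<in> arrs A" "src A (ra F M) = fob F (fob T M)" "trg A (ra F M) = fob F M"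
proof -
  have la: "module_transformation C A A (comp_lax A S F) F (la F)"
    and ra: "module_transformation C A A (comp_lax A F T) F (ra F)"
    using assms by (simp_all add: biact_functor_def)
  show "la F M \<in> arrs A" "src A (la F M) = fob S (fob F M)" "trg A (la F M) = fob F M"
    "ra F M \<in> arrs A" "src A (ra F M) = fob F (fob T M)" "trg A (ra F M) = fob F M"
    using module_transformation_arr[OF la assms(2)] module_transformation_arr[OF ra assms(2)]
    by (simp_all add: comp_lax_def)
qed

lemma biact_morphism_arr:
  assumes "biact_morphism C A S T F G t" "M \<in> obs A"
  shows "t M \<in> arrs A" "src A (t M) = fob F M" "trg A (t M) = fob G M"
  using module_transformation_arr[OF biact_morphism_module[OF assms(1)] assms(2)] by simp_all

lemma biact_morphism_eqs:
  assumes "biact_morphism C A S T F G t" "M \<in> obs A"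
  shows "t M \<bullet> la F M = la G M \<bullet> far S (t M)" "t M \<bullet> ra F M = ra G M \<bullet> t (fob T M)"
  using assms by (simp_all add: biact_morphism_def)

lemma linear_Biact: "linear_category (Biact C A S T)"
proof -
  have FG: "lax_functors C A A F G" if "biact_functor C A S T F" "biact_functor C A S T G" for F G
    using that by (intro lax_functors.intro biactI)
  show ?thesis
    unfolding Biact_def
  proof (rule linear_transformation_category; (elim CollectE conjE)?)
    fix F G H :: "('v, 'o, 'a) biactfun" and s t and c :: 'k
    assume F: "biact_functor C A S T F"
    interpret F: lax_functor C A A F
      using F by (rule biactI)
    show "fob F M \<in> obs A" if "M \<in> obs A" for M
      using that by simp
    show "biact_morphism C A S T F F (\<lambda>M\<in>obs A. ide A (fob F M))"
      using F.module_transformation_ide biact_arr[OF F] by (simp add: biact_morphism_def)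
    assume G: "biact_functor C A S T G"
    interpret FG: lax_functors C A A F G
      using F G by (rule FG)
    note [simp] = biact_arr[OF F] biact_arr[OF G]
    show "biact_morphism C A S T F G (\<lambda>M\<in>obs A. zro A (fob F M) (fob G M))"
      using FG.module_transformation_zro by (simp add: biact_morphism_def)
    assume s: "biact_morphism C A S T F G s"
    note [simp] = biact_morphism_arr[OF s] biact_morphism_eqs[OF s]
    show "s M \<in> homset A (fob F M) (fob G M)" if "M \<in> obs A" for M
      using that by (simp add: in_homset)
    show "biact_morphism C A S T F G (\<lambda>M\<in>obs A. c \<star> s M)"
      using FG.module_transformation_scale[OF biact_morphism_module[OF s]]
      by (simp add: biact_morphism_def A.scale_cmp A.cmp_scale)
    show "biact_morphism C A S T F G (\<lambda>M\<in>obs A. s M \<oplus> t M)" if t: "biact_morphism C A S T F G t"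
      using FG.module_transformation_plus[OF s[THEN biact_morphism_module] t[THEN biact_morphism_module]]
        biact_morphism_arr[OF t] biact_morphism_eqs[OF t]
      by (simp add: biact_morphism_def A.plus_cmp A.cmp_plus)
    assume H: "biact_functor C A S T H" and t: "biact_morphism C A S T G H t"
    show "biact_morphism C A S T F H (\<lambda>M\<in>obs A. t M \<bullet> s M)"
      using FG.module_transformation_restrict_cmp[OF biactI[OF H] s[THEN biact_morphism_module]
          t[THEN biact_morphism_module]] biact_arr[OF H] biact_morphism_arr[OF t]
        biact_morphism_eqs[OF t, THEN A.whisker]
      by (simp add: biact_morphism_def)
  qed (rule A.linear_category_axioms)
qed

end

section \<open>The biact functor attached to a right exact lax module functor\<close>

locale right_exact_lax = linton_pair C A S prS T prT
  for C :: "('v, 'w, 'k::field) moncat"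
    and A :: "('v, 'w, 'o, 'a, 'k) modcat" (structure)
    and S :: "('v, 'o, 'a) laxmonad" and prS :: "'v \<Rightarrow> ('o, 'a) em_ob \<Rightarrow> ('o, 'a) em_ar"
    and T :: "('v, 'o, 'a) laxmonad" and prT :: "'v \<Rightarrow> ('o, 'a) em_ob \<Rightarrow> ('o, 'a) em_ar" +
  fixes \<Phi> :: "('v, ('o, 'a) em_ob, ('o, 'a) em_ar, ('o, 'a) em_ob, ('o, 'a) em_ar) laxfun"
  assumes \<Phi>_lax: "lax_module_functor C (EMmod C A T prT) (EMmod C A S prS) \<Phi>"
    and \<Phi>_rex: "right_exact (EMmod C A T prT) (EMmod C A S prS) \<Phi>"

sublocale right_exact_lax \<subseteq> P: lax_functor C "EMmod C A T prT" "EMmod C A S prS" \<Phi>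
  using \<Phi>_lax by unfold_locales

context right_exact_lax
begin

abbreviation G where "G \<equiv> CEW_ob C A S prS T prT \<Phi>"
abbreviation RPL where "RPL \<equiv> comp_lax A S.R (comp_lax S.E \<Phi> T.L)"

text \<open>The definition composes in \<open>EM\<close>, the proof works in \<open>EMmod\<close>,
  and the two have the same composition. Moreover the counit at a module has the action as its
  underlying arrow, which simplifies both actions of \<open>G\<close>.\<close>

lemma CEW_ob_eq:
  "G = \<lparr>fob = restrict (fob RPL) (obs A), far = restrict (far RPL) (arrs A),
       lax = (\<lambda>V M. if V \<in> obs C \<and> M \<in> obs A then lax RPL V M else undefined),
       la = (\<lambda>M \<in> obs A. snd (fob \<Phi> (free_ob T M))),
       ra = (\<lambda>M \<in> obs A. und (far \<Phi> (counit T (free_ob T M))))\<rparr>"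
proof -
  have "comp_lax (EM A S) \<Phi> T.L = comp_lax S.E \<Phi> T.L"
    by (simp add: comp_lax_def S.EM_to_EMmod)
  then show ?thesis
    unfolding CEW_ob_def Let_def by (simp only:) (simp add: counit_def und_def)
qed

lemma CEW_ob_simps [simp]:
  "M \<in> obs A \<Longrightarrow> fob G M = fst (fob \<Phi> (free_ob T M))"
  "f \<in> arrs A \<Longrightarrow> far G f = und (far \<Phi> (free_ar A T f))"
  "M \<in> obs A \<Longrightarrow> la G M = snd (fob \<Phi> (free_ob T M))"
  "M \<in> obs A \<Longrightarrow> ra G M = und (far \<Phi> (counit T (free_ob T M)))"
  "\<lbrakk>V \<in> obs C; M \<in> obs A\<rbrakk> \<Longrightarrow> lax G V M = und (far \<Phi> (lax T.L V M)) \<bullet>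
    und (lax \<Phi> V (free_ob T M)) \<bullet> S.q V (fob \<Phi> (free_ob T M))"
  by (simp_all add: CEW_ob_eq comp_lax_def)

lemma CEW_ob_lax: "lax_module_functor C A A G"
proof (rule lax_module_functor_cong)
  show "lax_module_functor C A A RPL"
    by (rule lax_module_functor_comp[OF act.module_action_axioms S.Em.module_action_axioms
      act.module_action_axioms lax_module_functor_comp[OF act.module_action_axioms
      T.Em.module_action_axioms S.Em.module_action_axioms T.L_lax \<Phi>_lax] S.R_lax])
qed (simp_all add: CEW_ob_eq act.module_action_axioms)

lemma CEW_ob_right_exact: "right_exact A A G"
proof (rule right_exact_cong)
  have "right_exact A S.E (comp_lax S.E \<Phi> T.L)"
    by (rule right_exact_comp[OF T.L_right_exact \<Phi>_rex]) (simp_all add: comp_lax_def)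
  then show "right_exact A A RPL"
    by (rule right_exact_comp[OF _ S.R_right_exact]) (simp_all add: comp_lax_def)
qed (simp_all add: CEW_ob_eq A.linear_category_axioms)

lemma und_far_eq:
  "\<lbrakk>g \<cdot>\<^bsub>T.E\<^esub> f = h; f \<in> arrs T.E; g \<in> arrs T.E; src T.E g = trg T.E f\<rbrakk>
    \<Longrightarrow> und (far \<Phi> g) \<bullet> und (far \<Phi> f) = und (far \<Phi> h)"
  by (metis P.far_cmp S.E_ops(3))

text \<open>The left action is the \<open>S\<close>-action on the module
  \<open>fob \<Phi> (free_ob T M)\<close>. Underlying arrows of \<open>S\<close>-module morphisms
  commute with it, which gives naturality and moves it past the structure maps of \<open>L\<close>
  and \<Phi>; what then remains is the balancedness of \<open>q\<close>.\<close>

lemma CEW_ob_left_action: "module_transformation C A A (comp_lax A S G) G (la G)"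
proof (rule module_transformationI)
  fix V M assume [simp]: "V \<in> obs C" "M \<in> obs A"
  show "la G (V \<rhd> M) \<bullet> lax (comp_lax A S G) V M = lax G V M \<bullet> (ide C V \<unrhd> la G M)"
    by (simp add: comp_lax_def S.und_linear_rev' S.q_balanced_rev)
qed (simp_all add: A.linear_category_axioms comp_lax_def S.und_linear_rev)

text \<open>Compatibility with the action of \<open>C\<close> is the image under \<Phi> of
  \<open>lax_L_counit\<close>, carried past \<Phi> and \<open>R\<close> by naturality of their
  structure maps.\<close>

lemma CEW_ob_right_action: "module_transformation C A A (comp_lax A G T) G (ra G)"
proof (rule module_transformationI)
  fix f assume [simp]: "f \<in> arrs A"
  have "counit T (free_ob T (trg A f)) \<cdot>\<^bsub>T.E\<^esub> free_ar A T (far T f) =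
      free_ar A T f \<cdot>\<^bsub>T.E\<^esub> counit T (free_ob T (src A f))"
    by (rule T.E_eqI) (simp_all add: T.mu_natural)
  from und_far_eq[OF this] show "ra G (trg A f) \<bullet> far (comp_lax A G T) f = far G f \<bullet> ra G (src A f)"
    by (simp add: comp_lax_def)
next
  fix V M assume [simp]: "V \<in> obs C" "M \<in> obs A"
  from und_far_eq[OF T.lax_L_counit[of V M]]
  have "und (far \<Phi> (counit T (free_ob T (V \<rhd> M)))) \<bullet> und (far \<Phi> (free_ar A T (lax T V M))) \<bullet>
      und (far \<Phi> (lax T.L V (fob T M))) =
    und (far \<Phi> (lax T.L V M)) \<bullet> und (far \<Phi> (ide C V \<unrhd>\<^bsub>T.E\<^esub> counit T (free_ob T M)))"
    by simp
  note * = S.double_whisker[OF this]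
  have "und (far \<Phi> (ide C V \<unrhd>\<^bsub>T.E\<^esub> counit T (free_ob T M))) \<bullet> und (lax \<Phi> V (free_ob T (fob T M))) =
      und (lax \<Phi> V (free_ob T M)) \<bullet> und (ide C V \<unrhd>\<^bsub>S.E\<^esub> far \<Phi> (counit T (free_ob T M)))"
    using P.lax_natural_ide[of V "counit T (free_ob T M)"]
    by (simp flip: S.E_ops(3))
  note ** = A.whisker[OF this]
  show "ra G (V \<rhd> M) \<bullet> lax (comp_lax A G T) V M = lax G V M \<bullet> (ide C V \<unrhd> ra G M)"
    by (simp add: comp_lax_def * ** S.act_q_ide_rev)
qed (simp_all add: A.linear_category_axioms comp_lax_def)

text \<open>The laws of the left action are those of an \<open>S\<close>-module, the laws of the
  right action are images under \<Phi> of monad laws at a free module, and the two actions commute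
  because the right one underlies an \<open>S\<close>-module morphism.\<close>

lemma CEW_ob_biact: "biact_functor C A S T G"
  unfolding biact_functor_def
proof (intro conjI ballI CEW_ob_lax CEW_ob_right_exact CEW_ob_left_action CEW_ob_right_action)
  fix M assume [simp]: "M \<in> obs A"
  have "counit T (free_ob T M) \<cdot>\<^bsub>T.E\<^esub> free_ar A T (eta T M) = ide T.E (free_ob T M)"
    by (rule T.E_eqI) simp_all
  from und_far_eq[OF this] show "ra G M \<bullet> far G (eta T M) = ide A (fob G M)"
    by simp
  have "counit T (free_ob T M) \<cdot>\<^bsub>T.E\<^esub> free_ar A T (mu T M) =
      counit T (free_ob T M) \<cdot>\<^bsub>T.E\<^esub> counit T (free_ob T (fob T M))"
    by (rule T.E_eqI) simp_all
  from und_far_eq[OF this] show "ra G M \<bullet> far G (mu T M) = ra G M \<bullet> ra G (fob T M)"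
    by simp
qed (simp_all add: S.und_linear)

lemma CEW_ob_in_Biact: "G \<in> obs (Biact C A S T)"
  using CEW_ob_biact by (simp add: Biact_def lax_extensional_def CEW_ob_eq)

end

section \<open>Transformations are determined by, and extend from, free modules\<close>

context linton
begin

lemma counit_natural:
  "\<lbrakk>g \<in> arrs E; src E g = X\<rbrakk> \<Longrightarrow> g \<cdot>\<^bsub>E\<^esub> counit T X = counit T (trg E g) \<cdot>\<^bsub>E\<^esub> free_ar A T (und g)"
  by (rule E_eqI) (auto simp: und_linear)

text \<open>By naturality \<open>und (ide C V \<unrhd> e)\<close>, formed in the module category,
  composes with \<open>q\<close> to \<open>q\<close> after \<open>V \<unrhd> und e\<close>; the
  latter factor is a coequalizer in \<open>A\<close> and cancels, and then \<open>q\<close> cancels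
  by linearity.\<close>

lemma act_epi:
  assumes [simp]: "V \<in> obs C" and e: "is_coequalizer E f g e"
    and h: "h \<in> arrs E" "k \<in> arrs E" "src E h = ob V (trg E e)" "src E k = ob V (trg E e)"
      "trg E h = trg E k"
    and eq: "h \<cdot>\<^bsub>E\<^esub> (ide C V \<unrhd>\<^bsub>E\<^esub> e) = k \<cdot>\<^bsub>E\<^esub> (ide C V \<unrhd>\<^bsub>E\<^esub> e)"
  shows "h = k"
proof (rule q_ext[of V "trg E e"])
  have e' [simp]: "e \<in> arrs E"
    using E.coequalizerD[OF e] by simp
  have "und h \<bullet> und (ide C V \<unrhd>\<^bsub>E\<^esub> e) = und k \<bullet> und (ide C V \<unrhd>\<^bsub>E\<^esub> e)"
    using und_eq[OF eq] by simp
  note * = A.whisker[OF this, of "q V (src E e)"]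
  show "und h \<bullet> q V (trg E e) = und k \<bullet> q V (trg E e)"
  proof (rule A.coequalizer_epi[OF act_left_coequalizer[of V, OF _ und_coequalizer[OF e]]])
    show "(und h \<bullet> q V (trg E e)) \<bullet> (ide C V \<unrhd> und e) = (und k \<bullet> q V (trg E e)) \<bullet> (ide C V \<unrhd> und e)"
      using h * by (simp add: act_q_ide_rev)
  qed (use h in simp_all)
qed (use h E.coequalizerD[OF e] in simp_all)

end

locale right_exact_lax_pair = linton_pair C A S prS T prT +
  P: right_exact_lax C A S prS T prT \<Phi> + Q: right_exact_lax C A S prS T prT \<Psi>
  for C :: "('v, 'w, 'k::field) moncat"
    and A :: "('v, 'w, 'o, 'a, 'k) modcat" (structure)
    and S :: "('v, 'o, 'a) laxmonad" and prS :: "'v \<Rightarrow> ('o, 'a) em_ob \<Rightarrow> ('o, 'a) em_ar"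
    and T :: "('v, 'o, 'a) laxmonad" and prT :: "'v \<Rightarrow> ('o, 'a) em_ob \<Rightarrow> ('o, 'a) em_ar"
    and \<Phi> \<Psi> :: "('v, ('o, 'a) em_ob, ('o, 'a) em_ar, ('o, 'a) em_ob, ('o, 'a) em_ar) laxfun"
begin

lemma CEW_morphism:
  assumes t: "module_transformation C T.E S.E \<Phi> \<Psi> t"
  shows "biact_morphism C A S T P.G Q.G (\<lambda>M\<in>obs A. und (t (free_ob T M)))"
proof -
  note [simp] = module_transformation_arr[OF t]
  have nat: "und (t (trg T.E f)) \<bullet> und (far \<Phi> f) = und (far \<Psi> f) \<bullet> und (t X)"
    if "f \<in> arrs T.E" "src T.E f = X" for f X
    using S.und_eq[OF module_transformation_natural[OF t that]] by simp
  have "module_transformation C A A P.G Q.G (\<lambda>M\<in>obs A. und (t (free_ob T M)))"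
  proof (rule module_transformationI)
    show "(\<lambda>M\<in>obs A. und (t (free_ob T M))) (trg A f) \<bullet> far P.G f =
        far Q.G f \<bullet> (\<lambda>M\<in>obs A. und (t (free_ob T M))) (src A f)" if "f \<in> arrs A" for f
      using nat[of "free_ar A T f"] that by simp
  next
    fix V M assume [simp]: "V \<in> obs C" "M \<in> obs A"
    have 1: "und (t (free_ob T (V \<rhd> M))) \<bullet> und (far \<Phi> (lax T.L V M)) =
        und (far \<Psi> (lax T.L V M)) \<bullet> und (t (T.ob V (free_ob T M)))"
      using nat[of "lax T.L V M"] by simp
    have 2: "und (t (T.ob V (free_ob T M))) \<bullet> und (lax \<Phi> V (free_ob T M)) =
        und (lax \<Psi> V (free_ob T M)) \<bullet> und (ide C V \<unrhd>\<^bsub>S.E\<^esub> t (free_ob T M))"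
      using S.und_eq[OF module_transformation_lax[OF t, of V "free_ob T M"]] by simp
    show "(\<lambda>M\<in>obs A. und (t (free_ob T M))) (V \<rhd> M) \<bullet> lax P.G V M =
        lax Q.G V M \<bullet> (ide C V \<unrhd> (\<lambda>M\<in>obs A. und (t (free_ob T M))) M)"
      by (simp add: A.whisker[OF 1] A.whisker[OF 2] S.act_q_ide)
  qed (simp_all add: A.linear_category_axioms)
  then show ?thesis
    using nat[of "counit T (free_ob T _)"] by (simp add: biact_morphism_def S.und_linear)
qed

lemma CEW_faithful:
  assumes t: "module_transformation C T.E S.E \<Phi> \<Psi> t" and s: "module_transformation C T.E S.E \<Phi> \<Psi> s"
    and eq: "\<And>M. M \<in> obs A \<Longrightarrow> und (t (free_ob T M)) = und (s (free_ob T M))"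
    and X [simp]: "X \<in> obs T.E"
  shows "t X = s X"
proof (rule S.E.coequalizer_epi[OF P.P.right_exact_coequalizer[OF P.\<Phi>_rex T.counit_coequalizer[OF X]]])
  note [simp] = module_transformation_arr[OF t] module_transformation_arr[OF s]
  have "t (free_ob T (fst X)) = s (free_ob T (fst X))"
    by (rule S.E_eqI) (simp_all add: eq)
  then show "t X \<cdot>\<^bsub>S.E\<^esub> far \<Phi> (counit T X) = s X \<cdot>\<^bsub>S.E\<^esub> far \<Phi> (counit T X)"
    using module_transformation_natural[OF t, of "counit T X"]
      module_transformation_natural[OF s, of "counit T X"]
    by simp
qed (simp_all add: module_transformation_arr[OF t] module_transformation_arr[OF s])

lemma CEW_full:
  assumes s: "biact_morphism C A S T P.G Q.G s"
  shows "\<exists>t \<in> extensional (obs T.E). module_transformation C T.E S.E \<Phi> \<Psi> t \<and>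
    (\<forall>M \<in> obs A. und (t (free_ob T M)) = s M)"
proof -
  have [simp]: "s M \<in> arrs A" "src A (s M) = fst (fob \<Phi> (free_ob T M))"
    "trg A (s M) = fst (fob \<Psi> (free_ob T M))" if "M \<in> obs A" for M
    using biact_morphism_arr[OF s that] that by simp_all
  \<comment> \<open>Compatibility of \<open>s\<close> with the left actions says exactly that each
    component is \<open>S\<close>-linear, so it lifts to modules.\<close>
  define r where "r M = (fob \<Phi> (free_ob T M), s M, fob \<Psi> (free_ob T M))" for M
  have r [simp]: "r M \<in> arrs S.E" "src S.E (r M) = fob \<Phi> (free_ob T M)"
    "trg S.E (r M) = fob \<Psi> (free_ob T M)" "und (r M) = s M" if "M \<in> obs A" for M
    unfolding r_def using biact_morphism_eqs(1)[OF s that] that by (auto intro!: S.E_arrI)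
  have r_nat: "r (trg A f) \<cdot>\<^bsub>S.E\<^esub> far \<Phi> (free_ar A T f) = far \<Psi> (free_ar A T f) \<cdot>\<^bsub>S.E\<^esub> r M"
    if "f \<in> arrs A" "src A f = M" for f M
    by (rule S.E_eqI)
      (use module_transformation_natural[OF biact_morphism_module[OF s] that] that in auto)
  have r_ra: "r M \<cdot>\<^bsub>S.E\<^esub> far \<Phi> (counit T (free_ob T M)) =
      far \<Psi> (counit T (free_ob T M)) \<cdot>\<^bsub>S.E\<^esub> r (fob T M)" if "M \<in> obs A" for M
    by (rule S.E_eqI) (use biact_morphism_eqs(2)[OF s that] that in simp_all)
  note coeq = P.P.right_exact_coequalizer[OF P.\<Phi>_rex T.counit_coequalizer]
  have "\<exists>u. u \<in> arrs S.E \<and> src S.E u = fob \<Phi> X \<and> trg S.E u = fob \<Psi> X \<and>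
      u \<cdot>\<^bsub>S.E\<^esub> far \<Phi> (counit T X) = far \<Psi> (counit T X) \<cdot>\<^bsub>S.E\<^esub> r (fst X)"
    if [simp]: "X \<in> obs T.E" for X
  proof -
    let ?h = "far \<Psi> (counit T X) \<cdot>\<^bsub>S.E\<^esub> r (fst X)"
    have "counit T X \<cdot>\<^bsub>T.E\<^esub> free_ar A T (snd X) = counit T X \<cdot>\<^bsub>T.E\<^esub> counit T (free_ob T (fst X))"
      using T.E.coequalizerD(7)[OF T.counit_coequalizer[of X]] by simp
    from Q.P.far_eq[OF this] have *: "far \<Psi> (counit T X) \<cdot>\<^bsub>S.E\<^esub> far \<Psi> (free_ar A T (snd X)) =
        far \<Psi> (counit T X) \<cdot>\<^bsub>S.E\<^esub> far \<Psi> (counit T (free_ob T (fst X)))"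
      by simp
    \<comment> \<open>Naturality of \<open>r\<close> at the action of \<open>X\<close> and
      compatibility with the right actions move both arrows to the side of \<Psi>, where they are
      identified by the image of the presentation of \<open>X\<close>.\<close>
    have "?h \<cdot>\<^bsub>S.E\<^esub> far \<Phi> (free_ar A T (snd X)) = ?h \<cdot>\<^bsub>S.E\<^esub> far \<Phi> (counit T (free_ob T (fst X)))"
      using r_nat[of "snd X"] r_ra[of "fst X"] S.E.whisker[OF *, of "r (fob T (fst X))"] by simp
    then show ?thesis
      using S.E.coequalizer_factor[OF coeq[of X], of ?h] by (metis P.P.far_arr(2,3) Q.P.far_arr(2,3)
        S.E.cmp_arr Q.P.far_arr(1) T.counit_arr T.free_ar_arr T.E_ob r that)
  qed
  then obtain t0 where t0: "\<And>X. X \<in> obs T.E \<Longrightarrow> t0 X \<in> arrs S.E \<and> src S.E (t0 X) = fob \<Phi> X \<and>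
      trg S.E (t0 X) = fob \<Psi> X \<and>
      t0 X \<cdot>\<^bsub>S.E\<^esub> far \<Phi> (counit T X) = far \<Psi> (counit T X) \<cdot>\<^bsub>S.E\<^esub> r (fst X)"
    by metis
  define t where "t = restrict t0 (obs T.E)"
  have t [simp]: "t X \<in> arrs S.E" "src S.E (t X) = fob \<Phi> X" "trg S.E (t X) = fob \<Psi> X"
    if "X \<in> obs T.E" for X
    using that t0[of X] by (simp_all add: t_def)
  have tc: "t X \<cdot>\<^bsub>S.E\<^esub> far \<Phi> (counit T X) = far \<Psi> (counit T X) \<cdot>\<^bsub>S.E\<^esub> r (fst X)"
    if "X \<in> obs T.E" for X
    using that t0[of X] by (simp add: t_def)
  note tc' = S.E.whisker[OF tc]
  \<comment> \<open>By \<open>r_ra\<close>, the given component \<open>r M\<close> solves the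
    problem that defines \<open>t\<close> at the free module.\<close>
  have t_free: "t (free_ob T M) = r M" if [simp]: "M \<in> obs A" for M
    by (rule S.E.coequalizer_epi[OF coeq[of "free_ob T M"]]) (simp_all add: tc r_ra)
  have t_nat: "t (trg T.E g) \<cdot>\<^bsub>S.E\<^esub> far \<Phi> g = far \<Psi> g \<cdot>\<^bsub>S.E\<^esub> t (src T.E g)"
    if [simp]: "g \<in> arrs T.E" for g
  proof (rule S.E.coequalizer_epi[OF coeq[of "src T.E g"]])
    note nat = T.counit_natural[of g "src T.E g"]
    have 1: "far \<Phi> g \<cdot>\<^bsub>S.E\<^esub> far \<Phi> (counit T (src T.E g)) =
        far \<Phi> (counit T (trg T.E g)) \<cdot>\<^bsub>S.E\<^esub> far \<Phi> (free_ar A T (und g))"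
      by (subst P.P.far_eq[OF nat]) simp_all
    have 2: "far \<Psi> g \<cdot>\<^bsub>S.E\<^esub> far \<Psi> (counit T (src T.E g)) =
        far \<Psi> (counit T (trg T.E g)) \<cdot>\<^bsub>S.E\<^esub> far \<Psi> (free_ar A T (und g))"
      by (subst Q.P.far_eq[OF nat]) simp_all
    show "(t (trg T.E g) \<cdot>\<^bsub>S.E\<^esub> far \<Phi> g) \<cdot>\<^bsub>S.E\<^esub> far \<Phi> (counit T (src T.E g)) =
        (far \<Psi> g \<cdot>\<^bsub>S.E\<^esub> t (src T.E g)) \<cdot>\<^bsub>S.E\<^esub> far \<Phi> (counit T (src T.E g))"
      using r_nat[of "und g"] by (simp add: tc tc' 1 S.E.whisker[OF 2])
  qed simp_all
  have lax_free: "t (T.ob V (free_ob T M)) \<cdot>\<^bsub>S.E\<^esub> lax \<Phi> V (free_ob T M) =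
      lax \<Psi> V (free_ob T M) \<cdot>\<^bsub>S.E\<^esub> (ide C V \<unrhd>\<^bsub>S.E\<^esub> r M)" if [simp]: "V \<in> obs C" "M \<in> obs A" for V M
  \<comment> \<open>The hypothesis on \<open>s\<close> yields this identity only after the structure
    map of \<open>L\<close> has been transported by \<Psi>; since \<open>L\<close> is strong, that
    map can be cancelled.\<close>
  proof (rule S.E.iso_mono[OF Q.P.far_iso[OF T.lax_L_iso[of V M]]])
    have 1: "far \<Psi> (lax T.L V M) \<cdot>\<^bsub>S.E\<^esub> t (T.ob V (free_ob T M)) =
        r (V \<rhd> M) \<cdot>\<^bsub>S.E\<^esub> far \<Phi> (lax T.L V M)"
      using t_nat[of "lax T.L V M"] by (simp add: t_free)
    show "far \<Psi> (lax T.L V M) \<cdot>\<^bsub>S.E\<^esub> (t (T.ob V (free_ob T M)) \<cdot>\<^bsub>S.E\<^esub> lax \<Phi> V (free_ob T M)) =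
        far \<Psi> (lax T.L V M) \<cdot>\<^bsub>S.E\<^esub> (lax \<Psi> V (free_ob T M) \<cdot>\<^bsub>S.E\<^esub> (ide C V \<unrhd>\<^bsub>S.E\<^esub> r M))"
    proof (rule S.q_ext[of V "fob \<Phi> (free_ob T M)"])
      show "und (far \<Psi> (lax T.L V M) \<cdot>\<^bsub>S.E\<^esub> (t (T.ob V (free_ob T M)) \<cdot>\<^bsub>S.E\<^esub> lax \<Phi> V (free_ob T M))) \<bullet>
          S.q V (fob \<Phi> (free_ob T M)) =
        und (far \<Psi> (lax T.L V M) \<cdot>\<^bsub>S.E\<^esub> (lax \<Psi> V (free_ob T M) \<cdot>\<^bsub>S.E\<^esub> (ide C V \<unrhd>\<^bsub>S.E\<^esub> r M))) \<bullet>
          S.q V (fob \<Phi> (free_ob T M))"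
        using module_transformation_lax[OF biact_morphism_module[OF s], of V M] A.whisker[OF S.und_eq[OF 1]]
        by (simp add: S.act_q_ide)
    qed simp_all
  qed simp_all
  have "module_transformation C T.E S.E \<Phi> \<Psi> t"
  proof (rule module_transformationI)
    fix V X assume [simp]: "V \<in> obs C" "X \<in> obs T.E"
    let ?e = "counit T X"
    have "t (T.ob V X) \<cdot>\<^bsub>S.E\<^esub> lax \<Phi> V X = lax \<Psi> V X \<cdot>\<^bsub>S.E\<^esub> (ide C V \<unrhd>\<^bsub>S.E\<^esub> t X)"
    \<comment> \<open>Precomposing with the image of the counit reduces the claim at
      \<open>X\<close> to \<open>lax_free\<close> at the free module on
      \<open>fst X\<close>.\<close>
    proof (rule S.act_epi[of V, OF _ coeq[of X]])
      have 1: "t (T.ob V X) \<cdot>\<^bsub>S.E\<^esub> far \<Phi> (ide C V \<unrhd>\<^bsub>T.E\<^esub> ?e) =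
          far \<Psi> (ide C V \<unrhd>\<^bsub>T.E\<^esub> ?e) \<cdot>\<^bsub>S.E\<^esub> t (T.ob V (free_ob T (fst X)))"
        using t_nat[of "ide C V \<unrhd>\<^bsub>T.E\<^esub> ?e"] by simp
      have 2: "(ide C V \<unrhd>\<^bsub>S.E\<^esub> t X) \<cdot>\<^bsub>S.E\<^esub> (ide C V \<unrhd>\<^bsub>S.E\<^esub> far \<Phi> ?e) =
          (ide C V \<unrhd>\<^bsub>S.E\<^esub> far \<Psi> ?e) \<cdot>\<^bsub>S.E\<^esub> (ide C V \<unrhd>\<^bsub>S.E\<^esub> r (fst X))"
        by (simp add: tc flip: S.Em.ide_act_cmp)
      show "(t (T.ob V X) \<cdot>\<^bsub>S.E\<^esub> lax \<Phi> V X) \<cdot>\<^bsub>S.E\<^esub> (ide C V \<unrhd>\<^bsub>S.E\<^esub> far \<Phi> ?e) =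
          (lax \<Psi> V X \<cdot>\<^bsub>S.E\<^esub> (ide C V \<unrhd>\<^bsub>S.E\<^esub> t X)) \<cdot>\<^bsub>S.E\<^esub> (ide C V \<unrhd>\<^bsub>S.E\<^esub> far \<Phi> ?e)"
        by (simp add: P.P.lax_natural_ide_rev Q.P.lax_natural_ide_rev' 2 S.E.whisker[OF 1] lax_free)
    qed simp_all
    then show "t (V \<rhd>\<^bsub>T.E\<^esub> X) \<cdot>\<^bsub>S.E\<^esub> lax \<Phi> V X = lax \<Psi> V X \<cdot>\<^bsub>S.E\<^esub> (ide C V \<unrhd>\<^bsub>S.E\<^esub> t X)"
      by simp
  qed (simp_all add: T.E_linear t_nat)
  then show ?thesis
    by (intro bexI[of _ t]) (simp_all add: t_free, simp add: t_def)
qed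

end

section \<open>The comparison functor is linear, faithful and full\<close>

context linton_pair
begin

lemma fob_K: "fob K = CEW_ob C A S prS T prT"
  by (simp add: CEW_def Let_def)

lemma far_K: "far K (\<Phi>, t, \<Psi>) =
    (CEW_ob C A S prS T prT \<Phi>, \<lambda>M\<in>obs A. und (t (free_ob T M)), CEW_ob C A S prS T prT \<Psi>)"
  by (simp add: CEW_def Let_def)

lemma LaxRex_obsD: "\<Phi> \<in> obs (LaxRex C T.E S.E) \<Longrightarrow> right_exact_lax C A S prS T prT \<Phi>"
  by unfold_locales (simp_all add: LaxRex_def)

lemma LaxRex_hom:
  assumes "f \<in> homset (LaxRex C T.E S.E) \<Phi> \<Psi>"
  obtains t where "f = (\<Phi>, t, \<Psi>)" "t \<in> extensional (obs T.E)" "module_transformation C T.E S.E \<Phi> \<Psi> t"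
    "right_exact_lax_pair C A S prS T prT \<Phi> \<Psi>"
proof -
  have "\<Phi> \<in> obs (LaxRex C T.E S.E)" "\<Psi> \<in> obs (LaxRex C T.E S.E)"
    using assms by (auto simp: LaxRex_def in_transformation_category)
  then have "right_exact_lax_pair C A S prS T prT \<Phi> \<Psi>"
    by (intro right_exact_lax_pair.intro LaxRex_obsD linton_pair_axioms)
  then show ?thesis
    using assms that by (auto simp: LaxRex_def in_transformation_category)
qed

lemma K_linear: "linear_functor (LaxRex C T.E S.E) (Biact C A S T) K"
  unfolding linear_functor_def
proof (intro conjI allI ballI)
  fix \<Phi> assume \<Phi>: "\<Phi> \<in> obs (LaxRex C T.E S.E)"
  then interpret right_exact_lax C A S prS T prT \<Phi>
    by (rule LaxRex_obsD)
  show "fob K \<Phi> \<in> obs (Biact C A S T)"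
    by (simp add: fob_K CEW_ob_in_Biact)
  show "far K (ide (LaxRex C T.E S.E) \<Phi>) = ide (Biact C A S T) (fob K \<Phi>)"
    by (auto simp: LaxRex_def Biact_def far_K fob_K intro!: restrict_ext)
next
  fix \<Phi> \<Psi> \<Xi> f g and c :: 'k
  assume f: "f \<in> homset (LaxRex C T.E S.E) \<Phi> \<Psi>"
  then obtain t where t: "f = (\<Phi>, t, \<Psi>)" "module_transformation C T.E S.E \<Phi> \<Psi> t"
    and "right_exact_lax_pair C A S prS T prT \<Phi> \<Psi>"
    by (rule LaxRex_hom)
  then interpret PQ: right_exact_lax_pair C A S prS T prT \<Phi> \<Psi>
    by simp
  note [simp] = module_transformation_arr[OF t(2)]
  show "far K f \<in> homset (Biact C A S T) (fob K \<Phi>) (fob K \<Psi>)"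
    using PQ.P.CEW_ob_in_Biact PQ.Q.CEW_ob_in_Biact PQ.CEW_morphism[OF t(2)]
    by (simp add: Biact_def in_transformation_category t(1) fob_K far_K)
  show "far K (c \<star>\<^bsub>LaxRex C T.E S.E\<^esub> f) = c \<star>\<^bsub>Biact C A S T\<^esub> far K f"
    by (auto simp: t(1) LaxRex_def Biact_def far_K intro!: restrict_ext)
  show "far K (g \<cdot>\<^bsub>LaxRex C T.E S.E\<^esub> f) = far K g \<cdot>\<^bsub>Biact C A S T\<^esub> far K f"
    if g: "g \<in> homset (LaxRex C T.E S.E) \<Psi> \<Xi>"
    using g by (rule LaxRex_hom) (auto simp: t(1) LaxRex_def Biact_def far_K intro!: restrict_ext)
  show "far K (f \<oplus>\<^bsub>LaxRex C T.E S.E\<^esub> g) = far K f \<oplus>\<^bsub>Biact C A S T\<^esub> far K g"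
    if g: "g \<in> homset (LaxRex C T.E S.E) \<Phi> \<Psi>"
    using g by (rule LaxRex_hom) (auto simp: t(1) LaxRex_def Biact_def far_K intro!: restrict_ext)
qed

lemma K_faithful: "faithful (LaxRex C T.E S.E) K"
  unfolding faithful_def
proof (intro ballI impI)
  fix \<Phi> \<Psi> f g
  assume f: "f \<in> homset (LaxRex C T.E S.E) \<Phi> \<Psi>" and g: "g \<in> homset (LaxRex C T.E S.E) \<Phi> \<Psi>"
    and eq: "far K f = far K g"
  obtain t where t: "f = (\<Phi>, t, \<Psi>)" "t \<in> extensional (obs T.E)" "module_transformation C T.E S.E \<Phi> \<Psi> t"
    and "right_exact_lax_pair C A S prS T prT \<Phi> \<Psi>"
    using f by (rule LaxRex_hom)
  then interpret PQ: right_exact_lax_pair C A S prS T prT \<Phi> \<Psi>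
    by simp
  obtain s where s: "g = (\<Phi>, s, \<Psi>)" "s \<in> extensional (obs T.E)" "module_transformation C T.E S.E \<Phi> \<Psi> s"
    using g by (rule LaxRex_hom)
  have "und (t (free_ob T M)) = und (s (free_ob T M))" if "M \<in> obs A" for M
    using eq that unfolding t(1) s(1) far_K by (auto dest: fun_cong[where x = M])
  then have "t = s"
    using t(2) s(2) by (intro extensionalityI[of t "obs T.E" s] PQ.CEW_faithful t(3) s(3))
  then show "f = g"
    by (simp add: t(1) s(1))
qed

lemma K_full:
  assumes \<Phi>: "\<Phi> \<in> obs (LaxRex C T.E S.E)" and \<Psi>: "\<Psi> \<in> obs (LaxRex C T.E S.E)"
    and g: "g \<in> homset (Biact C A S T) (fob K \<Phi>) (fob K \<Psi>)"
  shows "\<exists>f \<in> homset (LaxRex C T.E S.E) \<Phi> \<Psi>. far K f = g"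
proof -
  interpret PQ: right_exact_lax_pair C A S prS T prT \<Phi> \<Psi>
    by (intro right_exact_lax_pair.intro LaxRex_obsD linton_pair_axioms \<Phi> \<Psi>)
  obtain s where s: "s \<in> extensional (obs A)" "biact_morphism C A S T PQ.P.G PQ.Q.G s"
    "g = (PQ.P.G, s, PQ.Q.G)"
    using g by (auto simp: Biact_def in_transformation_category fob_K)
  obtain t where t: "module_transformation C T.E S.E \<Phi> \<Psi> t" "t \<in> extensional (obs T.E)"
    "\<forall>M \<in> obs A. und (t (free_ob T M)) = s M"
    using PQ.CEW_full[OF s(2)] by blast
  have "(\<lambda>M\<in>obs A. und (t (free_ob T M))) = s"
    using s(1) t(3) by (intro extensionalityI[of _ "obs A" s]) simp_all
  then show ?thesis
    using t \<Phi> \<Psi> by (intro bexI[of _ "(\<Phi>, t, \<Psi>)"]) (simp_all add: far_K s(3) LaxRex_def in_transformation_category)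
qed

end

section \<open>Essential surjectivity\<close>

locale biact = linton_pair C A S prS T prT
  for C :: "('v, 'w, 'k::field) moncat"
    and A :: "('v, 'w, 'o, 'a, 'k) modcat" (structure)
    and S :: "('v, 'o, 'a) laxmonad" and prS :: "'v \<Rightarrow> ('o, 'a) em_ob \<Rightarrow> ('o, 'a) em_ar"
    and T :: "('v, 'o, 'a) laxmonad" and prT :: "'v \<Rightarrow> ('o, 'a) em_ob \<Rightarrow> ('o, 'a) em_ar" +
  fixes F :: "('v, 'o, 'a) biactfun"
  assumes biact: "biact_functor C A S T F"

sublocale biact \<subseteq> F: lax_functor C A A F
  using biact by (rule biactI)

context biact
begin

lemma F_rex: "right_exact A A F"
  using biact by (simp add: biact_functor_def)

lemmas act_arrs [simp] = biact_arr[OF biact]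

lemma la_module: "module_transformation C A A (comp_lax A S F) F (la F)"
  and ra_module: "module_transformation C A A (comp_lax A F T) F (ra F)"
  using biact by (simp_all add: biact_functor_def)

lemma la_natural:
  "\<lbrakk>f \<in> arrs A; trg A f = M\<rbrakk> \<Longrightarrow> la F M \<bullet> far S (far F f) = far F f \<bullet> la F (src A f)"
  using module_transformation_natural[OF la_module] by (auto simp: comp_lax_def)

lemma ra_natural:
  "\<lbrakk>f \<in> arrs A; trg A f = M\<rbrakk> \<Longrightarrow> ra F M \<bullet> far F (far T f) = far F f \<bullet> ra F (src A f)"
  using module_transformation_natural[OF ra_module] by (auto simp: comp_lax_def)

lemma la_lax:
  "\<lbrakk>V \<in> obs C; M \<in> obs A\<rbrakk> \<Longrightarrow>
    la F (V \<rhd> M) \<bullet> far S (lax F V M) \<bullet> lax S V (fob F M) = lax F V M \<bullet> (ide C V \<unrhd> la F M)"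
  using module_transformation_lax[OF la_module] by (simp add: comp_lax_def)

lemma ra_lax:
  "\<lbrakk>V \<in> obs C; M \<in> obs A\<rbrakk> \<Longrightarrow>
    ra F (V \<rhd> M) \<bullet> far F (lax T V M) \<bullet> lax F V (fob T M) = lax F V M \<bullet> (ide C V \<unrhd> ra F M)"
  using module_transformation_lax[OF ra_module] by (simp add: comp_lax_def)

lemma act_laws:
  assumes "M \<in> obs A"
  shows "la F M \<bullet> eta S (fob F M) = ide A (fob F M)"
    "la F M \<bullet> mu S (fob F M) = la F M \<bullet> far S (la F M)"
    "ra F M \<bullet> far F (eta T M) = ide A (fob F M)"
    "ra F M \<bullet> far F (mu T M) = ra F M \<bullet> ra F (fob T M)"
    "la F M \<bullet> far S (ra F M) = ra F M \<bullet> la F (fob T M)"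
  using biact assms by (simp_all add: biact_functor_def)

lemmas la_natural' = A.whisker[OF la_natural]
lemmas ra_natural' = A.whisker[OF ra_natural]

text \<open>The coequalizer is formed in the category of \<open>S\<close>-modules, so its \<open>S\<close>-action comes for free.\<close>

definition alg where "alg M = (fob F M, la F M)"
definition alg_ar where "alg_ar f = (alg (src A f), far F f, alg (trg A f))"
definition ra_alg where "ra_alg M = (alg (fob T M), ra F M, alg M)"

lemma alg_obs [simp]:
  "M \<in> obs A \<Longrightarrow> alg M \<in> obs S.E" "fst (alg M) = fob F M" "snd (alg M) = la F M"
  by (simp_all add: alg_def S.E_obs in_homset act_laws)

lemma alg_ar_arr [simp]:
  "f \<in> arrs A \<Longrightarrow> alg_ar f \<in> arrs S.E" "src S.E (alg_ar f) = alg (src A f)"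
  "trg S.E (alg_ar f) = alg (trg A f)" "und (alg_ar f) = far F f"
  by (auto simp: alg_ar_def la_natural intro!: S.E_arrI)

lemma ra_alg_arr [simp]:
  "M \<in> obs A \<Longrightarrow> ra_alg M \<in> arrs S.E" "src S.E (ra_alg M) = alg (fob T M)"
  "trg S.E (ra_alg M) = alg M" "und (ra_alg M) = ra F M"
  by (auto simp: ra_alg_def act_laws intro!: S.E_arrI)

text \<open>The target \<open>Q X\<close> is the relative tensor product of \<open>F\<close> with
  the \<open>T\<close>-module \<open>X\<close> over \<open>T\<close>, as an
  \<open>S\<close>-module.\<close>

definition p where "p X = (SOME h. is_coequalizer S.E (alg_ar (snd X)) (ra_alg (fst X)) h)"

text \<open>Take the cokernel in \<open>A\<close> of the difference of the two underlying arrows and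
  lift it to \<open>S\<close>-modules by \<open>lift_cokernel\<close>.\<close>

lemma p_coequalizer:
  assumes [simp]: "X \<in> obs T.E"
  shows "is_coequalizer S.E (alg_ar (snd X)) (ra_alg (fst X)) (p X)"
  unfolding p_def
proof (rule someI_ex)
  let ?d = "alg_ar (snd X) \<oplus>\<^bsub>S.E\<^esub> (-1) \<star>\<^bsub>S.E\<^esub> ra_alg (fst X)"
  have d: "?d \<in> arrs S.E"
    by simp
  then obtain k where "is_cokernel A (und ?d) k"
    using A.cokernels[of "und ?d"] S.und_arr(1) by blast
  then obtain Z where "is_cokernel S.E ?d (trg S.E ?d, k, Z)"
    using S.lift_cokernel[OF d] by blast
  then have "is_coequalizer S.E (alg_ar (snd X)) (ra_alg (fst X)) (trg S.E ?d, k, Z)"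
    by (subst S.E.cokernel_diff_iff_coequalizer[symmetric]) simp_all
  then show "\<exists>h. is_coequalizer S.E (alg_ar (snd X)) (ra_alg (fst X)) h" ..
qed

definition Q where "Q X = trg S.E (p X)"

lemma p_arr [simp]:
  assumes "X \<in> obs T.E"
  shows "p X \<in> arrs S.E" "src S.E (p X) = alg (fst X)" "trg S.E (p X) = Q X"
  using S.E.coequalizerD[OF p_coequalizer[OF assms]] assms by (simp_all add: Q_def)

lemma Q_obs [simp]: "X \<in> obs T.E \<Longrightarrow> Q X \<in> obs S.E"
  using S.E.trg_obs[of "p X"] by simp

lemma p_eq: "X \<in> obs T.E \<Longrightarrow> und (p X) \<bullet> far F (snd X) = und (p X) \<bullet> ra F (fst X)"
  using S.und_eq[OF S.E.coequalizerD(7)[OF p_coequalizer]] by simp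

lemmas p_eq' = A.whisker[OF p_eq]
lemmas und_p_coequalizer = S.und_coequalizer[OF p_coequalizer]
lemmas act_p_coequalizer = act_left_coequalizer[OF _ und_p_coequalizer]

lemma p_ext:
  assumes "X \<in> obs T.E" "h \<in> arrs A" "k \<in> arrs A" "src A h = fst (Q X)" "src A k = fst (Q X)"
    "h \<bullet> und (p X) = k \<bullet> und (p X)"
  shows "h = k"
  by (rule A.coequalizer_epi[OF und_p_coequalizer[OF assms(1)]]) (use assms in simp_all)

lemma p_ext_E:
  assumes "X \<in> obs T.E" "h \<in> arrs S.E" "k \<in> arrs S.E" "src S.E h = Q X" "src S.E k = Q X"
    "trg S.E h = trg S.E k" "und h \<bullet> und (p X) = und k \<bullet> und (p X)"
  shows "h = k"
proof (rule S.E_eqI)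
  show "und h = und k"
    by (rule p_ext[OF assms(1)]) (use assms in simp_all)
qed (use assms in simp_all)

text \<open>\<open>V \<unrhd> und (p X)\<close> is a coequalizer in \<open>A\<close>, and
  \<open>q\<close> cancels against \<open>S\<close>-linear arrows. Thus identities with source a
  Linton product of \<open>V\<close> and \<open>Q X\<close> are tested on
  \<open>V \<rhd> F M\<close>, where only \<open>F\<close> and its structure map are
  visible.\<close>

lemma act_p_ext:
  assumes [simp]: "V \<in> obs C" "X \<in> obs T.E" and "h \<in> arrs S.E" "k \<in> arrs S.E"
    "src S.E h = S.ob V (Q X)" "src S.E k = S.ob V (Q X)" "trg S.E h = trg S.E k"
    "und h \<bullet> S.q V (Q X) \<bullet> (ide C V \<unrhd> und (p X)) = und k \<bullet> S.q V (Q X) \<bullet> (ide C V \<unrhd> und (p X))"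
  shows "h = k"
proof (rule S.q_ext[of V "Q X"])
  show "und h \<bullet> S.q V (Q X) = und k \<bullet> S.q V (Q X)"
    by (rule A.coequalizer_epi[OF act_p_coequalizer[of V X]]) (use assms in simp_all)
qed (use assms in simp_all)

text \<open>Linearity of \<open>g\<close> and naturality of the right action show that
  \<open>F g\<close> followed by \<open>p Y\<close> respects the two arrows defining
  \<open>Q X\<close>.\<close>

lemma Q_ar_exists:
  assumes [simp]: "g \<in> arrs T.E" "src T.E g = X" "trg T.E g = Y"
  shows "\<exists>h. h \<in> arrs S.E \<and> src S.E h = Q X \<and> trg S.E h = Q Y \<and> und h \<bullet> und (p X) = und (p Y) \<bullet> far F (und g)"
proof -
  have [simp]: "X \<in> obs T.E" "Y \<in> obs T.E"
    using T.E.src_obs[of g] T.E.trg_obs[of g] by simp_all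
  let ?h = "p Y \<cdot>\<^bsub>S.E\<^esub> alg_ar (und g)"
  have *: "far F (und g) \<bullet> far F (snd X) = far F (snd Y) \<bullet> far F (far T (und g))"
    by (subst F.far_eq[OF T.und_linear[of g X]]) simp_all
  have "?h \<cdot>\<^bsub>S.E\<^esub> alg_ar (snd X) = ?h \<cdot>\<^bsub>S.E\<^esub> ra_alg (fst X)"
    by (rule S.E_eqI) (simp_all add: * p_eq' ra_natural)
  then obtain u where "u \<in> arrs S.E" "src S.E u = Q X" "trg S.E u = Q Y" "u \<cdot>\<^bsub>S.E\<^esub> p X = ?h"
    by (elim S.E.coequalizer_factor[OF p_coequalizer[of X], of ?h, rotated 3]) simp_all
  then show ?thesis
    using S.und_eq[of u "p X" ?h] by (intro exI[of _ u]) simp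
qed

definition Q_ar where "Q_ar g = (SOME h. h \<in> arrs S.E \<and> src S.E h = Q (src T.E g) \<and>
  trg S.E h = Q (trg T.E g) \<and> und h \<bullet> und (p (src T.E g)) = und (p (trg T.E g)) \<bullet> far F (und g))"

lemma Q_ar:
  assumes "g \<in> arrs T.E"
  shows "Q_ar g \<in> arrs S.E" "src S.E (Q_ar g) = Q (src T.E g)" "trg S.E (Q_ar g) = Q (trg T.E g)"
    "src T.E g = X \<Longrightarrow> und (Q_ar g) \<bullet> und (p X) = und (p (trg T.E g)) \<bullet> far F (und g)"
  using someI_ex[OF Q_ar_exists[OF assms refl refl], folded Q_ar_def] by auto

lemmas Q_ar_p' = A.whisker[OF Q_ar(4)]

text \<open>Two descents: along \<open>V \<unrhd> und (p X)\<close> in \<open>A\<close>, giving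
  \<open>u\<close>, and then along \<open>q\<close>, once \<open>u\<close> has been seen to be
  balanced for \<open>S\<close>.\<close>

lemma Q_lax_exists:
  assumes [simp]: "V \<in> obs C" "X \<in> obs T.E"
  shows "\<exists>h. h \<in> arrs S.E \<and> src S.E h = S.ob V (Q X) \<and> trg S.E h = Q (T.ob V X) \<and>
    und h \<bullet> S.q V (Q X) \<bullet> (ide C V \<unrhd> und (p X)) =
      und (p (T.ob V X)) \<bullet> far F (T.q V X) \<bullet> lax F V (fst X)"
proof -
  let ?V = "ide C V" and ?p = "und (p (T.ob V X))" and ?M = "fst X"
  let ?c = "?p \<bullet> far F (T.q V X) \<bullet> lax F V ?M"
  have "far F (T.q V X) \<bullet> far F (?V \<unrhd> snd X) =
      far F (snd (T.ob V X)) \<bullet> far F (far T (T.q V X)) \<bullet> far F (lax T V ?M)"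
    by (subst F.far_eq[OF T.q_balanced[of V X]]) simp_all
  note Fq = A.whisker[OF this]
  \<comment> \<open>Balancedness of \<open>T.q\<close> turns the action of \<open>X\<close> into
    that of the Linton product, \<open>p\<close> exchanges the latter for the right action of
    \<open>F\<close>, and \<open>ra_lax\<close> moves this back before the structure map.\<close>
  have "?c \<bullet> (?V \<unrhd> und (alg_ar (snd X))) = ?c \<bullet> (?V \<unrhd> und (ra_alg ?M))"
    by (simp add: F.lax_natural_ide_rev Fq p_eq' ra_natural' flip: ra_lax)
  then obtain u where u: "u \<in> arrs A" "src A u = V \<rhd> fst (Q X)" "trg A u = fst (Q (T.ob V X))"
    "u \<bullet> (?V \<unrhd> und (p X)) = ?c"
    by (elim A.coequalizer_factor[OF act_p_coequalizer[of V X], of ?c, rotated 4]) simp_all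
  have Su: "far S u \<bullet> far S (?V \<unrhd> und (p X)) =
      far S ?p \<bullet> far S (far F (T.q V X)) \<bullet> far S (lax F V ?M)"
    using u(1-3) by (subst S.fn.far_eq[OF u(4)]) simp_all
  have "u \<bullet> (?V \<unrhd> snd (Q X)) = snd (Q (T.ob V X)) \<bullet> far S u \<bullet> lax S V (fst (Q X))"
  \<comment> \<open>Right exactness of \<open>S\<close> and of \<open>V \<rhd> -\<close> makes the
    image of \<open>p X\<close> cancellable; the identity then reduces to
    \<open>la_lax\<close>.\<close>
  proof (rule A.coequalizer_epi[OF act_left_coequalizer[of V,
        OF _ S.fn.right_exact_coequalizer[OF S.rex und_p_coequalizer[of X]]]])
    have *: "(?V \<unrhd> snd (Q X)) \<bullet> (?V \<unrhd> far S (und (p X))) = (?V \<unrhd> und (p X)) \<bullet> (?V \<unrhd> la F ?M)"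
      by (simp add: S.und_linear_rev flip: act.ide_act_cmp)
    show "(u \<bullet> (?V \<unrhd> snd (Q X))) \<bullet> (?V \<unrhd> far S (und (p X))) =
        (snd (Q (T.ob V X)) \<bullet> far S u \<bullet> lax S V (fst (Q X))) \<bullet> (?V \<unrhd> far S (und (p X)))"
      using u(1-3) by (simp add: * A.whisker[OF u(4)] S.fn.lax_natural_ide_rev A.whisker[OF Su]
        S.und_linear_rev' la_natural' la_lax)
  qed (use u(1-3) in simp_all)
  then obtain h where "h \<in> arrs S.E" "src S.E h = S.ob V (Q X)" "trg S.E h = Q (T.ob V X)"
    "und h \<bullet> S.q V (Q X) = u"
    by (elim S.q_factor[of V "Q X" "Q (T.ob V X)" u, rotated 6]) (use u(1-3) in simp_all)
  then show ?thesis
    using u(4) A.whisker[of "und h" "S.q V (Q X)" u "?V \<unrhd> und (p X)"] by (intro exI[of _ h]) simp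
qed

definition Q_lax where "Q_lax V X = (SOME h. h \<in> arrs S.E \<and> src S.E h = S.ob V (Q X) \<and>
  trg S.E h = Q (T.ob V X) \<and> und h \<bullet> S.q V (Q X) \<bullet> (ide C V \<unrhd> und (p X)) =
    und (p (T.ob V X)) \<bullet> far F (T.q V X) \<bullet> lax F V (fst X))"

lemma Q_lax:
  assumes "V \<in> obs C" "X \<in> obs T.E"
  shows "Q_lax V X \<in> arrs S.E" "src S.E (Q_lax V X) = S.ob V (Q X)"
    "trg S.E (Q_lax V X) = Q (T.ob V X)"
    "und (Q_lax V X) \<bullet> S.q V (Q X) \<bullet> (ide C V \<unrhd> und (p X)) =
      und (p (T.ob V X)) \<bullet> far F (T.q V X) \<bullet> lax F V (fst X)"
  using someI_ex[OF Q_lax_exists[OF assms], folded Q_lax_def] by auto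

lemmas Q_lax_p' = S.double_whisker[OF Q_lax(4)]

definition \<Phi> :: "('v, ('o, 'a) em_ob, ('o, 'a) em_ar, ('o, 'a) em_ob, ('o, 'a) em_ar) laxfun"
  where "\<Phi> = \<lparr>fob = restrict Q (obs T.E), far = restrict Q_ar (arrs T.E),
    lax = (\<lambda>V X. if V \<in> obs C \<and> X \<in> obs T.E then Q_lax V X else undefined)\<rparr>"

lemma \<Phi>_simps [simp]:
  "X \<in> obs T.E \<Longrightarrow> fob \<Phi> X = Q X" "g \<in> arrs T.E \<Longrightarrow> far \<Phi> g = Q_ar g"
  "\<lbrakk>V \<in> obs C; X \<in> obs T.E\<rbrakk> \<Longrightarrow> lax \<Phi> V X = Q_lax V X"
  by (simp_all add: \<Phi>_def)

lemma \<Phi>_linear: "linear_functor T.E S.E \<Phi>"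
  unfolding linear_functor_def
proof (intro conjI allI ballI)
  note [simp] = Q_ar Q_ar_p'
  show "fob \<Phi> X \<in> obs S.E" "far \<Phi> (ide T.E X) = ide S.E (fob \<Phi> X)" if [simp]: "X \<in> obs T.E" for X
    by simp (simp, rule p_ext_E[of X]; simp)
next
  note [simp] = Q_ar Q_ar_p'
  fix X Y Z g g' and c :: 'k
  assume "g \<in> homset T.E X Y"
  then have [simp]: "g \<in> arrs T.E" "src T.E g = X" "trg T.E g = Y" "X \<in> obs T.E" "Y \<in> obs T.E"
    by (auto simp: in_homset)
  show "far \<Phi> g \<in> homset S.E (fob \<Phi> X) (fob \<Phi> Y)"
    by (simp add: in_homset)
  show "far \<Phi> (c \<star>\<^bsub>T.E\<^esub> g) = c \<star>\<^bsub>S.E\<^esub> far \<Phi> g"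
    by simp (rule p_ext_E[of X]; simp add: A.scale_cmp A.cmp_scale)
  show "far \<Phi> (g' \<cdot>\<^bsub>T.E\<^esub> g) = far \<Phi> g' \<cdot>\<^bsub>S.E\<^esub> far \<Phi> g" if "g' \<in> homset T.E Y Z"
  proof -
    have [simp]: "g' \<in> arrs T.E" "src T.E g' = Y" "trg T.E g' = Z" "Z \<in> obs T.E"
      using that by (auto simp: in_homset)
    show ?thesis
      by simp (rule p_ext_E[of X]; simp)
  qed
  show "far \<Phi> (g \<oplus>\<^bsub>T.E\<^esub> g') = far \<Phi> g \<oplus>\<^bsub>S.E\<^esub> far \<Phi> g'" if "g' \<in> homset T.E X Y"
  proof -
    have [simp]: "g' \<in> arrs T.E" "src T.E g' = X" "trg T.E g' = Y"
      using that by (auto simp: in_homset)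
    show ?thesis
      by simp (rule p_ext_E[of X]; simp add: A.plus_cmp A.cmp_plus)
  qed
qed

text \<open>After \<open>act_p_ext\<close>, each axiom becomes the same axiom for \<open>F\<close>,
  combined with the equations that characterize the Linton structure over \<open>T\<close> in the
  source and over \<open>S\<close> in the target.\<close>

lemma \<Phi>_lax: "lax_module_functor C T.E S.E \<Phi>"
  unfolding lax_module_functor_def
proof (intro conjI allI ballI \<Phi>_linear)
  note [simp] = Q_ar(1-3) Q_lax(1-3)
  show "lax \<Phi> V X \<in> homset S.E (V \<rhd>\<^bsub>S.E\<^esub> fob \<Phi> X) (fob \<Phi> (V \<rhd>\<^bsub>T.E\<^esub> X))"
    if "V \<in> obs C" "X \<in> obs T.E" for V X
    using that by (simp add: in_homset)
next
  note [simp] = Q_ar(1-3) Q_lax(1-3)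
  fix V V' X X' f g
  assume "f \<in> homset C V V'" "g \<in> homset T.E X X'"
  then have [simp]: "f \<in> arrs C" "src C f = V" "trg C f = V'" "g \<in> arrs T.E" "src T.E g = X" "trg T.E g = X'"
    "V \<in> obs C" "V' \<in> obs C" "X \<in> obs T.E" "X' \<in> obs T.E"
    by (auto simp: in_homset)
  have "(f \<unrhd> und (Q_ar g)) \<bullet> (ide C V \<unrhd> und (p X)) = (ide C V' \<unrhd> und (p X')) \<bullet> (f \<unrhd> far F (und g))"
    using Q_ar(4)[of g X] by (simp flip: act.act_cmp)
  note 1 = this
  have 2: "far F (und (f \<unrhd>\<^bsub>T.E\<^esub> g)) \<bullet> far F (T.q V X) = far F (T.q V' X') \<bullet> far F (f \<unrhd> und g)"
    by (subst F.far_eq[OF T.act_q[of f g V X]]) simp_all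
  have "Q_ar (f \<unrhd>\<^bsub>T.E\<^esub> g) \<cdot>\<^bsub>S.E\<^esub> Q_lax V X = Q_lax V' X' \<cdot>\<^bsub>S.E\<^esub> (f \<unrhd>\<^bsub>S.E\<^esub> Q_ar g)"
    by (rule act_p_ext[of V X])
      (simp_all add: Q_lax(4) Q_ar_p' A.whisker[OF 2] S.act_q' 1 Q_lax_p' F.lax_natural)
  then show "far \<Phi> (f \<unrhd>\<^bsub>T.E\<^esub> g) \<cdot>\<^bsub>S.E\<^esub> lax \<Phi> V X = lax \<Phi> V' X' \<cdot>\<^bsub>S.E\<^esub> (f \<unrhd>\<^bsub>S.E\<^esub> far \<Phi> g)"
    by simp
next
  note [simp] = Q_ar(1-3) Q_lax(1-3)
  fix V W X
  assume [simp]: "V \<in> obs C" "W \<in> obs C" "X \<in> obs T.E"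
  let ?V = "ide C V" and ?W = "ide C W" and ?M = "fst X" and ?VW = "V \<otimes>\<^bsub>C\<^esub> W"
  have 1: "far F (und (massoc T.E V W X)) \<bullet> far F (T.q ?VW X) =
      far F (T.q V (T.ob W X)) \<bullet> far F (?V \<unrhd> T.q W X) \<bullet> far F (massoc A V W ?M)"
    by (subst F.far_eq[OF T.massoc_q[of V W X]]) simp_all
  have 2: "(?V \<unrhd> und (Q_lax W X)) \<bullet> (?V \<unrhd> S.q W (Q X)) \<bullet> (?V \<unrhd> (?W \<unrhd> und (p X))) =
      (?V \<unrhd> und (p (T.ob W X))) \<bullet> (?V \<unrhd> far F (T.q W X)) \<bullet> (?V \<unrhd> lax F W ?M)"
    using Q_lax(4)[of W X] by (simp flip: act.ide_act_cmp)
  have "Q_ar (massoc T.E V W X) \<cdot>\<^bsub>S.E\<^esub> Q_lax ?VW X =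
      Q_lax V (T.ob W X) \<cdot>\<^bsub>S.E\<^esub> ((?V \<unrhd>\<^bsub>S.E\<^esub> Q_lax W X) \<cdot>\<^bsub>S.E\<^esub> massoc S.E V W (Q X))"
    by (rule act_p_ext[of ?VW X])
      (simp_all add: Q_lax(4) Q_ar_p' A.whisker[OF 1] S.massoc_q' S.act_q_ide' massoc_natural_ide
        S.double_whisker[OF 2] Q_lax_p' F.lax_massoc F.lax_natural_ide_rev F.lax_natural_ide_rev')
  then show "far \<Phi> (massoc T.E V W X) \<cdot>\<^bsub>S.E\<^esub> lax \<Phi> ?VW X =
      lax \<Phi> V (W \<rhd>\<^bsub>T.E\<^esub> X) \<cdot>\<^bsub>S.E\<^esub> (?V \<unrhd>\<^bsub>S.E\<^esub> lax \<Phi> W X) \<cdot>\<^bsub>S.E\<^esub> massoc S.E V W (fob \<Phi> X)"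
    by simp
next
  note [simp] = Q_ar(1-3) Q_lax(1-3)
  fix X
  assume [simp]: "X \<in> obs T.E"
  let ?I = "\<one>\<^bsub>C\<^esub>"
  have 1: "far F (und (munit T.E X)) \<bullet> far F (T.q ?I X) = far F (munit A (fst X))"
    by (subst F.far_eq[OF T.munit_q[of X]]) simp_all
  have "Q_ar (munit T.E X) \<cdot>\<^bsub>S.E\<^esub> Q_lax ?I X = munit S.E (Q X)"
    by (rule act_p_ext[of ?I X])
      (simp_all add: Q_lax(4) Q_ar_p' A.whisker[OF 1] S.munit_q' F.lax_munit munit_natural_arr)
  then show "far \<Phi> (munit T.E X) \<cdot>\<^bsub>S.E\<^esub> lax \<Phi> ?I X = munit S.E (fob \<Phi> X)"
    by simp
qed

text \<open>An interchange of colimits: \<open>Q\<close> is a coequalizer of functors that preserve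
  cokernels. An arrow \<open>h\<close> killing \<open>far \<Phi> f\<close> is pulled back along
  \<open>p\<close>, descends along \<open>F e\<close> to \<open>k\<close>, and then from
  \<open>F\<close> to \<open>Q\<close> at the target of \<open>e\<close>.\<close>

lemma \<Phi>_right_exact: "right_exact T.E S.E \<Phi>"
  unfolding right_exact_def
proof (intro conjI allI impI \<Phi>_linear)
  note [simp] = Q_ar(1-3)
  interpret P: linfunctor T.E S.E \<Phi>
    using \<Phi>_linear by unfold_locales
  fix f e assume coker: "is_cokernel T.E f e"
  note [simp] = T.E.cokernelD(1-3)[OF coker]
  have Fe: "is_cokernel A (far F (und f)) (far F (und e))"
    using F_rex T.und_cokernel[OF coker] by (simp add: right_exact_def)
  have FTe: "is_cokernel A (far F (far T (und f))) (far F (far T (und e)))"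
    using F_rex T.far_cokernel[OF T.und_cokernel[OF coker]] by (simp add: right_exact_def)
  have SFe: "is_cokernel A (far S (far F (und f))) (far S (far F (und e)))"
    by (rule S.far_cokernel[OF Fe])
  let ?Y = "trg T.E f" and ?Z = "trg T.E e"
  show "is_cokernel S.E (far \<Phi> f) (far \<Phi> e)"
  proof (rule S.E.cokernelI)
    have "far \<Phi> e \<cdot>\<^bsub>S.E\<^esub> far \<Phi> f = far \<Phi> (zro T.E (src T.E f) ?Z)"
      by (intro P.far_eq[OF T.E.cokernelD(4)[OF coker]]) simp_all
    also have "\<dots> = zro S.E (fob \<Phi> (src T.E f)) (fob \<Phi> ?Z)"
      by (rule P.far_zro) simp_all
    finally show "far \<Phi> e \<cdot>\<^bsub>S.E\<^esub> far \<Phi> f = zro S.E (src S.E (far \<Phi> f)) (trg S.E (far \<Phi> e))"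
      by simp
  next
    fix h assume h: "h \<in> arrs S.E" "src S.E h = trg S.E (far \<Phi> f)"
      "h \<cdot>\<^bsub>S.E\<^esub> far \<Phi> f = zro S.E (src S.E (far \<Phi> f)) (trg S.E h)"
    then have [simp]: "h \<in> arrs S.E" "src S.E h = Q ?Y"
      by simp_all
    let ?W = "trg S.E h"
    have "und h \<bullet> und (Q_ar f) = zro A (fst (Q (src T.E f))) (fst ?W)"
      using S.und_eq[OF h(3)] by simp
    from A.whisker[OF this, of "und (p (src T.E f))"]
    have "(und h \<bullet> und (p ?Y)) \<bullet> far F (und f) = zro A (fob F (fst (src T.E f))) (fst ?W)"
      by (simp add: Q_ar(4))
    then obtain k where k: "k \<in> arrs A" "src A k = fob F (fst ?Z)" "trg A k = fst ?W"
      "k \<bullet> far F (und e) = und h \<bullet> und (p ?Y)"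
      using A.cokernel_factor[OF Fe, of "und h \<bullet> und (p ?Y)"] by auto
    have Sk: "far S k \<bullet> far S (far F (und e)) = far S (und h) \<bullet> far S (und (p ?Y))"
      using k(1-3) by (subst S.fn.far_eq[OF k(4)]) simp_all
    \<comment> \<open>Linearity of \<open>k\<close> is tested after the image of \<open>e\<close>
      under \<open>F\<close> and then \<open>S\<close>, still a cokernel.\<close>
    have "k \<bullet> la F (fst ?Z) = snd ?W \<bullet> far S k"
      by (rule A.cokernel_epi[OF SFe])
        (use k(1-3) in \<open>simp_all add: la_natural A.whisker[OF k(4)] Sk S.und_linear_rev' S.und_linear_rev\<close>)
    then have K: "(alg (fst ?Z), k, ?W) \<in> arrs S.E"
      using k(1-3) by (intro S.E_arrI) simp_all
    have n: "far F (snd ?Z) \<bullet> far F (far T (und e)) = far F (und e) \<bullet> far F (snd ?Y)"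
      using F.far_eq[OF T.und_linear[of e ?Y]] by simp
    \<comment> \<open>Here the test arrow is the image of \<open>e\<close> under \<open>T\<close>
      and then \<open>F\<close>; the relation for \<open>p\<close> at the source of \<open>e\<close>
      supplies the equality.\<close>
    have "k \<bullet> far F (snd ?Z) = k \<bullet> ra F (fst ?Z)"
      by (rule A.cokernel_epi[OF FTe])
        (use k(1-3) in \<open>simp_all add: n A.whisker[OF k(4)] p_eq ra_natural\<close>)
    then have "(alg (fst ?Z), k, ?W) \<cdot>\<^bsub>S.E\<^esub> alg_ar (snd ?Z) = (alg (fst ?Z), k, ?W) \<cdot>\<^bsub>S.E\<^esub> ra_alg (fst ?Z)"
      by (intro S.E_eqI) simp_all
    then obtain u where u: "u \<in> arrs S.E" "src S.E u = Q ?Z" "trg S.E u = ?W"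
      "u \<cdot>\<^bsub>S.E\<^esub> p ?Z = (alg (fst ?Z), k, ?W)"
      by (elim S.E.coequalizer_factor[OF p_coequalizer[of ?Z], of "(alg (fst ?Z), k, ?W)", rotated 3])
        (use K k(1-3) in simp_all)
    have up: "und u \<bullet> und (p ?Z) = k"
      using S.und_eq[OF u(4)] by simp
    have "u \<cdot>\<^bsub>S.E\<^esub> Q_ar e = h"
      by (rule p_ext_E[of ?Y]) (use u(1-3) k in \<open>simp_all add: Q_ar(4) A.whisker[OF up]\<close>)
    then show "\<exists>u. u \<in> arrs S.E \<and> src S.E u = trg S.E (far \<Phi> e) \<and> trg S.E u = trg S.E h \<and>
        u \<cdot>\<^bsub>S.E\<^esub> far \<Phi> e = h"
      using u(1-3) by (intro exI[of _ u]) simp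
  next
    fix u v
    assume uv: "u \<in> arrs S.E" "v \<in> arrs S.E" "src S.E u = trg S.E (far \<Phi> e)"
      "src S.E v = trg S.E (far \<Phi> e)" "trg S.E u = trg S.E v"
      "u \<cdot>\<^bsub>S.E\<^esub> far \<Phi> e = v \<cdot>\<^bsub>S.E\<^esub> far \<Phi> e"
    have "und u \<bullet> und (Q_ar e) = und v \<bullet> und (Q_ar e)"
      using S.und_eq[OF uv(6)] by simp
    from A.whisker[OF this, of "und (p ?Y)"]
    have *: "und u \<bullet> und (p ?Z) \<bullet> far F (und e) = und v \<bullet> und (p ?Z) \<bullet> far F (und e)"
      using uv(1-5) by (simp add: Q_ar(4))
    have "und u \<bullet> und (p ?Z) = und v \<bullet> und (p ?Z)"
      by (rule A.cokernel_epi[OF Fe]) (use uv(1-5) * in simp_all)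
    then show "u = v"
      by - (rule p_ext_E[of ?Z], use uv(1-5) in simp_all)
  qed simp_all
qed

end

section \<open>The comparison isomorphism at free modules\<close>

sublocale biact \<subseteq> W: right_exact_lax C A S prS T prT \<Phi>
  using \<Phi>_lax \<Phi>_right_exact by unfold_locales

context biact
begin

text \<open>At a free module, associativity of the right action says that \<open>ra F M\<close>
  identifies the two arrows whose coequalizer is \<open>p\<close>.\<close>

lemma comparison_exists:
  assumes [simp]: "M \<in> obs A"
  shows "\<exists>e. e \<in> arrs A \<and> src A e = fst (Q (free_ob T M)) \<and> trg A e = fob F M \<and>
    e \<bullet> und (p (free_ob T M)) = ra F M"
proof -
  have "ra F M \<bullet> und (alg_ar (snd (free_ob T M))) = ra F M \<bullet> und (ra_alg (fst (free_ob T M)))"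
    by (simp add: act_laws)
  then show ?thesis
    using A.coequalizer_factor[OF und_p_coequalizer[of "free_ob T M"], of "ra F M"] by auto
qed

definition e where "e M = (if M \<in> obs A then SOME e. e \<in> arrs A \<and> src A e = fst (Q (free_ob T M)) \<and>
  trg A e = fob F M \<and> e \<bullet> und (p (free_ob T M)) = ra F M else undefined)"

lemma e [simp]:
  assumes "M \<in> obs A"
  shows "e M \<in> arrs A" "src A (e M) = fst (Q (free_ob T M))" "trg A (e M) = fob F M"
    "e M \<bullet> und (p (free_ob T M)) = ra F M"
  using someI_ex[OF comparison_exists[OF assms]] assms by (auto simp: e_def)

lemmas e' = A.whisker[OF e(4)]

text \<open>Each identity is tested after \<open>p\<close>, \<open>V \<unrhd> und p\<close> or
  \<open>far S (und p)\<close>, where \<open>e\<close> turns into \<open>ra F\<close> and the laws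
  of a biact functor apply.\<close>

lemma e_morphism: "biact_morphism C A S T W.G F e"
proof -
  note [simp] = Q_ar(1-3) Q_lax(1-3)
  have "module_transformation C A A W.G F e"
  proof (rule module_transformationI)
    fix f assume [simp]: "f \<in> arrs A"
    show "e (trg A f) \<bullet> far W.G f = far F f \<bullet> e (src A f)"
      by (rule p_ext[of "free_ob T (src A f)"]) (simp_all add: Q_ar(4) e' ra_natural)
  next
    fix V M assume [simp]: "V \<in> obs C" "M \<in> obs A"
    let ?X = "free_ob T M" and ?V = "ide C V"
    show "e (V \<rhd> M) \<bullet> lax W.G V M = lax F V M \<bullet> (?V \<unrhd> e M)"
    proof (rule A.coequalizer_epi[OF act_p_coequalizer[of V ?X]])
      have 1: "far F (und (lax T.L V M)) \<bullet> far F (T.q V ?X) = far F (lax T V M)"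
        by (intro F.far_eq T.lax_L) simp_all
      have 2: "(?V \<unrhd> e M) \<bullet> (?V \<unrhd> und (p ?X)) = ?V \<unrhd> ra F M"
        by (simp flip: act.ide_act_cmp)
      show "(e (V \<rhd> M) \<bullet> lax W.G V M) \<bullet> (?V \<unrhd> und (p ?X)) = (lax F V M \<bullet> (?V \<unrhd> e M)) \<bullet> (?V \<unrhd> und (p ?X))"
        by (simp add: Q_lax(4) Q_ar_p' e' A.whisker[OF 1] 2 ra_lax)
    qed simp_all
  qed (simp_all add: A.linear_category_axioms)
  moreover have "e M \<bullet> snd (Q (free_ob T M)) = la F M \<bullet> far S (e M)" if [simp]: "M \<in> obs A" for M
  proof (rule A.coequalizer_epi[OF S.fn.right_exact_coequalizer[OF S.rex
        und_p_coequalizer[of "free_ob T M"]]])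
    have "far S (e M) \<bullet> far S (und (p (free_ob T M))) = far S (ra F M)"
      by (intro S.fn.far_eq) simp_all
    then show "(e M \<bullet> snd (Q (free_ob T M))) \<bullet> far S (und (p (free_ob T M))) =
        (la F M \<bullet> far S (e M)) \<bullet> far S (und (p (free_ob T M)))"
      by (simp add: S.und_linear_rev e' act_laws)
  qed simp_all
  moreover have "e M \<bullet> und (Q_ar (counit T (free_ob T M))) = ra F M \<bullet> e (fob T M)" if [simp]: "M \<in> obs A" for M
    by (rule p_ext[of "free_ob T (fob T M)"]) (simp_all add: Q_ar(4) e' act_laws)
  ultimately show ?thesis
    by (simp add: biact_morphism_def)
qed

definition d where "d M = (if M \<in> obs A then und (p (free_ob T M)) \<bullet> far F (eta T M) else undefined)"

lemma d [simp]:
  assumes [simp]: "M \<in> obs A"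
  shows "d M \<in> arrs A" "src A (d M) = fob F M" "trg A (d M) = fst (Q (free_ob T M))"
    "e M \<bullet> d M = ide A (fob F M)" "d M \<bullet> e M = ide A (fst (Q (free_ob T M)))"
proof -
  show d: "d M \<in> arrs A" "src A (d M) = fob F M" "trg A (d M) = fst (Q (free_ob T M))"
    by (simp_all add: d_def)
  show "e M \<bullet> d M = ide A (fob F M)"
    by (simp add: d_def e' act_laws)
  show "d M \<bullet> e M = ide A (fst (Q (free_ob T M)))"
  proof (rule p_ext[of "free_ob T M"])
    \<comment> \<open>After \<open>p\<close>, naturality moves the unit past \<open>ra F\<close>;
      the relation for \<open>p\<close> replaces \<open>ra F\<close> by
      \<open>far F (mu T M)\<close>, which cancels against the unit.\<close>
    have "far F (eta T M) \<bullet> ra F M = ra F (fob T M) \<bullet> far F (far T (eta T M))"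
      by (simp add: ra_natural)
    moreover have "far F (mu T M) \<bullet> far F (far T (eta T M)) = ide A (fob F (fob T M))"
      by (subst F.far_eq[OF T.monad_laws(2)]) simp_all
    ultimately show "(d M \<bullet> e M) \<bullet> und (p (free_ob T M)) =
        ide A (fst (Q (free_ob T M))) \<bullet> und (p (free_ob T M))"
      using p_eq'[of "free_ob T M" "far F (far T (eta T M))"] by (simp add: d_def)
  qed (use d in simp_all)
qed

lemmas d' = d(4,5)[THEN A.whisker]

text \<open>Compatibility passes formally from \<open>e\<close> to its inverse: every equation is
  tested after \<open>e\<close>, \<open>V \<unrhd> e\<close> or \<open>far S e\<close>, all of them
  isomorphisms.\<close>

lemma d_morphism: "biact_morphism C A S T F W.G d"
proof -
  note [simp] = Q_ar(1-3) Q_lax(1-3)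
  note mod = biact_morphism_module[OF e_morphism] and eqs = biact_morphism_eqs[OF e_morphism]
  have iso: "is_iso A (e M)" if "M \<in> obs A" for M
    using that by (intro A.isoI[of _ "d M"]) simp_all
  have "module_transformation C A A F W.G d"
  proof (rule module_transformationI)
    fix f assume [simp]: "f \<in> arrs A"
    show "d (trg A f) \<bullet> far F f = far W.G f \<bullet> d (src A f)"
    proof (rule A.iso_epi[OF iso])
      show "(d (trg A f) \<bullet> far F f) \<bullet> e (src A f) = (far W.G f \<bullet> d (src A f)) \<bullet> e (src A f)"
        using module_transformation_natural[OF mod, of f "src A f", symmetric] by (simp add: d')
    qed simp_all
  next
    fix V M assume [simp]: "V \<in> obs C" "M \<in> obs A"
    let ?V = "ide C V"
    show "d (V \<rhd> M) \<bullet> lax F V M = lax W.G V M \<bullet> (?V \<unrhd> d M)"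
    proof (rule A.iso_epi)
      have *: "(?V \<unrhd> d M) \<bullet> (?V \<unrhd> e M) = ide A (V \<rhd> fst (Q (free_ob T M)))"
        by (simp flip: act.ide_act_cmp)
      moreover have "(?V \<unrhd> e M) \<bullet> (?V \<unrhd> d M) = ide A (V \<rhd> fob F M)"
        by (simp flip: act.ide_act_cmp)
      ultimately show "is_iso A (?V \<unrhd> e M)"
        by (intro A.isoI[of _ "?V \<unrhd> d M"]) simp_all
      show "(d (V \<rhd> M) \<bullet> lax F V M) \<bullet> (?V \<unrhd> e M) = (lax W.G V M \<bullet> (?V \<unrhd> d M)) \<bullet> (?V \<unrhd> e M)"
        using module_transformation_lax[OF mod, of V M, symmetric] by (simp add: * d')
    qed simp_all
  qed (simp_all add: A.linear_category_axioms)
  moreover have "d M \<bullet> la F M = snd (Q (free_ob T M)) \<bullet> far S (d M)" if [simp]: "M \<in> obs A" for M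
  proof (rule A.iso_epi[OF S.fn.far_iso[OF iso]])
    have "far S (d M) \<bullet> far S (e M) = far S (ide A (fst (Q (free_ob T M))))"
      by (intro S.fn.far_eq) simp_all
    then show "(d M \<bullet> la F M) \<bullet> far S (e M) = (snd (Q (free_ob T M)) \<bullet> far S (d M)) \<bullet> far S (e M)"
      using eqs(1)[of M, symmetric] by (simp add: d')
  qed simp_all
  moreover have "d M \<bullet> ra F M = und (Q_ar (counit T (free_ob T M))) \<bullet> d (fob T M)" if [simp]: "M \<in> obs A" for M
  proof (rule A.iso_epi[OF iso])
    show "(d M \<bullet> ra F M) \<bullet> e (fob T M) = (und (Q_ar (counit T (free_ob T M))) \<bullet> d (fob T M)) \<bullet> e (fob T M)"
      using eqs(2)[of M, symmetric] by (simp add: d')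
  qed simp_all
  ultimately show ?thesis
    by (simp add: biact_morphism_def)
qed

lemma \<Phi>_in_LaxRex: "\<Phi> \<in> obs (LaxRex C T.E S.E)"
  using \<Phi>_lax \<Phi>_right_exact by (simp add: LaxRex_def lax_extensional_def) (simp add: \<Phi>_def)

end

context linton_pair
begin

lemma K_surjective:
  assumes F: "F \<in> obs (Biact C A S T)"
  shows "\<exists>\<Phi> \<in> obs (LaxRex C T.E S.E). \<exists>h \<in> homset (Biact C A S T) (fob K \<Phi>) F. is_iso (Biact C A S T) h"
proof -
  interpret biact C A S prS T prT F
    using F by unfold_locales (simp add: Biact_def)
  interpret B: linear_category "Biact C A S T"
    by (rule linear_Biact)
  have G: "W.G \<in> obs (Biact C A S T)"
    by (rule W.CEW_ob_in_Biact)
  have e_hom: "(W.G, e, F) \<in> homset (Biact C A S T) W.G F"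
    using F G e_morphism unfolding Biact_def in_transformation_category by (auto simp: e_def extensional_def)
  have d_hom: "(F, d, W.G) \<in> homset (Biact C A S T) F W.G"
    using F G d_morphism unfolding Biact_def in_transformation_category by (auto simp: d_def extensional_def)
  have "is_iso (Biact C A S T) (W.G, e, F)"
  proof (rule B.isoI[of _ "(F, d, W.G)"])
    show "(F, d, W.G) \<cdot>\<^bsub>Biact C A S T\<^esub> (W.G, e, F) = ide (Biact C A S T) (src (Biact C A S T) (W.G, e, F))"
      "(W.G, e, F) \<cdot>\<^bsub>Biact C A S T\<^esub> (F, d, W.G) = ide (Biact C A S T) (trg (Biact C A S T) (W.G, e, F))"
      by (auto simp: Biact_def intro!: restrict_ext)
  qed (use e_hom d_hom in \<open>simp_all add: in_homset\<close>)
  then show ?thesis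
    using e_hom \<Phi>_in_LaxRex by (auto simp: fob_K)
qed

lemma K_equivalence:
  "equivalence_of_categories (LaxRex C T.E S.E) (Biact C A S T) K"
  by (intro equivalence_of_categoriesI linear_category_LaxRex linear_Biact K_linear K_faithful K_full
    K_surjective T.Em.module_action_axioms S.Em.module_action_axioms)

end

theorem theorem6p10:
  fixes C :: "('v, 'w, 'k::field) moncat"
    and A :: "('v, 'w, 'o, 'a, 'k) modcat"
    and S T :: "('v, 'o, 'a) laxmonad"
    and prS prT :: "'v \<Rightarrow> ('o, 'a) em_ob \<Rightarrow> ('o, 'a) em_ar"
  assumes "abelian_monoidal_category C"
    and "abelian_module_category C A"
    and "lax_module_monad C A S" and "right_exact A A S"
    and "lax_module_monad C A T" and "right_exact A A T"
    and "linton_coequalizers C A S prS"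
    and "linton_coequalizers C A T prT"
  shows "faithful (LaxRex C (EMmod C A T prT) (EMmod C A S prS)) (CEW C A S prS T prT)
       \<and> equivalence_of_categories
           (LaxRex C (EMmod C A T prT) (EMmod C A S prS))
           (Biact C A S T)
           (CEW C A S prS T prT)"
proof -
  interpret abelian_module_category C A by fact
  interpret linton_pair C A S prS T prT
    using assms by unfold_locales
  show ?thesis
    using K_faithful K_equivalence ..
qed

end
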